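(* Let $X,Y\subseteq I$ and $w\in W_I$. Let $w=w_1w_2w_2'$ with $w_1\in W_X$, $w_2'\in W_Y$ and $w_2\in W_I$ an $(X,Y)$-reduced element. Write $\omega=\kappa_I(w)$, $\omega_1=\kappa_I(w_1)$ and $\omega_2'=\kappa_I(w_2')$. Let $X_1\subseteq X$ and $Y_1\subseteq Y$ be the subsets determined by $S_{X_1}=w_2S_Yw_2^{-1}\cap S_X$ and $w_2S_{Y_1}w_2^{-1}=S_{X_1}$. Then $$\omega A_Y\omega^{-1}\cap A_X=\omega_1A_{X_1}\omega_1^{-1}\quad\text{and}\quad \omega^{-1}A_X\omega\cap A_Y=(\omega_2')^{-1}A_{Y_1}\omega_2'.$$
   Context: $\Gamma=(I,E,m)$ is a finite simplicial graph with edge labelling $m:E\to\mathbb{N}_{\ge 2}$; write $m(i,j)=m(\{i,j\})$. The Artin-Tits group $A_I$ is generated by $\Sigma_I=\{\sigma_i\mid i\in I\}$ with relations $\sigma_i\sigma_j\sigma_i\cdots=\sigma_j\sigma_i\sigma_j\cdots$ ($m(i,j)$ terms on each side) for $\{i,j\}\in E$; the Coxeter group $W_I$ is generated by $S_I=\{s_i\mid i\in I\}$ with the corresponding relations $s_is_js_i\cdots=s_js_is_j\cdots$ together with $s_i^2=1$. The set $S_I$ is identified with its image in $W_I$. For $X\subseteq I$, $S_X=\{s_i\mid i\in X\}$, and $A_X\subseteq A_I$ and $W_X\subseteq W_I$ are the subgroups generated by $\{\sigma_i\mid i\in X\}$ and $S_X$ respectively. An element $w\in W_I$ is $(X,Y)$-reduced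 if it is the (unique) element of minimal length (with respect to $S_I$) in the double coset $W_XwW_Y$. The map $\kappa_I:W_I\to A_I$ is the set section of the morphism $A_I\to W_I$, $\sigma_i\mapsto s_i$, defined by $\kappa_I(w)=\sigma_{i_1}\cdots\sigma_{i_k}$ for any reduced (i.e. minimal length) word $s_{i_1}\cdots s_{i_k}$ representing $w$; this does not depend on the chosen reduced word. *)

theory Defs
  imports "HOL-Algebra.Generated_Groups" "HOL-Algebra.Coset"
begin

section \<open>Groups given by generators and relations\<close>

text \<open>A letter \<open>(x, True)\<close> stands for the generator \<open>x\<close> and \<open>(x, False)\<close> for its formal inverse;
  a relation is a pair of words that are to become equal.\<close>

type_synonym 'a signed_word = "('a \<times> bool) list"

abbreviation signed_words :: "'a set \<Rightarrow> 'a signed_word set"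
  where "signed_words S \<equiv> lists (S \<times> UNIV)"

inductive pres_eq :: "'a set \<Rightarrow> ('a signed_word \<times> 'a signed_word) set \<Rightarrow> 'a signed_word \<Rightarrow> 'a signed_word \<Rightarrow> bool"
  for S R
where
  rel: "(u, v) \<in> R \<Longrightarrow> u \<in> signed_words S \<Longrightarrow> v \<in> signed_words S \<Longrightarrow> pres_eq S R u v"
| cancel: "x \<in> S \<Longrightarrow> pres_eq S R [(x, b), (x, \<not> b)] []"
| refl: "u \<in> signed_words S \<Longrightarrow> pres_eq S R u u"
| sym: "pres_eq S R u v \<Longrightarrow> pres_eq S R v u"
| trans: "pres_eq S R u v \<Longrightarrow> pres_eq S R v w \<Longrightarrow> pres_eq S R u w"
| append: "pres_eq S R u v \<Longrightarrow> pres_eq S R u' v' \<Longrightarrow> pres_eq S R (u @ u') (v @ v')"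

definition pres_class :: "'a set \<Rightarrow> ('a signed_word \<times> 'a signed_word) set \<Rightarrow> 'a signed_word \<Rightarrow> 'a signed_word set"
  where "pres_class S R u = {v. pres_eq S R u v}"

definition presented_group :: "'a set \<Rightarrow> ('a signed_word \<times> 'a signed_word) set \<Rightarrow> 'a signed_word set monoid"
  where "presented_group S R =
    \<lparr> carrier = pres_class S R ` signed_words S,
      mult = (\<lambda>U V. \<Union>u\<in>U. \<Union>v\<in>V. pres_class S R (u @ v)),
      one = pres_class S R [] \<rparr>"

definition pres_gen :: "'a set \<Rightarrow> ('a signed_word \<times> 'a signed_word) set \<Rightarrow> 'a \<Rightarrow> 'a signed_word set"
  where "pres_gen S R x = pres_class S R [(x, True)]"

lemma pres_eq_words:
  "pres_eq S R u v \<Longrightarrow> u \<in> signed_words S \<and> v \<in> signed_words S"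
  by (induction rule: pres_eq.induct) auto

lemma pres_class_eq_iff:
  assumes "u \<in> signed_words S"
  shows "pres_class S R u = pres_class S R v \<longleftrightarrow> pres_eq S R u v"
proof
  assume "pres_class S R u = pres_class S R v"
  moreover have "u \<in> pres_class S R u"
    using assms by (simp only: pres_class_def mem_Collect_eq pres_eq.refl)
  ultimately show "pres_eq S R u v"
    by (simp only: pres_class_def mem_Collect_eq pres_eq.sym)
next
  assume "pres_eq S R u v"
  then show "pres_class S R u = pres_class S R v"
    unfolding pres_class_def by (intro Collect_cong) (meson pres_eq.trans pres_eq.sym)
qed

lemma presented_group_mult:
  assumes "u \<in> signed_words S" "v \<in> signed_words S"
  shows "pres_class S R u \<otimes>\<^bsub>presented_group S R\<^esub> pres_class S R v = pres_class S R (u @ v)"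
proof -
  have "pres_class S R (u' @ v') = pres_class S R (u @ v)"
    if "u' \<in> pres_class S R u" "v' \<in> pres_class S R v" for u' v'
  proof -
    have "pres_eq S R u u'" "pres_eq S R v v'"
      using that by (simp_all only: pres_class_def mem_Collect_eq)
    then have "pres_eq S R (u @ v) (u' @ v')" by (rule pres_eq.append)
    moreover have "u @ v \<in> signed_words S" using assms by (simp only: append_in_lists_conv)
    ultimately show ?thesis using pres_class_eq_iff by blast
  qed
  moreover have "u \<in> pres_class S R u" "v \<in> pres_class S R v"
    using assms by (simp_all only: pres_class_def mem_Collect_eq pres_eq.refl)
  ultimately have "(\<Union>u'\<in>pres_class S R u. \<Union>v'\<in>pres_class S R v. pres_class S R (u' @ v')) =
      pres_class S R (u @ v)"
    by blast
  then show ?thesis by (simp only: presented_group_def monoid.simps)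
qed

lemma pres_eq_inverse:
  assumes "u \<in> signed_words S"
  shows "pres_eq S R (rev (map (\<lambda>(x, b). (x, \<not> b)) u) @ u) []"
  using assms
proof (induction u rule: list.induct)
  case Nil
  then show ?case by (simp add: pres_eq.refl)
next
  case (Cons a u)
  obtain x b where a: "a = (x, b)" by force
  let ?U = "rev (map (\<lambda>(x, b). (x, \<not> b)) u)"
  have U: "?U \<in> signed_words S" and u: "u \<in> signed_words S" and x: "x \<in> S"
    using Cons.prems[unfolded a] by (auto simp: in_lists_conv_set)
  have "pres_eq S R ([(x, \<not> b), (x, b)] @ u) ([] @ u)"
    using pres_eq.cancel[OF x, of R "\<not> b"] pres_eq.refl[OF u] by (intro pres_eq.append) auto
  then have "pres_eq S R (?U @ [(x, \<not> b), (x, b)] @ u) (?U @ [] @ u)"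
    by (rule pres_eq.append[OF pres_eq.refl[OF U]])
  then have "pres_eq S R (?U @ [(x, \<not> b), (x, b)] @ u) []"
    using Cons.IH[OF u] by (simp only: append_Nil) (rule pres_eq.trans)
  then show ?case by (simp add: a)
qed

lemma group_presented_group: "group (presented_group S R)"
proof (rule groupI)
  let ?G = "presented_group S R"
  have car: "carrier ?G = pres_class S R ` signed_words S" and one: "\<one>\<^bsub>?G\<^esub> = pres_class S R []"
    by (simp_all add: presented_group_def)
  have carE: "\<exists>u\<in>signed_words S. x = pres_class S R u" if "x \<in> carrier ?G" for x
    using that unfolding car by blast
  have one_word: "[] \<in> signed_words S" by simp
  have app: "u @ v \<in> signed_words S" if "u \<in> signed_words S" "v \<in> signed_words S" for u v
    using that by (simp only: append_in_lists_conv)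
  show "x \<otimes>\<^bsub>?G\<^esub> y \<in> carrier ?G" if xy: "x \<in> carrier ?G" "y \<in> carrier ?G" for x y
  proof -
    obtain u v where "u \<in> signed_words S" "x = pres_class S R u" "v \<in> signed_words S" "y = pres_class S R v"
      using carE[OF xy(1)] carE[OF xy(2)] by blast
    then show ?thesis unfolding car by (simp only: presented_group_mult app imageI)
  qed
  show "\<one>\<^bsub>?G\<^esub> \<in> carrier ?G" unfolding car one by (rule imageI[OF one_word])
  show "x \<otimes>\<^bsub>?G\<^esub> y \<otimes>\<^bsub>?G\<^esub> z = x \<otimes>\<^bsub>?G\<^esub> (y \<otimes>\<^bsub>?G\<^esub> z)"
    if xyz: "x \<in> carrier ?G" "y \<in> carrier ?G" "z \<in> carrier ?G" for x y z
  proof -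
    obtain t u v where "t \<in> signed_words S" "x = pres_class S R t" "u \<in> signed_words S"
      "y = pres_class S R u" "v \<in> signed_words S" "z = pres_class S R v"
      using carE[OF xyz(1)] carE[OF xyz(2)] carE[OF xyz(3)] by blast
    then show ?thesis by (simp only: presented_group_mult app append_assoc)
  qed
  show "\<one>\<^bsub>?G\<^esub> \<otimes>\<^bsub>?G\<^esub> x = x" if x: "x \<in> carrier ?G" for x
  proof -
    obtain u where "u \<in> signed_words S" "x = pres_class S R u"
      using carE[OF x] by blast
    then show ?thesis by (simp only: one presented_group_mult[OF one_word] append_Nil)
  qed
  show "\<exists>y\<in>carrier ?G. y \<otimes>\<^bsub>?G\<^esub> x = \<one>\<^bsub>?G\<^esub>" if x: "x \<in> carrier ?G" for x
  proof -
    obtain u where u: "u \<in> signed_words S" "x = pres_class S R u"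
      using x unfolding car by auto
    let ?U = "rev (map (\<lambda>(x, b). (x, \<not> b)) u)"
    have U: "?U \<in> signed_words S" using u(1) by auto
    have "pres_class S R ?U \<otimes>\<^bsub>?G\<^esub> x = \<one>\<^bsub>?G\<^esub>"
      using pres_eq_inverse[OF u(1), of R]
      by (simp only: u(2) one presented_group_mult[OF U u(1)] pres_class_eq_iff app[OF U u(1)])
    then show ?thesis using U unfolding car by blast
  qed
qed

lemma presented_group_relation:
  assumes "(u, v) \<in> R" "u \<in> signed_words S" "v \<in> signed_words S"
  shows "pres_class S R u = pres_class S R v"
  using assms by (simp only: pres_class_eq_iff pres_eq.rel)

lemma presented_group_universal:
  fixes H (structure)
  assumes "group H" and f: "\<And>x. x \<in> S \<Longrightarrow> f x \<in> carrier H"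
    and R: "\<And>u v. (u, v) \<in> R \<Longrightarrow> u \<in> signed_words S \<Longrightarrow> v \<in> signed_words S \<Longrightarrow>
      foldr (\<otimes>) (map (\<lambda>(x, b). if b then f x else inv (f x)) u) \<one> =
      foldr (\<otimes>) (map (\<lambda>(x, b). if b then f x else inv (f x)) v) \<one>"
  shows "\<exists>h\<in>hom (presented_group S R) H. \<forall>x\<in>S. h (pres_gen S R x) = f x"
proof -
  interpret group H by fact
  define e where "e u = foldr (\<otimes>) (map (\<lambda>(x, b). if b then f x else inv (f x)) u) \<one>" for u
  have e_cl: "e u \<in> carrier H" if "u \<in> signed_words S" for u
    using that by (induction u rule: list.induct) (auto simp: e_def f)
  have e_app: "e (u @ v) = e u \<otimes> e v" if "u \<in> signed_words S" "v \<in> signed_words S" for u v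
    using that(1)
  proof (induction u rule: list.induct)
    case Nil
    then show ?case using e_cl[OF that(2)] by (simp add: e_def)
  next
    case (Cons a u)
    obtain x b where a: "a = (x, b)" by force
    let ?g = "if b then f x else inv (f x)"
    have "e (a # u @ v) = ?g \<otimes> e (u @ v)" "e (a # u) = ?g \<otimes> e u" by (simp_all add: e_def a)
    moreover have "?g \<in> carrier H" using Cons.prems[unfolded a] f by (auto simp: in_lists_conv_set)
    ultimately show ?case using Cons e_cl that(2) by (simp add: m_assoc)
  qed
  have e_eq: "e u = e v" if "pres_eq S R u v" for u v
    using that
  proof (induction rule: pres_eq.induct)
    case (rel u v) then show ?case unfolding e_def by (rule R)
  next
    case (cancel x b) then show ?case by (simp add: e_def f)
  next
    case (append u v u' v')
    then show ?case using pres_eq_words[OF append.hyps(1)] pres_eq_words[OF append.hyps(2)]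
      by (simp only: e_app)
  qed auto
  define h where "h U = e (SOME u. u \<in> U)" for U
  have h: "h (pres_class S R u) = e u" if "u \<in> signed_words S" for u
  proof -
    have "u \<in> pres_class S R u" using that by (simp add: pres_class_def pres_eq.refl)
    then have "(SOME u'. u' \<in> pres_class S R u) \<in> pres_class S R u" by (rule someI)
    then show ?thesis unfolding h_def using e_eq by (simp add: pres_class_def)
  qed
  have "h \<in> hom (presented_group S R) H"
  proof (rule homI)
    have car: "carrier (presented_group S R) = pres_class S R ` signed_words S"
      by (simp add: presented_group_def)
    show "h x \<in> carrier H" if "x \<in> carrier (presented_group S R)" for x
      using that unfolding car by (elim imageE) (simp only: h e_cl)
    show "h (x \<otimes>\<^bsub>presented_group S R\<^esub> y) = h x \<otimes> h y"
      if "x \<in> carrier (presented_group S R)" "y \<in> carrier (presented_group S R)" for x y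
      using that unfolding car
      by (elim imageE) (simp only: h e_app presented_group_mult append_in_lists_conv simp_thms)
  qed
  moreover have "\<forall>x\<in>S. h (pres_gen S R x) = f x"
    by (simp add: pres_gen_def h) (simp add: e_def f)
  ultimately show ?thesis by blast
qed


section \<open>Artin-Tits groups and Coxeter groups\<close>

text \<open>Edges are two-element sets of vertices. The labelling is only constrained on edges, its
  other values are never used.\<close>

record 'a labelled_graph =
  verts :: "'a set"
  edges :: "'a set set"
  label :: "'a set \<Rightarrow> nat"

definition finite_labelled_graph :: "'a labelled_graph \<Rightarrow> bool"
  where "finite_labelled_graph \<Gamma> \<longleftrightarrow>
    finite (verts \<Gamma>) \<and>
    (\<forall>e\<in>edges \<Gamma>. e \<subseteq> verts \<Gamma> \<and> card e = 2) \<and>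
    (\<forall>e\<in>edges \<Gamma>. 2 \<le> label \<Gamma> e)"

text \<open>\<open>alternating i j n\<close> is the word \<open>i j i \<dots>\<close> with \<open>n\<close> letters.\<close>

fun alternating :: "'a \<Rightarrow> 'a \<Rightarrow> nat \<Rightarrow> 'a list"
  where
    "alternating i j 0 = []"
  | "alternating i j (Suc n) = i # alternating j i n"

definition braid_rels :: "'a labelled_graph \<Rightarrow> ('a signed_word \<times> 'a signed_word) set"
  where "braid_rels \<Gamma> =
    {(map (\<lambda>k. (k, True)) (alternating i j (label \<Gamma> {i, j})),
      map (\<lambda>k. (k, True)) (alternating j i (label \<Gamma> {i, j}))) | i j. {i, j} \<in> edges \<Gamma>}"

definition coxeter_rels :: "'a labelled_graph \<Rightarrow> ('a signed_word \<times> 'a signed_word) set"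
  where "coxeter_rels \<Gamma> = braid_rels \<Gamma> \<union> {([(i, True), (i, True)], []) | i. i \<in> verts \<Gamma>}"

definition artin_group :: "'a labelled_graph \<Rightarrow> 'a signed_word set monoid"
  where "artin_group \<Gamma> = presented_group (verts \<Gamma>) (braid_rels \<Gamma>)"

definition coxeter_group :: "'a labelled_graph \<Rightarrow> 'a signed_word set monoid"
  where "coxeter_group \<Gamma> = presented_group (verts \<Gamma>) (coxeter_rels \<Gamma>)"

definition artin_gen :: "'a labelled_graph \<Rightarrow> 'a \<Rightarrow> 'a signed_word set"
  where "artin_gen \<Gamma> = pres_gen (verts \<Gamma>) (braid_rels \<Gamma>)"

definition coxeter_gen :: "'a labelled_graph \<Rightarrow> 'a \<Rightarrow> 'a signed_word set"
  where "coxeter_gen \<Gamma> = pres_gen (verts \<Gamma>) (coxeter_rels \<Gamma>)"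

definition artin_parabolic :: "'a labelled_graph \<Rightarrow> 'a set \<Rightarrow> 'a signed_word set set"
  where "artin_parabolic \<Gamma> X = generate (artin_group \<Gamma>) (artin_gen \<Gamma> ` X)"

definition coxeter_parabolic :: "'a labelled_graph \<Rightarrow> 'a set \<Rightarrow> 'a signed_word set set"
  where "coxeter_parabolic \<Gamma> X = generate (coxeter_group \<Gamma>) (coxeter_gen \<Gamma> ` X)"

definition artin_word :: "'a labelled_graph \<Rightarrow> 'a list \<Rightarrow> 'a signed_word set"
  where "artin_word \<Gamma> ks =
    foldr (mult (artin_group \<Gamma>)) (map (artin_gen \<Gamma>) ks) \<one>\<^bsub>artin_group \<Gamma>\<^esub>"

definition coxeter_word :: "'a labelled_graph \<Rightarrow> 'a list \<Rightarrow> 'a signed_word set"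
  where "coxeter_word \<Gamma> ks =
    foldr (mult (coxeter_group \<Gamma>)) (map (coxeter_gen \<Gamma>) ks) \<one>\<^bsub>coxeter_group \<Gamma>\<^esub>"

text \<open>The generators of the Coxeter group are involutions, so positive words suffice for the
  word length.\<close>

definition coxeter_length :: "'a labelled_graph \<Rightarrow> 'a signed_word set \<Rightarrow> nat"
  where "coxeter_length \<Gamma> w =
    (LEAST n. \<exists>ks\<in>lists (verts \<Gamma>). coxeter_word \<Gamma> ks = w \<and> length ks = n)"

definition reduced_word :: "'a labelled_graph \<Rightarrow> 'a signed_word set \<Rightarrow> 'a list \<Rightarrow> bool"
  where "reduced_word \<Gamma> w ks \<longleftrightarrow>
    ks \<in> lists (verts \<Gamma>) \<and> coxeter_word \<Gamma> ks = w \<and> length ks = coxeter_length \<Gamma> w"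

text \<open>By Matsumoto's theorem, all reduced words of \<open>w\<close> give the same element of the Artin-Tits
  group, so the description below is proper on the Coxeter group.\<close>

definition kappa :: "'a labelled_graph \<Rightarrow> 'a signed_word set \<Rightarrow> 'a signed_word set"
  where "kappa \<Gamma> w = (THE \<omega>. \<exists>ks. reduced_word \<Gamma> w ks \<and> \<omega> = artin_word \<Gamma> ks)"

text \<open>Uniqueness of the minimal-length element in a double coset is a theorem and is not part of
  the definition.\<close>

definition double_coset_reduced :: "'a labelled_graph \<Rightarrow> 'a set \<Rightarrow> 'a set \<Rightarrow> 'a signed_word set \<Rightarrow> bool"
  where "double_coset_reduced \<Gamma> X Y w \<longleftrightarrow>
    w \<in> carrier (coxeter_group \<Gamma>) \<and>
    (\<forall>v \<in> (coxeter_parabolic \<Gamma> X #>\<^bsub>coxeter_group \<Gamma>\<^esub> w) <#>\<^bsub>coxeter_group \<Gamma>\<^esub> coxeter_parabolic \<Gamma> Y.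
      coxeter_length \<Gamma> w \<le> coxeter_length \<Gamma> v)"

definition conjugate_set :: "('g, 'b) monoid_scheme \<Rightarrow> 'g \<Rightarrow> 'g set \<Rightarrow> 'g set"
  where "conjugate_set G g H = (g <#\<^bsub>G\<^esub> H) #>\<^bsub>G\<^esub> inv\<^bsub>G\<^esub> g"

end

theory Submission
  imports Defs Complex_Main
begin

text \<open>The proof rests on a walk on minimal coset representatives. Let \<open>D\<close> be the set of elements of the
  Coxeter group that are minimal in their coset \<open>d W\<^sub>Y\<close>. By Deodhar's lemma a generator \<open>s\<^sub>i\<close>
  either maps \<open>d \<in> D\<close> to another element of \<open>D\<close>, or \<open>s\<^sub>i d = d s\<^sub>k\<close> for some \<open>k \<in> Y\<close>. In
  the first case let \<open>\<sigma>\<^sub>i\<close> move \<open>d\<close> to \<open>s\<^sub>i d\<close>; in the second case let it stay at \<open>d\<close> and put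
  out \<open>\<sigma>\<^sub>k\<close>. This is compatible with the braid relations (\<open>emitted_braid\<close>, \<open>signed_output_pres_eq\<close>), so
  every element of the Artin-Tits group, walked from a given \<open>d\<close>, has a well-defined output in \<open>A\<^sub>Y\<close>.

  Let \<open>h\<close> be \<open>(X, Y)\<close>-reduced and suppose \<open>g \<kappa>(h) = \<kappa>(h) s\<close> with \<open>g \<in> A\<^sub>X\<close> and \<open>s \<in> A\<^sub>Y\<close>. Walked from the
  identity, the right-hand side puts out \<open>s\<close>. The left-hand side goes to \<open>h\<close> without output and then
  continues with letters of \<open>X\<close>, and these can only put out letters \<open>k \<in> Y\<close> with \<open>h s\<^sub>k h\<^sup>-\<^sup>1 \<in> S\<^sub>X\<close>. Hence
  \<open>s\<close> lies in the parabolic subgroup of \<open>Y\<^sub>1\<close>, which \<open>\<kappa>(h)\<close> conjugates onto that of \<open>X\<^sub>1\<close>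
  (\<open>parabolic_Int_minimal_conjugate\<close>).

  An arbitrary \<open>w = w\<^sub>1 h w'\<close> has a factorization \<open>w = u h v\<close> with the same \<open>h\<close> in which lengths add up, so
  that \<open>\<kappa>(w) = \<kappa>(u) \<kappa>(h) \<kappa>(v)\<close>, and \<open>w\<^sub>1 = u c\<close>, again with lengths adding up, where \<open>c\<close> is in the parabolic
  subgroup of \<open>X\<^sub>1\<close> (\<open>double_coset_factorization\<close>). The outer factors are absorbed by the
  parabolic subgroups, and the general case follows. The second equation uses the mirrored
  factorization.

  The facts on Coxeter groups are derived from the geometric representation. Applied to a positive
  function, the operator of an element has a negative coordinate at \<open>i\<close> precisely if \<open>i\<close> is a left descent
  (\<open>coordinate_pos_iff\<close>). Matsumoto's theorem follows by looking at two coordinates, additivity of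
  length over parabolic cosets by looking at the coordinates in \<open>X\<close>, and the exchange property, hence
  Deodhar's lemma, from the rigidity of functionals that are positive on positive functions.\<close>

section \<open>The geometric representation\<close>

locale coxeter_matrix =
  fixes m :: "'a \<Rightarrow> 'a \<Rightarrow> nat"
  assumes m_sym: "m i j = m j i"
    and m_ne_1: "i \<noteq> j \<Longrightarrow> m i j \<noteq> 1"
begin

text \<open>Twice the Tits form on the simple roots. The label \<open>0\<close> stands for \<open>\<infinity>\<close>, where the angle
  \<open>\<pi> / m\<close> degenerates to \<open>0\<close>.\<close>

definition bil :: "'a \<Rightarrow> 'a \<Rightarrow> real"
  where "bil i k = (if i = k then 2 else if m i k = 0 then -2 else - 2 * cos (pi / m i k))"

text \<open>The action on the dual of the root space: \<open>f\<close> lists the values of a functional on the simple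
  roots. In the dual, the sign of a coordinate detects a descent.\<close>

definition reflection :: "'a \<Rightarrow> ('a \<Rightarrow> real) \<Rightarrow> 'a \<Rightarrow> real"
  where "reflection i f = (\<lambda>k. f k - f i * bil i k)"

definition act :: "'a list \<Rightarrow> ('a \<Rightarrow> real) \<Rightarrow> 'a \<Rightarrow> real"
  where "act ks = foldr (\<lambda>i g. reflection i \<circ> g) ks id"

lemma act_Nil [simp]: "act [] = id"
  by (simp add: act_def)

lemma act_Cons: "act (i # ks) = reflection i \<circ> act ks"
  by (simp add: act_def)

lemma act_append: "act (ks @ ls) = act ks \<circ> act ls"
  by (induction ks) (simp_all add: act_Cons o_assoc)

lemma bil_self [simp]: "bil i i = 2"
  by (simp add: bil_def)

lemma bil_sym: "bil i k = bil k i"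
  by (simp add: bil_def m_sym[of i k])

lemma m_ge_2: "i \<noteq> j \<Longrightarrow> m i j \<noteq> 0 \<Longrightarrow> m i j \<ge> 2"
  using m_ne_1[of i j] by linarith

lemma bil_nonpos:
  assumes "i \<noteq> k"
  shows "bil i k \<le> 0"
proof (cases "m i k = 0")
  case False
  then have "m i k \<ge> 2" using assms m_ge_2 by blast
  then have "pi / m i k \<le> pi / 2" by (intro divide_left_mono) auto
  then have "cos (pi / m i k) \<ge> 0" using \<open>m i k \<ge> 2\<close> by (intro cos_ge_zero) (auto simp: divide_le_eq, smt (verit) divide_nonneg_nonneg of_nat_0_le_iff pi_ge_zero)
  then show ?thesis using assms False by (simp add: bil_def)
qed (use assms in \<open>simp add: bil_def\<close>)

lemma reflection_reflection [simp]: "reflection i (reflection i f) = f"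
  by (simp add: reflection_def fun_eq_iff)

lemma reflection_comp_reflection [simp]: "reflection i \<circ> reflection i = id"
  by (simp add: fun_eq_iff)

lemma reflection_self [simp]: "reflection i f i = - f i"
  by (simp add: reflection_def)

lemma reflection_inj:
  assumes "reflection k = reflection l"
  shows "k = l"
proof (rule ccontr)
  assume "k \<noteq> l"
  have "reflection k (\<lambda>_. 1) l = reflection l (\<lambda>_. 1) l" using assms by simp
  then show False using bil_nonpos[OF \<open>k \<noteq> l\<close>] by (simp add: reflection_def)
qed

lemma act_linear: "act ks (\<lambda>x. f x + c * g x) = (\<lambda>x. act ks f x + c * act ks g x)"
  by (induction ks) (simp_all add: act_Cons reflection_def algebra_simps)

lemma act_rev_act [simp]: "act (rev ks) (act ks f) = f"
  by (induction ks arbitrary: f) (simp_all add: act_Cons act_append)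

lemma act_act_rev [simp]: "act ks (act (rev ks) f) = f"
  using act_rev_act[of "rev ks"] by simp

lemma act_rev_comp [simp]: "act (rev ks) \<circ> act ks = id" "act ks \<circ> act (rev ks) = id"
  by (simp_all add: fun_eq_iff)

lemma act_rev_cong:
  assumes "act ks = act ls"
  shows "act (rev ks) = act (rev ls)"
proof
  fix f
  have "act (rev ks) (act ls (act (rev ls) f)) = act (rev ls) f" by (simp flip: assms)
  then show "act (rev ks) f = act (rev ls) f" by simp
qed

lemma act_cancel_left: "act ks \<circ> f = act ks \<circ> g \<longleftrightarrow> f = g"
  by (metis act_rev_comp(1) comp_assoc id_comp)

lemma act_cancel_right: "f \<circ> act ks = g \<circ> act ks \<longleftrightarrow> f = g"
  by (metis act_rev_comp(2) comp_assoc comp_id)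

lemma act_move_left: "act (ks @ ls) = act us \<longleftrightarrow> act ls = act (rev ks @ us)"
  by (metis act_append act_rev_comp(1) act_rev_comp(2) comp_assoc id_comp)

lemma act_move_right: "act (ls @ ks) = act us \<longleftrightarrow> act ls = act (us @ rev ks)"
  by (metis act_append act_rev_comp(1) act_rev_comp(2) comp_assoc comp_id)

lemma act_Cons_Cons [simp]: "act (i # i # ks) = act ks"
  by (simp add: act_Cons o_assoc)

text \<open>The coordinates in \<open>X\<close> evolve among themselves under the generators in \<open>X\<close>. This is what
  makes length additive over parabolic cosets later on.\<close>

lemma act_local:
  assumes "set zs \<subseteq> X" "x \<in> X" "\<And>x. x \<in> X \<Longrightarrow> f x = g x"
  shows "act zs f x = act zs g x"
  using assms(1,2) by (induction zs arbitrary: x) (simp_all add: act_Cons reflection_def assms(3))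

section \<open>Alternating words\<close>

text \<open>The Chebyshev polynomials of the second kind at \<open>cos (\<pi> / n)\<close>, shifted by one: they are the
  coefficients of the roots of a dihedral group. The case \<open>n = 0\<close> is the limit for the infinite
  dihedral group. Real arguments allow the index \<open>-1\<close>.\<close>

definition chebyshev :: "nat \<Rightarrow> real \<Rightarrow> real"
  where "chebyshev n t = (if n = 0 then t else sin (t * pi / n) / sin (pi / n))"

lemma sin_pi_div_pos: "n \<ge> 2 \<Longrightarrow> sin (pi / real n) > 0"
  by (intro sin_gt_zero) (simp_all add: field_simps)

lemma chebyshev_rec:
  assumes "i \<noteq> j"
  shows "chebyshev (m i j) (t + 1) = - bil i j * chebyshev (m i j) t - chebyshev (m i j) (t - 1)"
proof (cases "m i j = 0")
  case False
  define \<theta> where "\<theta> = pi / m i j"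
  have "sin ((t + 1) * \<theta>) + sin ((t - 1) * \<theta>) = 2 * cos \<theta> * sin (t * \<theta>)"
    by (simp add: algebra_simps sin_add sin_diff)
  moreover have "chebyshev (m i j) s = sin (s * \<theta>) / sin \<theta>" for s
    using False by (simp add: chebyshev_def \<theta>_def)
  moreover have "- bil i j = 2 * cos \<theta>" using assms False by (simp add: bil_def \<theta>_def)
  ultimately show ?thesis by (metis (no_types, lifting) add_diff_cancel_right' add_divide_distrib times_divide_eq_right)
qed (use assms in \<open>simp add: chebyshev_def bil_def\<close>)

lemma chebyshev_0 [simp]: "chebyshev n 0 = 0"
  by (simp add: chebyshev_def)

lemma chebyshev_1 [simp]: "n \<noteq> 1 \<Longrightarrow> chebyshev n 1 = 1"
  using sin_pi_div_pos[of n] by (cases "n = 0") (auto simp: chebyshev_def)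

lemma chebyshev_minus: "chebyshev n (- t) = - chebyshev n t"
  by (simp add: chebyshev_def)

lemma chebyshev_pos:
  fixes t :: real
  assumes "n = 0 \<or> t < n" "n \<noteq> 1" "0 < t"
  shows "chebyshev n t > 0"
proof (cases "n = 0")
  case False
  then have "sin (pi / n) > 0" using assms(2) by (intro sin_pi_div_pos) auto
  moreover have "sin (t * pi / n) > 0"
    using assms False by (intro sin_gt_zero) (auto simp: field_simps)
  ultimately show ?thesis using False by (simp add: chebyshev_def)
qed (use assms in \<open>simp add: chebyshev_def\<close>)

lemma chebyshev_nonneg:
  fixes t :: real
  assumes "n = 0 \<or> t \<le> n" "n \<noteq> 1" "0 \<le> t"
  shows "chebyshev n t \<ge> 0"
proof (cases "n = 0 \<or> t < n")
  case True
  then show ?thesis using chebyshev_pos[of n t] assms by (cases "t = 0") auto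
next
  case False
  then have "t = n" using assms by simp
  then show ?thesis by (simp add: chebyshev_def)
qed

text \<open>Applying the two reflections in turn runs the recursion of \<open>chebyshev\<close>: the coordinate that
  is next to be reflected is the new term, and the one that was reflected last is the negative of the
  previous term.\<close>

lemma act_alternating:
  assumes "i \<noteq> j"
  shows "act (alternating i j n) f j =
      chebyshev (m i j) (real n + 1) * f (if odd n then i else j) + chebyshev (m i j) n * f (if odd n then j else i)"
    and "act (alternating i j n) f i =
      - (chebyshev (m i j) n * f (if odd n then i else j) + chebyshev (m i j) (real n - 1) * f (if odd n then j else i))"
  using assms
proof (induction n arbitrary: i j)
  case 0
  {
    case 1
    then show ?case using m_ne_1 by simp
  next
    case 2
    then show ?case using m_ne_1[of i j] chebyshev_minus[of "m i j" 1] by simp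
  }
next
  case (Suc n)
  {
    case 1
    define p q where "p = f (if odd (Suc n) then i else j)" and "q = f (if odd (Suc n) then j else i)"
    define U where "U = chebyshev (m i j)"
    let ?g = "act (alternating j i n) f"
    have "?g i = U (real n + 1) * p + U n * q" "?g j = - (U n * p + U (real n - 1) * q)"
      using Suc.IH[of j i] 1 by (simp_all add: m_sym[of j i] p_def q_def U_def)
    then have "act (alternating i j (Suc n)) f j =
        (- bil i j * U (real n + 1) - U n) * p + (- bil i j * U n - U (real n - 1)) * q"
      by (simp add: act_Cons reflection_def algebra_simps)
    also have "- bil i j * U n - U (real n - 1) = U (real n + 1)"
      using chebyshev_rec[OF 1] by (simp add: U_def)
    also have "- bil i j * U (real n + 1) - U n = U (real (Suc n) + 1)"
      using chebyshev_rec[OF 1, of "real n + 1"] by (simp add: U_def algebra_simps)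
    finally show ?case by (simp add: p_def q_def U_def algebra_simps)
  next
    case 2
    then show ?case using Suc.IH[of j i]
      by (simp add: act_Cons m_sym[of j i] algebra_simps)
  }
qed

lemma act_pair:
  assumes "set zs \<subseteq> {i, j}"
  shows "\<exists>a b. \<forall>k. act zs f k = f k - a * bil i k - b * bil j k"
  using assms
proof (induction zs)
  case Nil
  show ?case by (intro exI[of _ 0]) simp
next
  case (Cons x zs)
  then obtain a b where ab: "\<forall>k. act zs f k = f k - a * bil i k - b * bil j k" by auto
  show ?case
  proof (cases "x = i")
    case True
    then show ?thesis
      by (intro exI[of _ "a + act zs f i"] exI[of _ b]) (simp add: act_Cons reflection_def ab algebra_simps)
  next
    case False
    then have "x = j" using Cons.prems by simp
    then show ?thesis
      by (intro exI[of _ a] exI[of _ "b + act zs f j"]) (simp add: act_Cons reflection_def ab algebra_simps)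
  qed
qed

lemma set_alternating: "set (alternating i j n) \<subseteq> {i, j}"
  by (induction n arbitrary: i j) auto

lemma length_alternating [simp]: "length (alternating i j n) = n"
  by (induction n arbitrary: i j) auto

lemma alternating_add:
  "alternating i j (a + b) = alternating i j a @ (if even a then alternating i j b else alternating j i b)"
  by (induction a arbitrary: i j) auto

lemma rev_alternating:
  "rev (alternating i j n) = (if odd n then alternating i j n else alternating j i n)"
proof (induction n arbitrary: i j)
  case (Suc n)
  have "alternating a b (Suc n) = alternating a b n @ (if even n then [a] else [b])" for a b :: 'b
    using alternating_add[of a b n "Suc 0"] by simp
  from this[of i j] this[of j i] show ?case using Suc[of i j] Suc[of j i] by auto
qed simp

text \<open>After \<open>m i j\<close> steps the two coordinates \<open>i\<close> and \<open>j\<close> do not depend on the letter that came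
  first. All other coordinates are determined by them, since by \<open>act_pair\<close> the displacement lies
  in a plane on which the form is nondegenerate.\<close>

theorem braid_relation:
  assumes "i \<noteq> j" "m i j \<noteq> 0"
  shows "act (alternating i j (m i j)) = act (alternating j i (m i j))"
proof
  fix f
  let ?n = "m i j"
  have n: "?n \<ge> 2" using m_ge_2 assms by blast
  define \<theta> where "\<theta> = pi / ?n"
  have s: "sin \<theta> > 0" using sin_pi_div_pos[OF n] by (simp add: \<theta>_def)
  have n\<theta>: "?n * \<theta> = pi" using assms by (simp add: \<theta>_def)
  have ch: "chebyshev ?n t = sin (t * \<theta>) / sin \<theta>" for t
    using assms by (simp add: chebyshev_def \<theta>_def)
  have ch_n: "chebyshev ?n ?n = 0" by (simp add: ch n\<theta>)
  have "(real ?n + 1) * \<theta> = \<theta> + pi" "(real ?n - 1) * \<theta> = pi - \<theta>"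
    using n\<theta> by (simp_all add: algebra_simps)
  then have ch_n1: "chebyshev ?n (real ?n + 1) = - 1" and ch_n2: "chebyshev ?n (real ?n - 1) = 1"
    using s by (simp_all add: ch algebra_simps)
  let ?g = "act (alternating i j ?n) f" and ?h = "act (alternating j i ?n) f"
  have gh: "?g i = ?h i" "?g j = ?h j"
    using act_alternating[OF assms(1), of ?n f] act_alternating[OF assms(1)[symmetric], of ?n f] n
    by (auto simp: m_sym[of j i] ch_n ch_n1 ch_n2)
  obtain a b where ab: "\<And>k. ?g k = f k - a * bil i k - b * bil j k"
    using act_pair[OF set_alternating] by blast
  have "set (alternating j i ?n) \<subseteq> {i, j}" using set_alternating by fast
  then obtain a' b' where ab': "\<And>k. ?h k = f k - a' * bil i k - b' * bil j k"
    using act_pair by blast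
  define c where "c = bil i j"
  have c: "c = - 2 * cos \<theta>" using assms by (simp add: c_def bil_def \<theta>_def)
  \<comment> \<open>The form restricted to the plane is nondegenerate, so the two coordinates that agree
    determine the displacement.\<close>
  have det: "4 - c\<^sup>2 = 4 * (sin \<theta>)\<^sup>2"
    by (simp add: c power_mult_distrib sin_squared_eq)
  have e1: "2 * (a - a') + c * (b - b') = 0" and e2: "c * (a - a') + 2 * (b - b') = 0"
    using gh ab[of i] ab'[of i] ab[of j] ab'[of j]
    by (simp_all add: c_def bil_sym[of j i] algebra_simps)
  have "(4 - c\<^sup>2) * (a - a') = 2 * (2 * (a - a') + c * (b - b')) - c * (c * (a - a') + 2 * (b - b'))"
    by (simp add: algebra_simps power2_eq_square)
  then have "(4 - c\<^sup>2) * (a - a') = 0" by (simp only: e1 e2)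
  moreover have "(4 - c\<^sup>2) * (b - b') = 2 * (c * (a - a') + 2 * (b - b')) - c * (2 * (a - a') + c * (b - b'))"
    by (simp add: algebra_simps power2_eq_square)
  then have "(4 - c\<^sup>2) * (b - b') = 0" by (simp only: e1 e2)
  ultimately have "a = a'" "b = b'" using s by (simp_all add: det)
  show "?g = ?h" using \<open>a = a'\<close> \<open>b = b'\<close> ab ab' by (simp add: fun_eq_iff)
qed

section \<open>Length and the sign of coordinates\<close>

text \<open>Words are compared through their operators. That this is equality in the Coxeter group is the
  faithfulness statement \<open>coxeter_word_eq_iff\<close>.\<close>

definition len :: "'a list \<Rightarrow> nat"
  where "len ks = (LEAST n. \<exists>ls. act ls = act ks \<and> length ls = n)"

definition reduced :: "'a list \<Rightarrow> bool"
  where "reduced ks \<longleftrightarrow> len ks = length ks"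

lemma len_cong: "act ks = act ls \<Longrightarrow> len ks = len ls"
  by (simp add: len_def)

lemma len_le: "act ls = act ks \<Longrightarrow> len ks \<le> length ls"
  unfolding len_def by (rule Least_le) auto

lemma reduced_word_exists: "\<exists>ls. act ls = act ks \<and> length ls = len ks"
  unfolding len_def by (rule LeastI_ex) auto

lemma len_append_le: "len (ks @ ls) \<le> len ks + len ls"
proof -
  obtain ks' ls' where "act ks' = act ks" "length ks' = len ks" "act ls' = act ls" "length ls' = len ls"
    using reduced_word_exists by metis
  then show ?thesis using len_le[of "ks' @ ls'" "ks @ ls"] by (simp add: act_append)
qed

lemma len_le_length: "len ks \<le> length ks"
  by (rule len_le) simp

lemma len_Nil [simp]: "len [] = 0"
  using len_le_length[of "[]"] by simp

lemma len_eq_0: "len ks = 0 \<longleftrightarrow> act ks = id"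
  using reduced_word_exists[of ks] len_cong[of ks "[]"] by auto

lemma len_Cons_le: "len (i # ks) \<le> Suc (len ks)"
  using len_append_le[of "[i]" ks] len_le_length[of "[i]"] by simp

lemma len_Cons_Cons [simp]: "len (i # i # ks) = len ks"
  by (rule len_cong) simp

lemma len_le_Cons: "len ks \<le> Suc (len (i # ks))"
  using len_Cons_le[of i "i # ks"] by simp

lemma reduced_ConsD:
  assumes "reduced (i # ks)"
  shows "reduced ks"
  using assms len_Cons_le[of i ks] len_le_length[of ks] by (simp add: reduced_def)

lemma reduced_appendD:
  assumes "reduced (ks @ ls)"
  shows "reduced ks" "reduced ls"
  using assms len_append_le[of ks ls] len_le_length[of ks] len_le_length[of ls]
  by (simp_all add: reduced_def)

lemma len_rev: "len (rev ks) = len ks"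
proof -
  have "len (rev ks) \<le> len ks" for ks
  proof -
    obtain ls where "act ls = act ks" "length ls = len ks" using reduced_word_exists by blast
    then show ?thesis using len_le[of "rev ls" "rev ks"] act_rev_cong[of ls ks] by simp
  qed
  from this[of ks] this[of "rev ks"] show ?thesis by simp
qed

text \<open>Left descents in \<open>X\<close> are stripped off until none is left. The inequality at the end is weak
  because it is not known yet that multiplication by a generator changes the length.\<close>

lemma parabolic_decomposition:
  "\<exists>zs us. set zs \<subseteq> X \<and> act ks = act (zs @ us) \<and> length zs + len us = len ks \<and>
    (\<forall>x\<in>X. len us \<le> len (x # us))"
  proof (induction "len ks" arbitrary: ks rule: less_induct)
    case less
    show ?case
    proof (cases "\<forall>x\<in>X. len ks \<le> len (x # ks)")
      case True
      then show ?thesis by (intro exI[of _ "[]"] exI[of _ ks]) simp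
    next
      case False
      then obtain x where x: "x \<in> X" "len (x # ks) < len ks" by auto
      obtain zs us where zs: "set zs \<subseteq> X" "act (x # ks) = act (zs @ us)"
        "length zs + len us = len (x # ks)" "\<forall>x\<in>X. len us \<le> len (x # us)"
        using less[OF x(2)] by blast
      have "act ks = reflection x \<circ> act (x # ks)" by (simp add: act_Cons o_assoc)
      then have "act ks = act ((x # zs) @ us)" using zs(2) by (simp add: act_Cons)
      then show ?thesis using x zs len_le_Cons[of ks x]
        by (intro exI[of _ "x # zs"] exI[of _ us]) auto
    qed
qed

lemma reduced_pair_alternating:
  assumes "set zs \<subseteq> {i, j}" "reduced zs"
  shows "\<exists>n. zs = alternating i j n \<or> zs = alternating j i n"
  using assms
proof (induction zs)
  case Nil
  show ?case by (intro exI[of _ 0]) simp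
next
  case (Cons k zs)
  then obtain n where n: "zs = alternating i j n \<or> zs = alternating j i n"
    using reduced_ConsD by auto
  have k: "k \<in> {i, j}" using Cons.prems by simp
  have no_repeat: "zs \<noteq> k # ls" for ls
    using Cons.prems(2) len_Cons_Cons[of k ls] len_le_length[of ls] by (auto simp: reduced_def)
  show ?case
  proof (cases n)
    case 0
    then show ?thesis using n k by (intro exI[of _ 1]) auto
  next
    case (Suc n')
    then show ?thesis using n k no_repeat by (intro exI[of _ "Suc n"]) auto
  qed
qed

text \<open>The theorem of Tits. A generator \<open>j\<close> that is a left descent is different from \<open>i\<close>, so the
  longest prefix in the dihedral group of \<open>i\<close> and \<open>j\<close> can be split off. The rest is shorter and, by
  induction, has positive coordinates at both letters; the prefix is an alternating word that starts
  with \<open>j\<close> and has fewer than \<open>m i j\<close> letters, as otherwise the braid relation would bring \<open>i\<close> to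
  the front. For such words the Chebyshev coefficients are positive.\<close>

lemma coordinate_pos:
  assumes "len ks \<le> len (i # ks)" "\<And>k. f k > 0"
  shows "act ks f i > 0"
  using assms(1)
proof (induction "len ks" arbitrary: ks i rule: less_induct)
  case less
  show ?case
  proof (cases "len ks = 0")
    case True
    then show ?thesis using assms(2) len_eq_0[of ks] by simp
  next
    case False
    obtain ls where ls: "act ls = act ks" "length ls = len ks" using reduced_word_exists by blast
    then obtain j ls' where j: "ls = j # ls'" using False by (cases ls) auto
    have "act (j # ks) = act ls'" using ls(1)[symmetric] by (simp add: j act_Cons o_assoc)
    then have "len (j # ks) \<le> length ls'" using len_le by metis
    then have jd: "len (j # ks) < len ks" using ls(2) j by simp
    then have "i \<noteq> j" using less.prems by auto
    obtain zs us where zs: "set zs \<subseteq> {i, j}" "act ks = act (zs @ us)"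
      "length zs + len us = len ks" "\<forall>x\<in>{i, j}. len us \<le> len (x # us)"
      using parabolic_decomposition[of "{i, j}" ks] by blast
    define g where "g = act us f"
    have "zs \<noteq> []" using zs(4) len_cong[of "j # ks" "j # us"] jd zs(2,3) by (auto simp: act_Cons)
    then have "len us < len ks" using zs(3) by (cases zs) auto
    then have g: "g i > 0" "g j > 0" using less.hyps[of us] zs(4) by (auto simp: g_def)
    have zred: "reduced zs"
      using zs(2,3) len_append_le[of zs us] len_le_length[of zs] len_cong[of ks "zs @ us"]
      by (simp add: reduced_def)
    have no_i: "act zs \<noteq> act (i # ys)" if "length ys < length zs" for ys
    proof
      assume "act zs = act (i # ys)"
      then have "act (i # ks) = act (ys @ us)" using zs(2) by (simp add: act_Cons act_append o_assoc)
      then have "len (i # ks) < len ks"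
        using zs(3) that len_append_le[of ys us] len_le_length[of ys] len_cong[of "i # ks" "ys @ us"] by simp
      then show False using less.prems by simp
    qed
    obtain n where "zs = alternating i j n \<or> zs = alternating j i n"
      using reduced_pair_alternating[OF zs(1) zred] by blast
    moreover have "zs \<noteq> alternating i j n"
      using \<open>zs \<noteq> []\<close> no_i[of "alternating j i (n - 1)"] by (cases n) auto
    ultimately have n: "zs = alternating j i n" by simp
    have lt: "m i j = 0 \<or> n < m i j"
    proof (rule ccontr)
      assume c: "\<not> (m i j = 0 \<or> n < m i j)"
      define b where "b = n - m i j"
      define r where "r = (if even (m i j) then alternating j i b else alternating i j b)"
      have "zs = alternating j i (m i j + b)" using c n b_def by simp
      then have "zs = alternating j i (m i j) @ r" by (simp only: alternating_add r_def)
      then have "act zs = act (alternating i j (m i j) @ r)"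
        using braid_relation[OF \<open>i \<noteq> j\<close>] c by (simp add: act_append)
      moreover obtain n' where "m i j = Suc n'" using c by (cases "m i j") auto
      ultimately have "act zs = act (i # alternating j i n' @ r)" by simp
      moreover have "length zs = length (alternating i j (m i j) @ r)"
        using \<open>zs = alternating j i (m i j) @ r\<close> by simp
      ultimately show False using no_i[of "alternating j i n' @ r"] \<open>m i j = Suc n'\<close> by simp
    qed
    define p q where "p = g (if odd n then j else i)" and "q = g (if odd n then i else j)"
    have "p > 0" "q > 0" using g by (auto simp: p_def q_def)
    have "n > 0" using \<open>zs \<noteq> []\<close> n by (cases n) auto
    have "act ks f i = chebyshev (m i j) (real n + 1) * p + chebyshev (m i j) n * q"
      using act_alternating(1)[of j i n g] \<open>i \<noteq> j\<close> n zs(2)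
      by (simp add: act_append g_def p_def q_def m_sym[of j i])
    moreover have "chebyshev (m i j) n > 0"
      using \<open>n > 0\<close> lt m_ne_1[OF \<open>i \<noteq> j\<close>] by (intro chebyshev_pos) auto
    moreover have "chebyshev (m i j) (real n + 1) \<ge> 0"
      using lt m_ne_1[OF \<open>i \<noteq> j\<close>] by (intro chebyshev_nonneg) auto
    ultimately show ?thesis using \<open>p > 0\<close> \<open>q > 0\<close> by (simp add: add_nonneg_pos)
  qed
qed

lemma coordinate_neg:
  assumes "len (i # ks) \<le> len ks" "\<And>k. f k > 0"
  shows "act ks f i < 0"
  using coordinate_pos[of "i # ks" i f] assms by (simp add: act_Cons)

text \<open>Equal lengths would make the coordinate of a positive function both positive and negative.\<close>

lemma len_Cons_ne: "len (i # ks) \<noteq> len ks"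
proof
  assume "len (i # ks) = len ks"
  then show False
    using coordinate_neg[of i ks "\<lambda>_. 1"] coordinate_pos[of ks i "\<lambda>_. 1"] by simp
qed

theorem coordinate_pos_iff:
  assumes "\<And>k. f k > 0"
  shows "act ks f i > 0 \<longleftrightarrow> len ks < len (i # ks)"
proof (cases "len ks \<le> len (i # ks)")
  case True
  then show ?thesis using coordinate_pos[of ks i f] assms len_Cons_ne[of i ks] by simp
next
  case False
  then show ?thesis using coordinate_neg[of i ks f] assms by simp
qed

lemma coordinate_neg_iff:
  assumes "\<And>k. f k > 0"
  shows "act ks f i < 0 \<longleftrightarrow> len (i # ks) < len ks"
proof (cases "len ks \<le> len (i # ks)")
  case True
  then show ?thesis using coordinate_pos[of ks i f] assms by simp
next
  case False
  then show ?thesis using coordinate_neg[of i ks f] assms by simp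
qed

lemma len_Cons_cases: "len (i # ks) = Suc (len ks) \<or> len ks = Suc (len (i # ks))"
  using len_Cons_ne[of i ks] len_Cons_le[of i ks] len_le_Cons[of ks i] by linarith

lemma len_snoc: "len (ks @ [i]) = len (i # rev ks)"
  using len_rev[of "ks @ [i]"] by simp

lemma len_snoc_cases: "len (ks @ [i]) = Suc (len ks) \<or> len ks = Suc (len (ks @ [i]))"
  using len_Cons_cases[of i "rev ks"] by (simp add: len_snoc len_rev)

lemma no_descent_imp_id:
  assumes "\<And>i. len ks < len (i # ks)"
  shows "act ks = id"
proof -
  obtain ls where ls: "act ls = act ks" "length ls = len ks" using reduced_word_exists by blast
  show ?thesis
  proof (cases ls)
    case Nil
    then show ?thesis using ls by simp
  next
    case (Cons j ls')
    then have "act (j # ks) = act ls'" using ls(1)[symmetric] by (simp add: act_Cons o_assoc)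
    then have "len (j # ks) < len ks" using len_le[of ls' "j # ks"] ls(2) Cons by simp
    then show ?thesis using assms[of j] by simp
  qed
qed

text \<open>In particular \<open>m i j\<close> is the exact order of the product of the two generators, which is what
  the passage from the Coxeter group to the Artin-Tits group depends on.\<close>

lemma len_alternating:
  assumes "i \<noteq> j" "m i j = 0 \<or> n \<le> m i j"
  shows "len (alternating i j n) = n"
  using assms
proof (induction n arbitrary: i j)
  case (Suc n)
  let ?f = "\<lambda>_. 1 :: real"
  have IH: "len (alternating j i n) = n" using Suc.IH[of j i] Suc.prems by (auto simp: m_sym[of j i])
  have "act (alternating j i n) ?f i = chebyshev (m i j) (real n + 1) + chebyshev (m i j) n"
    using act_alternating(1)[of j i n ?f] Suc.prems by (auto simp: m_sym[of j i])
  moreover have "chebyshev (m i j) (real n + 1) \<ge> 0"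
    using Suc.prems m_ne_1[OF \<open>i \<noteq> j\<close>] by (intro chebyshev_nonneg) auto
  moreover have "n > 0 \<Longrightarrow> chebyshev (m i j) n > 0"
    using Suc.prems m_ne_1[OF \<open>i \<noteq> j\<close>] by (intro chebyshev_pos) auto
  moreover have "n = 0 \<Longrightarrow> chebyshev (m i j) (real n + 1) = 1"
    using m_ne_1[OF \<open>i \<noteq> j\<close>] by simp
  ultimately have "act (alternating j i n) ?f i > 0" by (cases "n = 0") simp_all
  then have "len (alternating j i n) < len (i # alternating j i n)"
    using coordinate_pos_iff[of ?f] by simp
  then show ?case using IH len_Cons_cases[of i "alternating j i n"] by simp
qed simp

section \<open>Matsumoto's theorem\<close>

inductive braid_eq :: "'a list \<Rightarrow> 'a list \<Rightarrow> bool"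
where
  refl: "braid_eq ks ks"
| sym: "braid_eq ks ls \<Longrightarrow> braid_eq ls ks"
| trans: "braid_eq ks ls \<Longrightarrow> braid_eq ls us \<Longrightarrow> braid_eq ks us"
| braid: "i \<noteq> j \<Longrightarrow> m i j \<noteq> 0 \<Longrightarrow>
    braid_eq (us @ alternating i j (m i j) @ vs) (us @ alternating j i (m i j) @ vs)"

lemma braid_eq_Cons:
  assumes "braid_eq ks ls"
  shows "braid_eq (i # ks) (i # ls)"
  using assms
proof induction
  case (braid j k us vs)
  then show ?case using braid_eq.braid[of j k "i # us" vs] by simp
qed (blast intro: braid_eq.intros)+

lemma set_alternating_eq:
  assumes "n \<ge> 2"
  shows "set (alternating i j n) = {i, j}"
proof -
  obtain k where "n = 2 + k" using le_Suc_ex[OF assms] by blast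
  then have "alternating i j n = i # j # alternating i j k" by simp
  then show ?thesis using set_alternating[of i j k] by auto
qed

lemma braid_eq_set:
  assumes "braid_eq ks ls"
  shows "set ks = set ls"
  using assms
proof induction
  case (braid i j us vs)
  then have "set (alternating i j (m i j)) = set (alternating j i (m i j))"
    using set_alternating_eq[OF m_ge_2[of i j], of i j] set_alternating_eq[OF m_ge_2[of i j], of j i] by auto
  then show ?case by simp
qed auto

text \<open>Two reduced words of the same element that start with different letters \<open>i\<close> and \<open>j\<close>: both
  letters are descents, so both coordinates are negative, and the signs of the Chebyshev coefficients
  force the dihedral prefix to have length at least \<open>m i j\<close>. Hence there are reduced words starting with
  either side of the braid relation, and the induction hypothesis connects them to the given words.\<close>

theorem matsumoto:
  assumes "reduced ks" "reduced ls" "act ks = act ls"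
  shows "braid_eq ks ls"
  using assms
proof (induction "length ks" arbitrary: ks ls rule: less_induct)
  case less
  have len_eq: "length ls = length ks"
    using less.prems len_cong[of ks ls] by (simp add: reduced_def)
  show ?case
  proof (cases ks)
    case Nil
    then show ?thesis using len_eq braid_eq.refl by simp
  next
    case (Cons i ks')
    then obtain j ls' where ls: "ls = j # ls'" using len_eq by (cases ls) auto
    \<comment> \<open>Two reduced words with the same first letter are settled by induction.\<close>
    have same_first: "braid_eq (k # us) (k # vs)"
      if "act (k # us) = act ks" "act (k # vs) = act ks" "Suc (length us) = length ks"
        "Suc (length vs) = length ks" for k us vs
    proof (rule braid_eq_Cons, rule less.hyps)
      have r: "reduced (k # us)" "reduced (k # vs)"
        using that less.prems(1) len_cong[of "k # us" ks] len_cong[of "k # vs" ks]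
        by (simp_all add: reduced_def)
      then show "reduced us" "reduced vs" using reduced_ConsD by blast+
      have "act (k # us) = act (k # vs)" using that by simp
      then show "act us = act vs" using act_cancel_left[of "[k]" "act us" "act vs"] by (simp add: act_Cons)
      show "length us < length ks" using that by simp
    qed
    show ?thesis
    proof (cases "i = j")
      case True
      then show ?thesis using same_first[of i ks' ls'] less.prems(3) Cons ls len_eq by simp
    next
      case False
      let ?f = "\<lambda>_. 1 :: real"
      have "act (i # ks) = act ks'" by (simp add: Cons)
      moreover have "act (j # ks) = act (j # ls)" by (simp only: act_Cons less.prems(3))
      then have "act (j # ks) = act ls'" by (simp add: ls)
      ultimately have "len (i # ks) < len ks" "len (j # ks) < len ks"
        using len_le[of ks' "i # ks"] len_le[of ls' "j # ks"] less.prems(1) Cons ls len_eq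
        by (simp_all add: reduced_def)
      then have neg: "act ks ?f i < 0" "act ks ?f j < 0" using coordinate_neg_iff[of ?f] by simp_all
      obtain zs us where zs: "set zs \<subseteq> {i, j}" "act ks = act (zs @ us)"
        "length zs + len us = len ks" "\<forall>x\<in>{i, j}. len us \<le> len (x # us)"
        using parabolic_decomposition[of "{i, j}" ks] by blast
      obtain us' where us': "act us' = act us" "length us' = len us" using reduced_word_exists by blast
      have g: "act us ?f i > 0" "act us ?f j > 0" using zs(4) coordinate_pos[of us _ ?f] by auto
      have zred: "reduced zs"
        using zs(2,3) len_append_le[of zs us] len_le_length[of zs] len_cong[of ks "zs @ us"]
        by (simp add: reduced_def)
      obtain n where n: "zs = alternating i j n \<or> zs = alternating j i n"
        using reduced_pair_alternating[OF zs(1) zred] by blast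
      define a b where "a = (if zs = alternating i j n then i else j)"
        and "b = (if zs = alternating i j n then j else i)"
      have ab: "zs = alternating a b n" "a \<noteq> b" "{a, b} = {i, j}" "m a b = m i j"
        using n False m_sym[of j i] by (auto simp: a_def b_def)
      define p q where "p = act us ?f (if odd n then a else b)" and "q = act us ?f (if odd n then b else a)"
      have pq: "p > 0" "q > 0" using g ab(3) by (auto simp: p_def q_def doubleton_eq_iff)
      have "act ks ?f b = chebyshev (m i j) (real n + 1) * p + chebyshev (m i j) n * q"
        using act_alternating(1)[OF ab(2), of n "act us ?f"] ab zs(2) by (simp add: act_append p_def q_def)
      moreover have "act ks ?f b < 0" using neg ab(3) by (auto simp: doubleton_eq_iff)
      moreover have "act ks ?f b \<ge> 0" if "m i j = 0 \<or> n < m i j"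
      proof -
        have "chebyshev (m i j) (real n + 1) \<ge> 0" "chebyshev (m i j) n \<ge> 0"
          using that m_ne_1[OF False] by (auto intro!: chebyshev_nonneg)
        then show ?thesis using calculation(1) pq by simp
      qed
      ultimately have "\<not> (m i j = 0 \<or> n < m i j)" by force
      then have le: "m i j \<noteq> 0" "m i j \<le> n" by simp_all
      let ?M = "m i j"
      define r where "r = (if even ?M then alternating a b (n - ?M) else alternating b a (n - ?M)) @ us'"
      have "zs = alternating a b ?M @ (if even ?M then alternating a b (n - ?M) else alternating b a (n - ?M))"
        using alternating_add[of a b ?M "n - ?M"] le ab(1) by simp
      then have zr: "zs @ us' = alternating a b ?M @ r" by (simp add: r_def)
      have ij: "act (alternating i j ?M @ r) = act (zs @ us')" "act (alternating j i ?M @ r) = act (zs @ us')"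
        using braid_relation[OF False le(1)] zr ab(3) by (auto simp: act_append doubleton_eq_iff)
      have ks_act: "act (zs @ us') = act ks" using zs(2) us'(1) by (simp add: act_append)
      have "length (alternating a b ?M @ r) = length ks"
        using us'(2) zs(3) less.prems(1) by (simp add: reduced_def flip: zr)
      then have lr: "?M + length r = length ks" by simp
      obtain M' where M': "?M = Suc M'" using le by (cases ?M) auto
      have "braid_eq ks (alternating i j ?M @ r)"
        using same_first[of i ks' "alternating j i M' @ r"] lr ij(1) ks_act M' Cons by simp
      moreover have "braid_eq (alternating i j ?M @ r) (alternating j i ?M @ r)"
        using braid_eq.braid[OF False le(1), of "[]" r] by simp
      moreover have "braid_eq (alternating j i ?M @ r) ls"
      proof -
        have e: "alternating j i ?M @ r = j # alternating i j M' @ r" by (simp add: M')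
        show ?thesis unfolding e ls
        proof (rule same_first)
          show "act (j # alternating i j M' @ r) = act ks" using ij(2) ks_act by (simp only: e)
          show "act (j # ls') = act ks" using less.prems(3) ls by (simp only:)
          show "Suc (length (alternating i j M' @ r)) = length ks" using lr M' by simp
          show "Suc (length ls') = length ks" using len_eq ls by simp
        qed
      qed
      ultimately show ?thesis by (blast intro: braid_eq.trans)
    qed
  qed
qed

section \<open>The exchange property\<close>

text \<open>A functional that is positive on all positive functions, but negative on their images under the
  \<open>k\<close>-th reflection, only depends on the \<open>k\<close>-th coordinate. The reflection alters a function by a
  multiple of that coordinate alone, so letting the coordinate tend to \<open>0\<close> squeezes the value of the
  functional to \<open>0\<close>.\<close>

lemma functional_proportional:
  assumes pos: "\<And>f. (\<And>x. f x > 0) \<Longrightarrow> act ks f i > 0"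
    and neg: "\<And>f. (\<And>x. f x > 0) \<Longrightarrow> act ks (reflection k f) i < 0"
  obtains c where "c > 0" "\<And>f. act ks f i = c * f k"
proof -
  define \<phi> where "\<phi> f = act ks f i" for f
  have lin: "\<phi> (\<lambda>x. f x + c * g x) = \<phi> f + c * \<phi> g" for f c g
    by (simp add: \<phi>_def act_linear)
  define e :: "'a \<Rightarrow> real" where "e x = (if x = k then 1 else 0)" for x
  have zero: "\<phi> h = 0" if h: "h k = 0" "\<And>x. x \<noteq> k \<Longrightarrow> h x > 0" for h
  proof -
    have b: "0 < \<phi> h + \<epsilon> * \<phi> e" "\<phi> h + \<epsilon> * \<phi> e < \<epsilon> * \<phi> (bil k)" if "\<epsilon> > 0" for \<epsilon>
    proof -
      let ?f = "\<lambda>x. h x + \<epsilon> * e x"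
      have f: "?f x > 0" for x using h that by (cases "x = k") (auto simp: e_def)
      then show "0 < \<phi> h + \<epsilon> * \<phi> e" using pos[of ?f] lin[of h \<epsilon> e] by (simp add: \<phi>_def)
      have "reflection k ?f = (\<lambda>x. ?f x + (- \<epsilon>) * bil k x)" using h(1) by (simp add: reflection_def e_def)
      then have "act ks (reflection k ?f) i = \<phi> ?f + (- \<epsilon>) * \<phi> (bil k)" using lin[of ?f "- \<epsilon>" "bil k"]
        by (simp only: \<phi>_def)
      then show "\<phi> h + \<epsilon> * \<phi> e < \<epsilon> * \<phi> (bil k)" using neg[of ?f, OF f] lin[of h \<epsilon> e] by simp
    qed
    have "\<phi> h \<le> 0"
    proof (rule field_le_epsilon)
      fix d :: real assume d: "d > 0"
      define a where "a = \<bar>\<phi> (bil k) - \<phi> e\<bar> + 1"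
      then have "a > 0" by simp
      have "\<phi> h < (d / a) * (\<phi> (bil k) - \<phi> e)" using b(2)[of "d / a"] d \<open>a > 0\<close> by (simp add: diff_divide_distrib right_diff_distrib)
      also have "\<dots> \<le> (d / a) * a" using d \<open>a > 0\<close> by (intro mult_left_mono) (auto simp: a_def)
      also have "\<dots> = d" using \<open>a > 0\<close> by simp
      finally show "\<phi> h \<le> 0 + d" by simp
    qed
    moreover have "- \<phi> h \<le> 0"
    proof (rule field_le_epsilon)
      fix d :: real assume d: "d > 0"
      define a where "a = \<bar>\<phi> e\<bar> + 1"
      then have "a > 0" by simp
      have "- \<phi> h < (d / a) * \<phi> e" using b(1)[of "d / a"] d \<open>a > 0\<close> by simp
      also have "\<dots> \<le> (d / a) * a" using d \<open>a > 0\<close> by (intro mult_left_mono) (auto simp: a_def)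
      also have "\<dots> = d" using \<open>a > 0\<close> by simp
      finally show "- \<phi> h \<le> 0 + d" by simp
    qed
    ultimately show ?thesis by simp
  qed
  have vanish: "\<phi> g = 0" if g: "g k = 0" for g
  proof -
    define h where "h x = (if x = k then 0 else \<bar>g x\<bar> + 1)" for x
    have "\<phi> (\<lambda>x. g x + h x) = 0"
      by (rule zero) (use g in \<open>auto simp: h_def\<close>)
    moreover have "\<phi> h = 0" by (rule zero) (auto simp: h_def)
    ultimately show ?thesis using lin[of g 1 h] by simp
  qed
  have proportional: "\<phi> f = \<phi> e * f k" for f
  proof -
    have "\<phi> (\<lambda>x. (f x + (- f k) * e x)) = 0" by (rule vanish) (simp add: e_def)
    then show ?thesis using lin[of f "- f k" e] by simp
  qed
  have "\<phi> (\<lambda>_. 1) > 0" using pos by (simp add: \<phi>_def)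
  then have "\<phi> e > 0" using proportional[of "\<lambda>_. 1"] by simp
  moreover have "act ks f i = \<phi> e * f k" for f using proportional[of f] by (simp only: \<phi>_def)
  ultimately show ?thesis by (rule that)
qed

text \<open>The generator \<open>i\<close> stops being an ascent exactly when \<open>k\<close> is appended. In the language of roots
  this says that the element carries the \<open>k\<close>-th simple root to the \<open>i\<close>-th one. By
  \<open>functional_proportional\<close> the two sides of the claim then differ by a shear, and an element that
  keeps one positive function positive has no descent, hence is trivial.\<close>

theorem exchange:
  assumes up: "len ks < len (i # ks)" and down: "len (i # ks @ [k]) < len (ks @ [k])"
  shows "act (i # ks) = act (ks @ [k])"
proof -
  have "act ks f i > 0" if "\<And>x. f x > 0" for f
    using coordinate_pos_iff[of f, OF that] up by simp
  moreover have "act ks (reflection k f) i < 0" if "\<And>x. f x > 0" for f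
    using coordinate_neg_iff[of f, OF that, of "ks @ [k]" i] down by (simp add: act_append act_Cons)
  ultimately obtain c where c: "c > 0" "\<And>f. act ks f i = c * f k"
    using functional_proportional by blast
  define b where "b x = act ks (bil k) x / c" for x
  have b_i: "b i = 2" using c by (simp add: b_def)
  define t where "t = i # ks @ [k] @ rev ks"
  \<comment> \<open>The quotient of the two sides is a shear in the direction of the coordinate \<open>i\<close>, hence
    preserves the positivity of a suitably chosen positive function.\<close>
  have t: "act t g = (\<lambda>x. g x - g i * (b x - bil i x))" for g
  proof -
    let ?g = "act (rev ks) g"
    have gk: "?g k = g i / c" using c(2)[of ?g] c(1) by (simp add: field_simps)
    have "reflection k ?g = (\<lambda>x. ?g x + (- (g i / c)) * bil k x)" by (simp add: reflection_def gk)
    then have "act ks (reflection k ?g) = (\<lambda>x. g x - g i * b x)"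
      by (simp only: act_linear) (simp add: b_def)
    then have "act t g = reflection i (\<lambda>x. g x - g i * b x)"
      by (simp add: t_def act_append act_Cons)
    also have "\<dots> = (\<lambda>x. g x - g i * (b x - bil i x))"
      by (simp add: reflection_def b_i algebra_simps)
    finally show ?thesis .
  qed
  define f where "f x = (if x = i then 1 else 1 + \<bar>b x - bil i x\<bar>)" for x
  have tf: "act t f x > 0" for x by (cases "x = i") (simp_all add: t f_def b_i)
  have f_pos: "f x > 0" for x by (simp add: f_def add_pos_nonneg)
  have "act t = id"
  proof (rule no_descent_imp_id)
    show "len t < len (x # t)" for x using coordinate_pos_iff[of f t x, OF f_pos] tf by simp
  qed
  then have "act ((i # ks @ [k]) @ rev ks) = act []" by (simp add: t_def)
  then have "act ((i # ks) @ [k]) = act ks" using act_move_right[of "i # ks @ [k]" "rev ks" "[]"] by simp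
  then show ?thesis using act_move_right[of "i # ks" "[k]" ks] by simp
qed

section \<open>Parabolic subgroups and minimal coset representatives\<close>

definition left_minimal :: "'a set \<Rightarrow> 'a list \<Rightarrow> bool"
  where "left_minimal X ks \<longleftrightarrow> (\<forall>x\<in>X. len ks < len (x # ks))"

definition right_minimal :: "'a set \<Rightarrow> 'a list \<Rightarrow> bool"
  where "right_minimal Y ks \<longleftrightarrow> (\<forall>y\<in>Y. len ks < len (ks @ [y]))"

lemma right_minimal_rev: "right_minimal Y ks \<longleftrightarrow> left_minimal Y (rev ks)"
  by (simp add: right_minimal_def left_minimal_def len_snoc len_rev)

lemma right_minimal_cong:
  assumes "act ks = act ls"
  shows "right_minimal Y ks \<longleftrightarrow> right_minimal Y ls"
proof -
  have "len (ks @ [y]) = len (ls @ [y])" for y by (rule len_cong) (simp add: act_append assms)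
  then show ?thesis using len_cong[OF assms] by (simp add: right_minimal_def)
qed

text \<open>Minimality makes the coordinates of \<open>act ks 1\<close> in \<open>X\<close> positive, and words over \<open>X\<close> cannot see
  the other coordinates. So such a word has the same descents in \<open>X\<close> before \<open>ks\<close> as on its own.\<close>

theorem len_append_left_minimal:
  assumes "set zs \<subseteq> X" "left_minimal X ks"
  shows "len (zs @ ks) = len zs + len ks"
  using assms(1)
proof (induction zs)
  case (Cons x zs)
  let ?one = "\<lambda>_. 1 :: real"
  define g where "g = act ks ?one"
  define g' where "g' k = (if k \<in> X then g k else 1)" for k
  have g: "g k > 0" if "k \<in> X" for k
    using assms(2) that coordinate_pos_iff[of ?one ks k] by (simp add: g_def left_minimal_def)
  then have g': "g' k > 0" for k by (simp add: g'_def)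
  have "act (zs @ ks) ?one x = act zs g' x"
    using act_local[of zs X x g g'] Cons.prems by (simp add: act_append g_def g'_def)
  then have "len (zs @ ks) < len (x # zs @ ks) \<longleftrightarrow> len zs < len (x # zs)"
    using coordinate_pos_iff[of ?one "zs @ ks" x] coordinate_pos_iff[of g' zs x, OF g'] by simp
  then show ?case
    using Cons len_Cons_cases[of x "zs @ ks"] len_Cons_cases[of x zs] by auto
qed simp

lemma len_append_right_minimal:
  assumes "set zs \<subseteq> Y" "right_minimal Y ks"
  shows "len (ks @ zs) = len ks + len zs"
  using len_append_left_minimal[of "rev zs" Y "rev ks"] assms len_rev[of "ks @ zs"]
  by (simp add: right_minimal_rev len_rev)

lemma left_coset_decomposition:
  obtains zs us where "set zs \<subseteq> X" "act ks = act (zs @ us)" "length zs + len us = len ks"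
    "left_minimal X us"
  using parabolic_decomposition[of X ks] len_Cons_ne
  by (metis left_minimal_def le_neq_implies_less)

lemma right_coset_decomposition:
  obtains us zs where "set zs \<subseteq> Y" "act ks = act (us @ zs)" "length zs + len us = len ks"
    "right_minimal Y us"
proof -
  obtain zs us where "set zs \<subseteq> Y" "act (rev ks) = act (zs @ us)" "length zs + len us = len (rev ks)"
    "left_minimal Y us"
    by (rule left_coset_decomposition)
  then show ?thesis
    using that[of "rev zs" "rev us"] act_rev_cong[of "rev ks" "zs @ us"]
    by (simp add: right_minimal_rev len_rev)
qed

text \<open>In the decomposition with respect to \<open>X\<close> the minimal part lies in the parabolic subgroup itself.
  Multiplying it by its inverse, lengths add up, so it is trivial.\<close>

lemma parabolic_reduced_word:
  assumes "set zs \<subseteq> X"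
  obtains ls where "set ls \<subseteq> X" "act ls = act zs" "length ls = len zs"
proof -
  obtain ls us where l: "set ls \<subseteq> X" "act zs = act (ls @ us)" "length ls + len us = len zs"
    "left_minimal X us"
    by (rule left_coset_decomposition)
  have us: "act us = act (rev ls @ zs)" using l(2) act_move_left[of ls us zs] by simp
  have "len (rev (rev ls @ zs) @ us) = len us + len us"
    using len_append_left_minimal[of "rev (rev ls @ zs)" X us] l assms len_rev[of "rev ls @ zs"]
      len_cong[OF us] by simp
  moreover have "act (rev (rev ls @ zs) @ us) = act (rev (rev ls @ zs)) \<circ> act (rev ls @ zs)"
    by (subst act_append) (simp only: us)
  then have "act (rev (rev ls @ zs) @ us) = id" by (simp only: act_rev_comp)
  ultimately have "len us = 0" using len_eq_0[of "rev (rev ls @ zs) @ us"] by simp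
  moreover have "act us = id" using \<open>len us = 0\<close> len_eq_0[of us] by blast
  ultimately show ?thesis using l that[of ls] by (simp add: act_append)
qed

lemma right_minimal_unique:
  assumes "right_minimal Y d" "right_minimal Y e" "act (d @ a) = act (e @ b)"
    "set a \<subseteq> Y" "set b \<subseteq> Y"
  shows "act d = act e" "act a = act b"
proof -
  have d: "act d = act (e @ b @ rev a)" using assms(3) act_move_right[of d a "e @ b"] by simp
  have e: "act e = act (d @ a @ rev b)" using assms(3) act_move_right[of e b "d @ a"] by simp
  have "len d = len e + len (b @ rev a)"
    using len_append_right_minimal[of "b @ rev a" Y e] assms len_cong[OF d] by simp
  moreover have "len e = len d + len (a @ rev b)"
    using len_append_right_minimal[of "a @ rev b" Y d] assms len_cong[OF e] by simp
  ultimately have "act (b @ rev a) = id" using len_eq_0[of "b @ rev a"] by simp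
  then show "act d = act e" using d by (simp add: act_append)
  then show "act a = act b" using assms(3) by (simp add: act_append act_cancel_left)
qed

lemma right_minimal_suffix:
  assumes "act ks = act (zs @ us)" "length zs + len us = len ks" "right_minimal Y ks"
  shows "right_minimal Y us"
  unfolding right_minimal_def
proof
  fix y assume "y \<in> Y"
  then have "len ks < len (ks @ [y])" using assms(3) by (simp add: right_minimal_def)
  also have "len (ks @ [y]) = len (zs @ us @ [y])" by (rule len_cong) (simp add: act_append assms(1) o_assoc)
  also have "\<dots> \<le> length zs + len (us @ [y])"
    using len_append_le[of zs "us @ [y]"] len_le_length[of zs] by simp
  finally show "len us < len (us @ [y])" using assms(2) by simp
qed

text \<open>Deodhar's lemma: a generator permutes the minimal coset representatives, except that it may fix the
  coset, and then it acts on the representative from the right as a generator in \<open>Y\<close>.\<close>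

theorem right_minimal_Cons:
  assumes "right_minimal Y ks" "\<not> right_minimal Y (i # ks)"
  obtains k where "k \<in> Y" "act (i # ks) = act (ks @ [k])"
proof -
  obtain k where k: "k \<in> Y" "len (i # ks @ [k]) \<le> len (i # ks)"
    using assms(2) by (auto simp: right_minimal_def)
  have "len (ks @ [k]) = Suc (len ks)"
    using assms(1) k len_snoc_cases[of ks k] by (auto simp: right_minimal_def)
  moreover have "len (i # ks @ [k]) = Suc (len (i # ks)) \<or> len (i # ks) = Suc (len (i # ks @ [k]))"
    using len_snoc_cases[of "i # ks" k] by simp
  moreover note k(2) len_Cons_cases[of i ks] len_Cons_cases[of i "ks @ [k]"]
  ultimately have "len ks < len (i # ks)" "len (i # ks @ [k]) < len (ks @ [k])" by linarith+
  then show ?thesis using exchange k that by blast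
qed

lemma act_snoc_inj:
  assumes "act (ks @ [k]) = act (ks @ [l])"
  shows "k = l"
proof (rule reflection_inj)
  show "reflection k = reflection l" using assms act_cancel_left[of ks "act [k]" "act [l]"] by (simp add: act_append act_Cons)
qed

section \<open>Walking on minimal coset representatives\<close>

text \<open>Cosets of the parabolic subgroup of \<open>Y\<close>, given by operators so that each coset occurs once.\<close>

definition minimal_reps :: "'a set \<Rightarrow> (('a \<Rightarrow> real) \<Rightarrow> 'a \<Rightarrow> real) set"
  where "minimal_reps Y = {act ks | ks. right_minimal Y ks}"

text \<open>One step of the walk. The generator \<open>i\<close> moves \<open>d\<close> whenever the result is again minimal; otherwise
  \<open>i\<close> passes through \<open>d\<close>, which stays put, and comes out as the generator \<open>k\<close> that \<open>emit\<close> records. The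
  letter \<open>k\<close> exists by \<open>right_minimal_Cons\<close> and is unique by \<open>act_snoc_inj\<close>.\<close>

definition move :: "'a set \<Rightarrow> 'a \<Rightarrow> (('a \<Rightarrow> real) \<Rightarrow> 'a \<Rightarrow> real) \<Rightarrow> ('a \<Rightarrow> real) \<Rightarrow> 'a \<Rightarrow> real"
  where "move Y i d = (if reflection i \<circ> d \<in> minimal_reps Y then reflection i \<circ> d else d)"

definition emit :: "'a set \<Rightarrow> 'a \<Rightarrow> (('a \<Rightarrow> real) \<Rightarrow> 'a \<Rightarrow> real) \<Rightarrow> 'a list"
  where "emit Y i d = (if reflection i \<circ> d \<in> minimal_reps Y then [] else [SOME k. k \<in> Y \<and> reflection i \<circ> d = d \<circ> reflection k])"

text \<open>Words act from the left, so the walk reads them from right to left.\<close>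

fun walk :: "'a set \<Rightarrow> 'a list \<Rightarrow> (('a \<Rightarrow> real) \<Rightarrow> 'a \<Rightarrow> real) \<Rightarrow> ('a \<Rightarrow> real) \<Rightarrow> 'a \<Rightarrow> real"
  where
    "walk Y [] d = d"
  | "walk Y (i # ks) d = move Y i (walk Y ks d)"

fun emitted :: "'a set \<Rightarrow> 'a list \<Rightarrow> (('a \<Rightarrow> real) \<Rightarrow> 'a \<Rightarrow> real) \<Rightarrow> 'a list"
  where
    "emitted Y [] d = []"
  | "emitted Y (i # ks) d = emit Y i (walk Y ks d) @ emitted Y ks d"

lemma act_in_minimal_reps: "act ks \<in> minimal_reps Y \<longleftrightarrow> right_minimal Y ks"
proof
  assume "act ks \<in> minimal_reps Y"
  then obtain ls where "act ks = act ls" "right_minimal Y ls" by (auto simp: minimal_reps_def)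
  then show "right_minimal Y ks" using right_minimal_cong[of ks ls Y] by simp
qed (auto simp: minimal_reps_def)

lemma blocked_step:
  assumes "d \<in> minimal_reps Y" "k \<in> Y" "reflection i \<circ> d = d \<circ> reflection k"
  shows "move Y i d = d" "emit Y i d = [k]"
proof -
  obtain ks where ks: "d = act ks" "right_minimal Y ks" using assms(1) by (auto simp: minimal_reps_def)
  have dk: "d \<circ> reflection l = act (ks @ [l])" for l by (simp add: ks act_append act_Cons)
  have "len (ks @ [k] @ [k]) = len ks" by (rule len_cong) (simp add: act_append act_Cons o_assoc[symmetric])
  moreover have "len ks < len (ks @ [k])" using ks(2) assms(2) by (simp add: right_minimal_def)
  ultimately have "\<not> right_minimal Y (ks @ [k])"
    using assms(2) by (auto simp: right_minimal_def intro!: bexI[of _ k])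
  then have n: "reflection i \<circ> d \<notin> minimal_reps Y" using act_in_minimal_reps assms(3) dk by simp
  then show "move Y i d = d" by (simp add: move_def)
  have "(SOME l. l \<in> Y \<and> reflection i \<circ> d = d \<circ> reflection l) = k"
  proof (rule some_equality)
    show "k \<in> Y \<and> reflection i \<circ> d = d \<circ> reflection k" using assms by simp
    fix l assume "l \<in> Y \<and> reflection i \<circ> d = d \<circ> reflection l"
    then have "act (ks @ [l]) = act (ks @ [k])" using assms(3) dk by simp
    then show "l = k" by (rule act_snoc_inj)
  qed
  then show "emit Y i d = [k]" using n by (simp add: emit_def)
qed

lemma step_cases:
  assumes "d \<in> minimal_reps Y"
  obtains (free) "reflection i \<circ> d \<in> minimal_reps Y" "move Y i d = reflection i \<circ> d" "emit Y i d = []"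
  | (blocked) k where "k \<in> Y" "reflection i \<circ> d = d \<circ> reflection k" "move Y i d = d" "emit Y i d = [k]"
proof (cases "reflection i \<circ> d \<in> minimal_reps Y")
  case True
  then show ?thesis using free by (simp add: move_def emit_def)
next
  case False
  obtain ks where ks: "d = act ks" "right_minimal Y ks" using assms(1) by (auto simp: minimal_reps_def)
  have "\<not> right_minimal Y (i # ks)" using False act_in_minimal_reps[of "i # ks"] by (simp add: ks act_Cons)
  then obtain k where k: "k \<in> Y" "act (i # ks) = act (ks @ [k])" using right_minimal_Cons ks(2) by blast
  then have "reflection i \<circ> d = d \<circ> reflection k" by (simp add: ks act_append act_Cons)
  then show ?thesis using blocked k blocked_step[OF assms] by blast
qed

lemma walk_in_minimal_reps:
  assumes "d \<in> minimal_reps Y"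
  shows "walk Y zs d \<in> minimal_reps Y"
  using assms by (induction zs) (auto simp: move_def)

lemma set_emitted:
  assumes "d \<in> minimal_reps Y"
  shows "set (emitted Y zs d) \<subseteq> Y"
proof (induction zs)
  case (Cons i zs)
  have "set (emit Y i (walk Y zs d)) \<subseteq> Y"
    using walk_in_minimal_reps[OF assms, of zs] by (rule step_cases[of _ _ i]) auto
  then show ?case using Cons by simp
qed simp

lemma walk_append: "walk Y (xs @ ys) d = walk Y xs (walk Y ys d)"
  by (induction xs) auto

text \<open>The output is the component in the parabolic subgroup that is split off on the way.\<close>

theorem act_walk:
  assumes "d \<in> minimal_reps Y"
  shows "act zs \<circ> d = walk Y zs d \<circ> act (emitted Y zs d)"
proof (induction zs)
  case (Cons i zs)
  let ?w = "walk Y zs d" and ?e = "emitted Y zs d"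
  have IH: "act (i # zs) \<circ> d = reflection i \<circ> ?w \<circ> act ?e" by (simp only: act_Cons comp_assoc Cons)
  show ?case
    using walk_in_minimal_reps[OF assms, of zs]
  proof (cases rule: step_cases[of _ _ i])
    case free
    then show ?thesis using IH by simp
  next
    case (blocked k)
    then show ?thesis using IH by (simp add: fun_eq_iff act_Cons)
  qed
qed simp

text \<open>The end point depends on the coset only, hence is invariant under all relations of the Coxeter
  group. Only the output needs care.\<close>

lemma walk_unique:
  assumes "d \<in> minimal_reps Y" "e \<in> minimal_reps Y" "set a \<subseteq> Y" "act zs \<circ> d = e \<circ> act a"
  shows "walk Y zs d = e"
proof -
  obtain ks ls where kl: "walk Y zs d = act ks" "right_minimal Y ks" "e = act ls" "right_minimal Y ls"
    using walk_in_minimal_reps[OF assms(1), of zs] assms(2) by (auto simp: minimal_reps_def)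
  have "act (ks @ emitted Y zs d) = act (ls @ a)"
    using act_walk[OF assms(1), of zs] assms(4) kl by (simp add: act_append)
  then show ?thesis using right_minimal_unique(1)[OF kl(2,4)] set_emitted[OF assms(1)] assms(3) kl by simp
qed

lemma walk_cong:
  assumes "d \<in> minimal_reps Y" "act zs = act zs'"
  shows "walk Y zs d = walk Y zs' d"
  using walk_unique[OF assms(1) walk_in_minimal_reps[OF assms(1)] set_emitted[OF assms(1)], of zs zs' zs']
    act_walk[OF assms(1), of zs'] assms(2) by simp

text \<open>Consecutive suffixes of a word differ by a reflection on the right; here these reflections are listed
  as palindromes.\<close>

fun inversions :: "'a list \<Rightarrow> 'a list list"
  where
    "inversions [] = []"
  | "inversions (a # zs) = (rev zs @ [a] @ zs) # inversions zs"

text \<open>When all blocked steps put out the same letter \<open>k\<close>, a step is blocked precisely if its inversion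
  is conjugated by \<open>d\<close> to the generator \<open>k\<close>: the output collected so far commutes with that generator.
  Therefore the output is determined by the multiset of inversions.\<close>

lemma emitted_single_letter:
  assumes "d \<in> minimal_reps Y" "k \<in> Y" "set (emitted Y zs d) \<subseteq> {k}"
  shows "emitted Y zs d = replicate (length (filter (\<lambda>p. act p \<circ> d = d \<circ> reflection k) (inversions zs))) k"
  using assms(3)
proof (induction zs)
  case (Cons a zs)
  define P where "P = (\<lambda>p. act p \<circ> d = d \<circ> reflection k)"
  define n where "n = length (filter P (inversions zs))"
  let ?w = "walk Y zs d" and ?p = "act (replicate n k)"
  have "set (emitted Y zs d) \<subseteq> {k}" using Cons.prems by simp
  then have IH: "emitted Y zs d = replicate n k" using Cons.IH by (simp only: n_def P_def)
  have comm: "?p \<circ> reflection k = reflection k \<circ> ?p"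
  proof -
    have "act (replicate n k @ [k]) = act (k # replicate n k)" by (simp only: replicate_append_same)
    then show ?thesis by (simp add: act_append act_Cons)
  qed
  have w: "act zs \<circ> d = ?w \<circ> ?p" using act_walk[OF assms(1), of zs] IH by simp
  have "act (rev zs @ [a] @ zs) \<circ> d = d \<circ> reflection k \<longleftrightarrow>
      act zs \<circ> (act (rev zs @ [a] @ zs) \<circ> d) = act zs \<circ> (d \<circ> reflection k)"
    by (simp only: act_cancel_left)
  also have "act zs \<circ> (act (rev zs @ [a] @ zs) \<circ> d) = reflection a \<circ> (act zs \<circ> d)"
    by (simp add: fun_eq_iff act_append act_Cons)
  also have "\<dots> = (reflection a \<circ> ?w) \<circ> ?p" by (simp only: w o_assoc)
  also have "act zs \<circ> (d \<circ> reflection k) = ?w \<circ> (?p \<circ> reflection k)" by (simp only: o_assoc w)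
  also have "\<dots> = (?w \<circ> reflection k) \<circ> ?p" by (simp only: comm o_assoc)
  also have "(reflection a \<circ> ?w) \<circ> ?p = (?w \<circ> reflection k) \<circ> ?p \<longleftrightarrow> reflection a \<circ> ?w = ?w \<circ> reflection k"
    by (rule act_cancel_right)
  finally have iff: "P (rev zs @ [a] @ zs) \<longleftrightarrow> reflection a \<circ> ?w = ?w \<circ> reflection k" by (simp only: P_def)
  have count: "length (filter P (inversions (a # zs))) = (if P (rev zs @ [a] @ zs) then Suc n else n)"
    by (simp add: n_def)
  have win: "?w \<in> minimal_reps Y" by (rule walk_in_minimal_reps[OF assms(1)])
  have "emitted Y (a # zs) d = replicate (if reflection a \<circ> ?w = ?w \<circ> reflection k then Suc n else n) k"
    using win
  proof (cases rule: step_cases[of _ _ a])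
    case free
    then have "reflection a \<circ> ?w \<noteq> ?w \<circ> reflection k" using blocked_step(2)[OF win assms(2), of a] by auto
    then show ?thesis using free IH by simp
  next
    case (blocked l)
    then have "l = k" using Cons.prems by simp
    then show ?thesis using blocked IH by simp
  qed
  also have "\<dots> = replicate (length (filter P (inversions (a # zs)))) k" by (simp only: count iff)
  finally show ?case by (simp only: P_def)
qed simp

lemma map_act_inversions_alternating:
  "map act (inversions (alternating i j n)) =
    rev (map (\<lambda>t. act (alternating (if odd n then i else j) (if odd n then j else i) (2 * t + 1))) [0..<n])"
proof (induction n arbitrary: i j)
  case (Suc n)
  let ?x = "if odd (Suc n) then i else j" and ?x' = "if odd (Suc n) then j else i"
  have "rev (alternating j i n) @ [i] @ alternating j i n = alternating ?x ?x' (2 * n + 1)"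
    using alternating_add[of ?x ?x' n "n + 1"] rev_alternating[of j i n] by (auto simp: mult_2)
  then show ?case using Suc[of j i] by simp
qed simp

lemma act_alternating_full:
  assumes "i \<noteq> j" "m i j \<noteq> 0"
  shows "act (alternating i j (2 * m i j)) = id"
proof -
  let ?M = "m i j"
  let ?w = "alternating i j ?M"
  have "act (if even ?M then ?w else alternating j i ?M) = act (rev ?w)"
    using braid_relation[OF assms] by (simp add: rev_alternating)
  then have "act (alternating i j (?M + ?M)) = act ?w \<circ> act (rev ?w)"
    by (simp only: alternating_add act_append)
  then show ?thesis by (simp add: mult_2)
qed

text \<open>Both sides of a braid relation have the same inversions, in opposite order, because the product of
  the \<open>t\<close>-th inversion of one side and the matching one of the other side is a full turn
  \<open>(i j)\<^sup>m\<close>.\<close>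

lemma inversions_braid:
  assumes "i \<noteq> j" "m i j \<noteq> 0"
  shows "map act (inversions (alternating j i (m i j))) = rev (map act (inversions (alternating i j (m i j))))"
proof -
  let ?M = "m i j"
  define x where "x = (if odd ?M then i else j)"
  define x' where "x' = (if odd ?M then j else i)"
  have xx: "x \<noteq> x'" "m x x' = ?M" using assms m_sym[of i j] by (auto simp: x_def x'_def)
  have pal: "act (alternating x' x (2 * (?M - Suc t) + 1)) = act (alternating x x' (2 * t + 1))" if "t < ?M" for t
  proof -
    let ?u = "alternating x x' (2 * t + 1)" and ?v = "alternating x' x (2 * (?M - Suc t) + 1)"
    have "2 * ?M = (2 * t + 1) + (2 * (?M - Suc t) + 1)" using that by simp
    then have "alternating x x' (2 * ?M) = ?u @ ?v"
      using alternating_add[of x x' "2 * t + 1" "2 * (?M - Suc t) + 1"] by simp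
    then have "act (?u @ ?v) = act []" using act_alternating_full[OF xx(1)] xx(2) assms(2) by simp
    then show ?thesis using act_move_left[of ?u ?v "[]"] rev_alternating[of x x' "2 * t + 1"] by simp
  qed
  have pal': "act (alternating x' x (2 * t + 1)) = act (alternating x x' (2 * (?M - Suc t) + 1))" if "t < ?M" for t
  proof -
    have "?M - Suc (?M - Suc t) = t" using that by simp
    then show ?thesis using pal[of "?M - Suc t"] that by simp
  qed
  have "map act (inversions (alternating j i ?M)) = rev (map (\<lambda>t. act (alternating x' x (2 * t + 1))) [0..<?M])"
    by (simp only: map_act_inversions_alternating x_def x'_def)
  also have "map (\<lambda>t. act (alternating x' x (2 * t + 1))) [0..<?M] =
      rev (map (\<lambda>t. act (alternating x x' (2 * t + 1))) [0..<?M])"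
    using pal' by (intro nth_equalityI) (auto simp: rev_nth)
  also have "\<dots> = map act (inversions (alternating i j ?M))"
    by (simp only: map_act_inversions_alternating x_def x'_def)
  finally show ?thesis .
qed

text \<open>The letter \<open>k\<close> on the right corresponds on the left to the reflection \<open>rev v @ [a] @ v\<close>. By
  additivity of the length over \<open>us\<close>, this reflection has length one.\<close>

lemma blocked_letters:
  assumes us: "left_minimal X us" "right_minimal Y us"
    and v: "set v \<subseteq> X" and a: "a \<in> X" and k: "k \<in> Y"
    and eq: "act (a # v @ us) = act (v @ us @ [k])"
  shows "\<exists>b\<in>X. act (b # us) = act (us @ [k])"
proof -
  let ?r = "rev v @ [a] @ v"
  have r: "set ?r \<subseteq> X" using v a by auto
  have e: "act (?r @ us) = act (us @ [k])"
    using eq act_move_left[of v "us @ [k]" "a # v @ us"] by simp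
  have "len ?r + len us = len us + 1"
    using len_append_left_minimal[OF r us(1)] len_cong[OF e] us(2) k len_snoc_cases[of us k]
    by (auto simp: right_minimal_def)
  moreover obtain ls where ls: "set ls \<subseteq> X" "act ls = act ?r" "length ls = len ?r"
    using parabolic_reduced_word[OF r] by blast
  ultimately obtain b where "ls = [b]" by (auto simp: length_Suc_conv)
  then have "act (b # us) = act (?r @ us)" using ls(2) act_append[of "[b]" us] act_append[of ?r us] by simp
  then show ?thesis using e ls(1) \<open>ls = [b]\<close> by (intro bexI[of _ b]) auto
qed

lemma walk_in_left_coset:
  assumes "set zs \<subseteq> X" "d = act (v @ us)" "set v \<subseteq> X"
  shows "\<exists>v'. walk Y zs d = act (v' @ us) \<and> set v' \<subseteq> X"
  using assms(1)
proof (induction zs)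
  case Nil
  then show ?case using assms by auto
next
  case (Cons a zs)
  then obtain v' where v': "walk Y zs d = act (v' @ us)" "set v' \<subseteq> X" by auto
  then have "reflection a \<circ> walk Y zs d = act ((a # v') @ us)" by (simp add: act_Cons)
  moreover have "walk Y (a # zs) d = reflection a \<circ> walk Y zs d \<or> walk Y (a # zs) d = walk Y zs d"
    by (simp add: move_def)
  ultimately show ?case using v' Cons.prems by (metis insert_subset list.simps(15))
qed

text \<open>Every letter put out by a walk with letters in \<open>X\<close> through \<open>W\<^sub>X us\<close> already comes out of a single
  letter of \<open>X\<close> at the minimal element \<open>us\<close>. This bounds the outputs both in the braid relations and
  in the intersection theorem.\<close>

lemma emitted_letters:
  assumes us: "left_minimal X us" "right_minimal Y us"
    and d: "d \<in> minimal_reps Y" "d = act (v @ us)" "set v \<subseteq> X"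
    and zs: "set zs \<subseteq> X" and k: "k \<in> set (emitted Y zs d)"
  shows "k \<in> Y \<and> (\<exists>b\<in>X. act (b # us) = act (us @ [k]))"
  using zs k
proof (induction zs)
  case (Cons a zs)
  show ?case
  proof (cases "k \<in> set (emitted Y zs d)")
    case True
    then show ?thesis using Cons by simp
  next
    case False
    obtain v' where v': "walk Y zs d = act (v' @ us)" "set v' \<subseteq> X"
      using walk_in_left_coset[of zs X d v us Y] d Cons.prems by auto
    show ?thesis
      using walk_in_minimal_reps[OF d(1), of zs]
    proof (cases rule: step_cases[of _ _ a])
      case free
      then show ?thesis using False Cons.prems by simp
    next
      case (blocked l)
      then have "k = l" using False Cons.prems by simp
      moreover have "act (a # v' @ us) = act (v' @ us @ [l])"
        using blocked(2) v'(1) by (simp add: act_append act_Cons o_assoc)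
      ultimately show ?thesis using blocked_letters[OF us v'(2) _ blocked(1)] Cons.prems blocked(1) by auto
    qed
  qed
qed simp

lemma blocked_alternating:
  assumes "d \<in> minimal_reps Y" "k \<in> Y" "l \<in> Y" "reflection i \<circ> d = d \<circ> reflection k" "reflection j \<circ> d = d \<circ> reflection l"
  shows "walk Y (alternating i j n) d = d \<and> emitted Y (alternating i j n) d = alternating k l n"
  using assms(2-)
proof (induction n arbitrary: i j k l)
  case (Suc n)
  have "walk Y (alternating j i n) d = d \<and> emitted Y (alternating j i n) d = alternating l k n"
    using Suc.IH Suc.prems by blast
  then show ?case using blocked_step[OF assms(1) Suc.prems(1,3)] by simp
qed simp

text \<open>Let \<open>us\<close> be the minimal element in the coset of \<open>d\<close> under the dihedral group of \<open>i\<close> and \<open>j\<close>. If at most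
  one letter can be put out in this coset, the outputs agree because both sides have the same inversions.
  Otherwise both \<open>i\<close> and \<open>j\<close> pass through \<open>us\<close>; then \<open>d\<close> equals \<open>us\<close>, and the outputs are
  alternating words in two letters of \<open>Y\<close> that are reduced words of the same element.\<close>

theorem emitted_braid:
  assumes d: "d \<in> minimal_reps Y" and ij: "i \<noteq> j" "m i j \<noteq> 0"
  shows "braid_eq (emitted Y (alternating i j (m i j)) d) (emitted Y (alternating j i (m i j)) d)"
proof -
  let ?M = "m i j"
  obtain ks where ks: "d = act ks" "right_minimal Y ks" using d by (auto simp: minimal_reps_def)
  obtain v us where v: "set v \<subseteq> {i, j}" "act ks = act (v @ us)" "length v + len us = len ks"
    "left_minimal {i, j} us"
    by (rule left_coset_decomposition)
  have us: "right_minimal Y us" using right_minimal_suffix v ks by blast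
  define K where "K = {k \<in> Y. \<exists>b\<in>{i, j}. act (b # us) = act (us @ [k])}"
  have K: "set (emitted Y zs d) \<subseteq> K" if "set zs \<subseteq> {i, j}" for zs
    using emitted_letters[OF v(4) us d _ v(1) that] ks v(2) by (auto simp: K_def)
  have alt: "set (alternating i j ?M) \<subseteq> {i, j}" "set (alternating j i ?M) \<subseteq> {i, j}"
    using set_alternating[of i j ?M] set_alternating[of j i ?M] by auto
  show ?thesis
  proof (cases "\<exists>k. K \<subseteq> {k}")
    case True
    then consider "K = {}" | k where "K = {k}" by blast
    then show ?thesis
    proof cases
      case 1
      then show ?thesis using K[OF alt(1)] K[OF alt(2)] braid_eq.refl by simp
    next
      case (2 k)
      then have k: "k \<in> Y" by (auto simp: K_def)
      define Q where "Q g \<longleftrightarrow> g \<circ> d = d \<circ> reflection k" for g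
      have count: "emitted Y zs d = replicate (length (filter Q (map act (inversions zs)))) k"
        if "set zs \<subseteq> {i, j}" for zs
      proof -
        have "length (filter Q (map act L)) = length (filter (\<lambda>p. act p \<circ> d = d \<circ> reflection k) L)" for L
          by (induction L) (simp_all add: Q_def del: o_apply)
        then show ?thesis using emitted_single_letter[OF d k, of zs] K[OF that] 2 by (simp only:)
      qed
      have "emitted Y (alternating i j ?M) d = emitted Y (alternating j i ?M) d"
        by (simp only: count[OF alt(1)] count[OF alt(2)] inversions_braid[OF ij] length_rev flip: rev_filter)
      then show ?thesis using braid_eq.refl by simp
    qed
  next
    case False
    \<comment> \<open>Both generators are blocked at the minimal element, which then is the current one.\<close>
    have "K \<noteq> {}" using False by auto
    then obtain k where k: "k \<in> K" by auto
    then obtain l where l: "l \<in> K" "l \<noteq> k" using False by auto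
    obtain b c where bc: "b \<in> {i, j}" "act (b # us) = act (us @ [k])" "c \<in> {i, j}" "act (c # us) = act (us @ [l])"
      using k l by (auto simp: K_def)
    have "b \<noteq> c" using bc l(2) act_snoc_inj[of us k l] by auto
    have "\<exists>k l. k \<in> Y \<and> l \<in> Y \<and> k \<noteq> l \<and> act (i # us) = act (us @ [k]) \<and> act (j # us) = act (us @ [l])"
    proof (cases "b = i")
      case True
      then have "c = j" using bc(3) \<open>b \<noteq> c\<close> by auto
      then show ?thesis using True bc k l by (intro exI[of _ k] exI[of _ l]) (auto simp: K_def)
    next
      case F: False
      then have "b = j" "c = i" using bc(1,3) \<open>b \<noteq> c\<close> by auto
      then show ?thesis using bc k l by (intro exI[of _ l] exI[of _ k]) (auto simp: K_def)
    qed
    then obtain k l where kl: "k \<in> Y" "l \<in> Y" "k \<noteq> l" "act (i # us) = act (us @ [k])" "act (j # us) = act (us @ [l])"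
      by blast
    have "\<exists>z. set z \<subseteq> Y \<and> act (v @ us) = act (us @ z)"
      using v(1)
    proof (induction v)
      case Nil
      show ?case by (intro exI[of _ "[]"]) simp
    next
      case (Cons a v)
      then obtain z where z: "set z \<subseteq> Y" "act (v @ us) = act (us @ z)" by auto
      obtain h where h: "h \<in> Y" "act (a # us) = act (us @ [h])" using Cons.prems kl by auto
      have "act ((a # v) @ us) = act (a # us) \<circ> act z" using z(2) by (simp add: act_Cons act_append o_assoc)
      also have "\<dots> = act (us @ (h # z))" by (simp only: h(2)) (simp add: act_Cons act_append o_assoc)
      finally show ?case using z h by (intro exI[of _ "h # z"]) simp
    qed
    then obtain z where "set z \<subseteq> Y" "act (v @ us) = act (us @ z)" by blast
    then have "act ks = act us" using right_minimal_unique(1)[OF ks(2) us, of "[]" z] v(2) by simp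
    then have du: "d = act us" using ks by simp
    then have bl: "reflection i \<circ> d = d \<circ> reflection k" "reflection j \<circ> d = d \<circ> reflection l"
      using kl by (simp_all add: act_append act_Cons)
    note walks = blocked_alternating[OF d kl(1,2) bl, of ?M] blocked_alternating[OF d kl(2,1) bl(2,1), of ?M]
    have e: "act (alternating i j ?M) \<circ> d = d \<circ> act (alternating k l ?M)"
      "act (alternating j i ?M) \<circ> d = d \<circ> act (alternating l k ?M)"
      using act_walk[OF d, of "alternating i j ?M"] act_walk[OF d, of "alternating j i ?M"] walks by simp_all
    have reduced_output: "reduced (alternating p q ?M)"
      if "a \<noteq> b" "{a, b} = {i, j}" "m a b = ?M" "{p, q} \<subseteq> Y"
        "act (alternating a b ?M) \<circ> d = d \<circ> act (alternating p q ?M)" for a b p q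
    proof -
      have pq: "set (alternating p q ?M) \<subseteq> Y" using set_alternating[of p q ?M] that(4) by blast
      have ab: "set (alternating a b ?M) \<subseteq> {i, j}" using set_alternating[of a b ?M] that(2) by simp
      have "act (alternating a b ?M @ us) = act (us @ alternating p q ?M)"
        using that(5) du by (simp add: act_append)
      then have "len (alternating a b ?M @ us) = len (us @ alternating p q ?M)" by (rule len_cong)
      then have "len (alternating a b ?M) = len (alternating p q ?M)"
        using len_append_left_minimal[OF ab v(4)] len_append_right_minimal[OF pq us] by simp
      moreover have "len (alternating a b ?M) = ?M" using len_alternating[OF that(1), of ?M] that(3) by simp
      ultimately show ?thesis by (simp add: reduced_def)
    qed
    have "reduced (alternating k l ?M)" using reduced_output[of i j k l] ij kl e by simp
    moreover have "reduced (alternating l k ?M)"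
      using reduced_output[of j i l k] ij kl e m_sym[of i j] by (simp add: insert_commute)
    moreover have "act (alternating k l ?M) = act (alternating l k ?M)"
      using e braid_relation[OF ij] du act_cancel_left[of us "act (alternating k l ?M)"] by simp
    ultimately have "braid_eq (alternating k l ?M) (alternating l k ?M)" by (rule matsumoto)
    then show ?thesis using walks by simp
  qed
qed

section \<open>Double cosets\<close>

lemma act_context: "act ks = act ls \<Longrightarrow> act (us @ ks @ vs) = act (us @ ls @ vs)"
  by (simp add: act_append)

text \<open>Splitting \<open>c @ e\<close> into its minimal coset representative and a remainder, letter by letter. When
  lengths add up the representative never gets shorter.\<close>

lemma walk_up:
  assumes "right_minimal Y e"
  shows "\<exists>z v. set z \<subseteq> set c \<and> set v \<subseteq> Y \<and> right_minimal Y (z @ e) \<and> act (c @ e) = act (z @ e @ v) \<and>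
    (len (c @ e) = length c + len e \<longrightarrow> len e \<le> len (z @ e))"
proof (induction c)
  case Nil
  show ?case using assms by (intro exI[of _ "[]"]) simp
next
  case (Cons x c)
  then obtain z v where zv: "set z \<subseteq> set c" "set v \<subseteq> Y" "right_minimal Y (z @ e)" "act (c @ e) = act (z @ e @ v)"
    "len (c @ e) = length c + len e \<longrightarrow> len e \<le> len (z @ e)" by blast
  have eq: "act ((x # c) @ e) = act ((x # z @ e) @ v)" using zv(4) by (simp add: act_Cons)
  have up: "len (c @ e) = length c + len e" if "len ((x # c) @ e) = length (x # c) + len e"
    using that len_Cons_le[of x "c @ e"] len_append_le[of c e] len_le_length[of c] by simp
  show ?case
  proof (cases "right_minimal Y (x # z @ e)")
    case True
    have "len (c @ e) = len (z @ e) + len v"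
      using len_append_right_minimal[OF zv(2,3)] len_cong[OF zv(4)] by simp
    moreover have "len ((x # c) @ e) = len (x # z @ e) + len v"
      using len_append_right_minimal[OF zv(2) True] len_cong[OF eq] by simp
    ultimately have "len ((x # c) @ e) = length (x # c) + len e \<longrightarrow> len e \<le> len (x # z @ e)"
      using up zv(5) by auto
    then show ?thesis using True zv eq by (intro exI[of _ "x # z"] exI[of _ v]) auto
  next
    case False
    then obtain k where k: "k \<in> Y" "act (x # z @ e) = act ((z @ e) @ [k])"
      using right_minimal_Cons[OF zv(3)] by blast
    have "act ((x # c) @ e) = act (z @ e @ k # v)"
      using eq act_context[OF k(2), of "[]" v] by simp
    then show ?thesis using k zv up by (intro exI[of _ z] exI[of _ "k # v"]) auto
  qed
qed

lemma double_coset_representative: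
  assumes g: "right_minimal Y g" and h: "left_minimal X h" "right_minimal Y h"
    and eq: "act g = act (a @ h @ b)" and ab: "set a \<subseteq> X" "set b \<subseteq> Y"
  shows "\<exists>z. act g = act (z @ h) \<and> len g = len z + len h"
proof -
  obtain z v where zv: "set z \<subseteq> set a" "set v \<subseteq> Y" "right_minimal Y (z @ h)" "act (a @ h) = act (z @ h @ v)"
    using walk_up[OF h(2), of a] by blast
  have "act (g @ []) = act ((z @ h) @ (v @ b))"
    using eq act_context[OF zv(4), of "[]" b] by simp
  then have "act g = act (z @ h)"
    using right_minimal_unique(1)[OF g zv(3), of "[]" "v @ b"] zv(2) ab(2) by simp
  moreover have "len (z @ h) = len z + len h"
    using len_append_left_minimal[OF _ h(1), of z] zv(1) ab(1) by blast
  ultimately show ?thesis using len_cong by metis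
qed

text \<open>Each of the two elements is of the form \<open>z\<close> times the other one with lengths adding up, so \<open>z\<close> is
  trivial.\<close>

theorem double_coset_unique:
  assumes g: "left_minimal X g" "right_minimal Y g" and h: "left_minimal X h" "right_minimal Y h"
    and eq: "act g = act (a @ h @ b)" and ab: "set a \<subseteq> X" "set b \<subseteq> Y"
  shows "act g = act h"
proof -
  obtain z where z: "act g = act (z @ h)" "len g = len z + len h"
    using double_coset_representative[OF g(2) h eq ab] by blast
  have "act (h @ b) = act (rev a @ g)" using eq act_move_left[of a "h @ b" g] by simp
  then have "act h = act (rev a @ g @ rev b)" using act_move_right[of h b "rev a @ g"] by simp
  then obtain z' where z': "act h = act (z' @ g)" "len h = len z' + len g"
    using double_coset_representative[OF h(2) g, of "rev a" "rev b"] ab by auto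
  have "len z = 0" using z z' by simp
  then have "act z = id" using len_eq_0[of z] by blast
  then show ?thesis using z(1) act_append[of z h] by simp
qed

text \<open>The index set of \<open>S\<^sub>X \<inter> h S\<^sub>Y h\<^sup>-\<^sup>1\<close>. Conjugation by \<open>h\<close> matches it with
  \<open>conj_letters Y X (rev h)\<close>.\<close>

definition conj_letters :: "'a set \<Rightarrow> 'a set \<Rightarrow> 'a list \<Rightarrow> 'a set"
  where "conj_letters X Y h = {x \<in> X. \<exists>y\<in>Y. act (x # h) = act (h @ [y])}"

text \<open>The intersection of a parabolic subgroup with a conjugate by a minimal double coset representative
  is generated by the obvious letters. If the last letter of \<open>c\<close> were not one of them, it would move \<open>h\<close> to
  a longer representative; from there representatives do not get shorter, so the walk could not return
  to the coset of \<open>h\<close>.\<close>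

theorem kilmoyer:
  assumes h: "left_minimal X h" "right_minimal Y h"
    and c: "reduced c" "set c \<subseteq> X" "act (c @ h) = act (h @ v)" "set v \<subseteq> Y"
  shows "set c \<subseteq> conj_letters X Y h"
  using c
proof (induction c arbitrary: v rule: rev_induct)
  case (snoc x c)
  show ?case
  proof (cases "\<exists>y\<in>Y. act (x # h) = act (h @ [y])")
    case True
    then obtain y where y: "y \<in> Y" "act (x # h) = act (h @ [y])" by blast
    have "act ((c @ h) @ [y]) = act (h @ v)"
      using snoc.prems(3) act_context[OF y(2), of c "[]"] by simp
    then have "act (c @ h) = act (h @ v @ [y])" using act_move_right[of "c @ h" "[y]" "h @ v"] by simp
    then have "set c \<subseteq> conj_letters X Y h"
      using snoc.IH[of "v @ [y]"] snoc.prems y(1) reduced_appendD(1)[of c "[x]"] by simp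
    then show ?thesis using y snoc.prems(2) by (auto simp: conj_letters_def)
  next
    case False
    then have rm: "right_minimal Y (x # h)" using right_minimal_Cons[OF h(2)] by blast
    have lx: "len h < len (x # h)" using h(1) snoc.prems(2) by (simp add: left_minimal_def)
    have "len (c @ x # h) = len (c @ [x]) + len h"
      using len_append_left_minimal[OF snoc.prems(2) h(1)] by simp
    then have "len (c @ x # h) = length c + len (x # h)"
      using snoc.prems(1) lx len_Cons_cases[of x h] by (simp add: reduced_def)
    then obtain z v' where z: "set v' \<subseteq> Y" "right_minimal Y (z @ x # h)" "act (c @ x # h) = act (z @ (x # h) @ v')"
      "len (x # h) \<le> len (z @ x # h)"
      using walk_up[OF rm, of c] by blast
    have "act ((z @ x # h) @ v') = act (h @ v)" using z(3) snoc.prems(3) by simp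
    then have "act (z @ x # h) = act h"
      using right_minimal_unique(1)[OF z(2) h(2) _ z(1) snoc.prems(4)] by blast
    then show ?thesis using len_cong[of "z @ x # h" h] lx z(4) by simp
  qed
qed simp

text \<open>The given product \<open>a h b\<close> need not be reduced. It has a reduced factorization \<open>u h v\<close> of the same
  shape, and by \<open>kilmoyer\<close> the factors \<open>a\<close> and \<open>u\<close> differ only by an element \<open>c\<close> that can be moved through
  \<open>h\<close>. Since \<open>u h\<close> is minimal in its coset, \<open>u\<close> has no right descent that can be moved through
  \<open>h\<close>, so \<open>u c\<close> is reduced as well.\<close>

theorem double_coset_factorization:
  assumes h: "left_minimal X h" "right_minimal Y h" "reduced h" and ab: "set a \<subseteq> X" "set b \<subseteq> Y"
  obtains u c v where "set u \<subseteq> X" "set c \<subseteq> conj_letters X Y h" "set v \<subseteq> Y"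
    "act (a @ h @ b) = act (u @ h @ v)" "reduced (u @ h @ v)" "act a = act (u @ c)" "reduced (u @ c)"
proof -
  let ?w = "a @ h @ b"
  obtain e v where e: "set v \<subseteq> Y" "act ?w = act (e @ v)" "length v + len e = len ?w" "right_minimal Y e"
    by (rule right_coset_decomposition)
  obtain u g where g: "set u \<subseteq> X" "act e = act (u @ g)" "length u + len g = len e" "left_minimal X g"
    by (rule left_coset_decomposition)
  have g_right: "right_minimal Y g" using right_minimal_suffix[OF g(2,3) e(4)] .
  have w: "act ?w = act (u @ g @ v)" using e(2) act_context[OF g(2), of "[]" v] by simp
  then have "act ((a @ h @ b) @ rev v) = act (u @ g)"
    using act_move_right[of "u @ g" v ?w] by simp
  then have "act (u @ g) = act (a @ h @ b @ rev v)" by simp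
  then have "act g = act ((rev u @ a) @ h @ (b @ rev v))"
    using act_move_left[of u g "a @ h @ b @ rev v"] by simp
  then have gh: "act g = act h"
    by (rule double_coset_unique[OF g(4) g_right h(1,2)]) (use ab g(1) e(1) in auto)
  have uhv: "act ?w = act (u @ h @ v)" using w act_context[OF gh, of u v] by simp
  have red: "reduced (u @ h @ v)"
    using e(3) g(3) len_cong[OF gh] len_cong[OF uhv] h(3) by (simp add: reduced_def)
  have e_uh: "act e = act (u @ h)" using g(2) act_context[OF gh, of u "[]"] by simp
  obtain c where c: "set c \<subseteq> X" "act c = act (rev u @ a)" "length c = len (rev u @ a)"
    using parabolic_reduced_word[of "rev u @ a" X] ab(1) g(1) by auto
  have "act (u @ h @ v) = act ((a @ h) @ b)" using uhv by simp
  then have "act ((u @ h @ v) @ rev b) = act (a @ h)" using act_move_right[of "a @ h" b "u @ h @ v"] by simp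
  then have "act (h @ v @ rev b) = act (rev u @ a @ h)"
    using act_move_left[of u "h @ v @ rev b" "a @ h"] by simp
  then have "act (c @ h) = act (h @ v @ rev b)" using act_context[OF c(2), of "[]" h] by simp
  then have c_conj: "set c \<subseteq> conj_letters X Y h"
    using kilmoyer[OF h(1,2)] c e(1) ab(2) len_cong[OF c(2)] by (simp add: reduced_def)
  have a: "act a = act (u @ c)" using c(2) act_move_left[of u c a] by simp
  have "right_minimal (conj_letters X Y h) u"
    unfolding right_minimal_def
  proof
    fix x assume "x \<in> conj_letters X Y h"
    then obtain y where y: "x \<in> X" "y \<in> Y" "act (x # h) = act (h @ [y])" by (auto simp: conj_letters_def)
    have "act (u @ x # h) = act (e @ [y])"
      using act_context[OF y(3), of u "[]"] act_context[OF e_uh, of "[]" "[y]"] by simp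
    then have "len (u @ x # h) = len (e @ [y])" by (rule len_cong)
    then have "len e < len (u @ x # h)" using e(4) y(2) by (simp add: right_minimal_def)
    also have "\<dots> \<le> len (u @ [x]) + len h" using len_append_le[of "u @ [x]" h] by simp
    finally show "len u < len (u @ [x])"
      using g(3) len_cong[OF gh] len_le_length[of u] by simp
  qed
  then have "len (u @ c) = len u + len c" using len_append_right_minimal c_conj by blast
  moreover have "len u = length u"
    using red reduced_appendD(1)[of u "h @ v"] by (simp add: reduced_def)
  ultimately have "reduced (u @ c)" using c(3) len_cong[OF c(2)] by (simp add: reduced_def)
  then show ?thesis using that g(1) c_conj e(1) uhv red a by blast
qed

lemma conj_letters_rev:
  "conj_letters Y X (rev h) = {y \<in> Y. \<exists>x\<in>X. act (x # h) = act (h @ [y])}"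
proof -
  have "act (y # rev h) = act (rev h @ [x]) \<longleftrightarrow> act (x # h) = act (h @ [y])" for x y
    using act_rev_cong[of "y # rev h" "rev h @ [x]"] act_rev_cong[of "x # h" "h @ [y]"] by auto
  then show ?thesis by (simp add: conj_letters_def)
qed

lemma reduced_rev: "reduced (rev ks) \<longleftrightarrow> reduced ks"
  by (simp add: reduced_def len_rev)

corollary double_coset_factorization_right:
  assumes h: "left_minimal X h" "right_minimal Y h" "reduced h" and ab: "set a \<subseteq> X" "set b \<subseteq> Y"
  obtains u c v where "set u \<subseteq> X" "set c \<subseteq> conj_letters Y X (rev h)" "set v \<subseteq> Y"
    "act (a @ h @ b) = act (u @ h @ v)" "reduced (u @ h @ v)" "act b = act (c @ v)" "reduced (c @ v)"
proof -
  have "left_minimal Y (rev h)" "right_minimal X (rev h)" "reduced (rev h)" "set (rev b) \<subseteq> Y" "set (rev a) \<subseteq> X"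
    using assms by (simp_all add: right_minimal_rev reduced_rev)
  then obtain u c v where ucv: "set u \<subseteq> Y" "set c \<subseteq> conj_letters Y X (rev h)" "set v \<subseteq> X"
    "act (rev b @ rev h @ rev a) = act (u @ rev h @ v)" "reduced (u @ rev h @ v)"
    "act (rev b) = act (u @ c)" "reduced (u @ c)"
    by (rule double_coset_factorization)
  show ?thesis
  proof (rule that[of "rev v" "rev c" "rev u"])
    show "act (a @ h @ b) = act (rev v @ h @ rev u)" using act_rev_cong[OF ucv(4)] by simp
    show "reduced (rev v @ h @ rev u)" using ucv(5) reduced_rev[of "rev v @ h @ rev u"] by simp
    show "act b = act (rev c @ rev u)" using act_rev_cong[OF ucv(6)] by simp
    show "reduced (rev c @ rev u)" using ucv(7) reduced_rev[of "rev c @ rev u"] by simp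
  qed (use ucv in simp_all)
qed

section \<open>Walks along signed words\<close>

text \<open>An inverse generator moves like the generator and puts out the inverse letter.\<close>

fun signed_output :: "'a set \<Rightarrow> 'a signed_word \<Rightarrow> (('a \<Rightarrow> real) \<Rightarrow> 'a \<Rightarrow> real) \<Rightarrow> 'a signed_word"
  where
    "signed_output Y [] d = []"
  | "signed_output Y ((i, b) # u) d =
      map (\<lambda>k. (k, b)) (emit Y i (walk Y (map fst u) d)) @ signed_output Y u d"

lemma map_fst_signed_output: "map fst (signed_output Y u d) = emitted Y (map fst u) d"
  by (induction u) (auto simp: o_def)

lemma signed_output_positive:
  "signed_output Y (map (\<lambda>k. (k, True)) ks) d = map (\<lambda>k. (k, True)) (emitted Y ks d)"
  by (induction ks) (auto simp: o_def)

lemma signed_output_append: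
  "signed_output Y (u @ v) d = signed_output Y u (walk Y (map fst v) d) @ signed_output Y v d"
  by (induction u) (auto simp: walk_append)

lemma id_in_minimal_reps: "id \<in> minimal_reps Y"
proof -
  have "right_minimal Y []" using len_snoc_cases[of "[]"] by (auto simp: right_minimal_def)
  then show ?thesis using act_in_minimal_reps[of "[]" Y] by simp
qed

text \<open>Suffixes of a reduced word of a minimal representative are minimal, so no step is blocked.\<close>

lemma walk_minimal_word:
  assumes "reduced ks" "right_minimal Y ks"
  shows "walk Y ks id = act ks \<and> emitted Y ks id = []"
  using assms
proof (induction ks)
  case (Cons i ks)
  have "reduced ks" using Cons.prems(1) by (rule reduced_ConsD)
  moreover have "right_minimal Y ks"
    using right_minimal_suffix[of "i # ks" "[i]" ks Y] Cons.prems \<open>reduced ks\<close> by (simp add: reduced_def)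
  ultimately have "walk Y ks id = act ks \<and> emitted Y ks id = []" using Cons.IH by blast
  moreover have "reflection i \<circ> act ks \<in> minimal_reps Y"
    using act_in_minimal_reps[of "i # ks" Y] Cons.prems(2) by (simp add: act_Cons)
  ultimately show ?case
    by (simp only: walk.simps emitted.simps move_def emit_def act_Cons simp_thms if_True append_Nil)
qed simp

lemma signed_output_parabolic:
  assumes "u \<in> signed_words Y"
  shows "walk Y (map fst u) id = id \<and> signed_output Y u id = u"
  using assms
proof (induction u rule: list.induct)
  case (Cons a u)
  obtain k b where a: "a = (k, b)" by force
  have "k \<in> Y" using Cons.prems a by simp
  moreover have "u \<in> signed_words Y" using Cons.prems by simp
  then have "walk Y (map fst u) id = id \<and> signed_output Y u id = u" by (rule Cons.IH)
  moreover have "move Y k id = id" "emit Y k id = [k]"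
    using blocked_step[OF id_in_minimal_reps \<open>k \<in> Y\<close>, of k] by (simp_all only: id_comp comp_id)
  ultimately show ?case by (simp only: a walk.simps signed_output.simps list.map fst_conv append_Cons append_Nil simp_thms)
qed simp

end

section \<open>Conjugates of subsets of a group\<close>

context group
begin

lemma conjugate_set_image: "conjugate_set G g H = (\<lambda>h. g \<otimes> h \<otimes> inv g) ` H"
  by (auto simp: conjugate_set_def l_coset_def r_coset_def)

lemma eq_conjugate_iff:
  assumes "g \<in> carrier G" "x \<in> carrier G" "y \<in> carrier G"
  shows "x = g \<otimes> y \<otimes> inv g \<longleftrightarrow> x \<otimes> g = g \<otimes> y"
  using assms inv_solve_right[of x "g \<otimes> y" g] by auto

lemma conjugate_set_mult:
  assumes "a \<in> carrier G" "b \<in> carrier G" "H \<subseteq> carrier G"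
  shows "conjugate_set G (a \<otimes> b) H = conjugate_set G a (conjugate_set G b H)"
proof -
  have "a \<otimes> b \<otimes> h \<otimes> inv (a \<otimes> b) = a \<otimes> (b \<otimes> h \<otimes> inv b) \<otimes> inv a" if "h \<in> H" for h
  proof -
    have "h \<in> carrier G" using that assms by blast
    then show ?thesis using assms(1,2) by (simp add: inv_mult_group m_assoc)
  qed
  then show ?thesis unfolding conjugate_set_image image_image by (intro image_cong) auto
qed

lemma conjugate_set_carrier:
  assumes "a \<in> carrier G" "H \<subseteq> carrier G"
  shows "conjugate_set G a H \<subseteq> carrier G"
  using assms by (auto simp: conjugate_set_image)

lemma conjugate_set_subgroup:
  assumes "subgroup H G" "q \<in> H"
  shows "conjugate_set G q H = H"
proof
  interpret H: subgroup H G by fact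
  have q: "q \<in> carrier G" "inv q \<in> H" using assms by auto
  have cl: "a \<otimes> h \<otimes> b \<in> H" if "a \<in> H" "h \<in> H" "b \<in> H" for a h b
    using that by (intro H.m_closed)
  show "conjugate_set G q H \<subseteq> H"
    unfolding conjugate_set_image using cl assms(2) q(2) by blast
  show "H \<subseteq> conjugate_set G q H"
  proof
    fix h assume h: "h \<in> H"
    then have hc: "h \<in> carrier G" by (rule H.mem_carrier)
    have "h = q \<otimes> (inv q \<otimes> h \<otimes> q) \<otimes> inv q"
      using q hc eq_conjugate_iff[of q h "inv q \<otimes> h \<otimes> q"] by (simp add: m_assoc[symmetric])
    then show "h \<in> conjugate_set G q H"
      unfolding conjugate_set_image using cl[OF q(2) h assms(2)] by (rule image_eqI)
  qed
qed

lemma conjugate_set_Int: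
  assumes "p \<in> carrier G" "A \<subseteq> carrier G" "B \<subseteq> carrier G"
  shows "conjugate_set G p (A \<inter> B) = conjugate_set G p A \<inter> conjugate_set G p B"
  unfolding conjugate_set_image
proof (rule inj_on_image_Int)
  show "inj_on (\<lambda>h. p \<otimes> h \<otimes> inv p) (carrier G)"
    using assms(1) by (auto intro!: inj_onI)
qed (use assms in auto)

text \<open>The factor \<open>q\<close> is absorbed by \<open>H\<close>, the factor \<open>p\<close> normalizes \<open>P\<close> and can be pulled out of the intersection,
  and \<open>c\<close> is absorbed by \<open>Q\<close>.\<close>

lemma conjugate_set_Int_subgroup:
  assumes "subgroup H G" "subgroup P G" "subgroup Q G"
    and "p \<in> P" "c \<in> Q" "k \<in> carrier G" "q \<in> H"
    and "conjugate_set G k H \<inter> P = Q"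
  shows "conjugate_set G (p \<otimes> k \<otimes> q) H \<inter> P = conjugate_set G (p \<otimes> c) Q"
proof -
  have c: "H \<subseteq> carrier G" "P \<subseteq> carrier G" "Q \<subseteq> carrier G" "p \<in> carrier G" "c \<in> carrier G" "q \<in> carrier G"
    using assms subgroup.subset subgroup.mem_carrier by blast+
  have "conjugate_set G (p \<otimes> k \<otimes> q) H = conjugate_set G p (conjugate_set G k H)"
    using assms c by (simp add: conjugate_set_mult conjugate_set_subgroup)
  moreover have "P = conjugate_set G p P" using assms conjugate_set_subgroup by simp
  ultimately have "conjugate_set G (p \<otimes> k \<otimes> q) H \<inter> P = conjugate_set G p (conjugate_set G k H \<inter> P)"
    using conjugate_set_Int[OF c(4) conjugate_set_carrier[OF assms(6) c(1)] c(2)] by simp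
  also have "\<dots> = conjugate_set G (p \<otimes> c) Q"
    using assms c by (simp add: conjugate_set_mult conjugate_set_subgroup)
  finally show ?thesis .
qed

end

section \<open>Presented groups\<close>

abbreviation positive_word :: "'a list \<Rightarrow> 'a signed_word"
  where "positive_word ks \<equiv> map (\<lambda>k. (k, True)) ks"

abbreviation inverse_word :: "'a signed_word \<Rightarrow> 'a signed_word"
  where "inverse_word u \<equiv> rev (map (\<lambda>(x, b). (x, \<not> b)) u)"

lemma positive_word_in [simp]: "positive_word ks \<in> signed_words V \<longleftrightarrow> ks \<in> lists V"
  by (auto simp: in_lists_conv_set)

lemma inverse_word_in: "u \<in> signed_words V \<Longrightarrow> inverse_word u \<in> signed_words V"
  by (auto simp: in_lists_conv_set)

lemma signed_words_mono: "X \<subseteq> Y \<Longrightarrow> u \<in> signed_words X \<Longrightarrow> u \<in> signed_words Y"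
  by (auto simp: in_lists_conv_set)

lemma pres_class_in_carrier: "u \<in> signed_words S \<Longrightarrow> pres_class S R u \<in> carrier (presented_group S R)"
  by (simp add: presented_group_def)

lemma presented_group_one: "\<one>\<^bsub>presented_group S R\<^esub> = pres_class S R []"
  by (simp add: presented_group_def)

lemma presented_group_inv:
  assumes "u \<in> signed_words S"
  shows "inv\<^bsub>presented_group S R\<^esub> (pres_class S R u) = pres_class S R (inverse_word u)"
proof (rule group.inv_equality[OF group_presented_group])
  have i: "inverse_word u \<in> signed_words S" using assms by (rule inverse_word_in)
  show "pres_class S R (inverse_word u) \<otimes>\<^bsub>presented_group S R\<^esub> pres_class S R u = \<one>\<^bsub>presented_group S R\<^esub>"
    using pres_eq_inverse[OF assms, of R] pres_class_eq_iff[of "inverse_word u @ u" S R "[]"] i assms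
    by (simp only: presented_group_mult presented_group_one append_in_lists_conv simp_thms)
  show "pres_class S R u \<in> carrier (presented_group S R)"
    "pres_class S R (inverse_word u) \<in> carrier (presented_group S R)"
    using assms i by (simp_all only: pres_class_in_carrier)
qed

lemma generate_presented_group:
  assumes "X \<subseteq> S"
  shows "generate (presented_group S R) (pres_gen S R ` X) = pres_class S R ` signed_words X"
proof
  let ?G = "presented_group S R"
  interpret group ?G by (rule group_presented_group)
  have sub: "u \<in> signed_words S" if "u \<in> signed_words X" for u using signed_words_mono assms that by blast
  show "generate ?G (pres_gen S R ` X) \<subseteq> pres_class S R ` signed_words X"
  proof
    fix g assume "g \<in> generate ?G (pres_gen S R ` X)"
    then show "g \<in> pres_class S R ` signed_words X"
    proof induction
      case one
      have "[] \<in> signed_words X" by simp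
      then show ?case by (simp only: presented_group_one image_eqI)
    next
      case (incl h)
      then obtain x where x: "x \<in> X" "h = pres_class S R [(x, True)]" by (auto simp: pres_gen_def)
      then show ?case by (intro image_eqI[of _ _ "[(x, True)]"]) auto
    next
      case (inv h)
      then obtain x where x: "x \<in> X" "h = pres_class S R [(x, True)]" by (auto simp: pres_gen_def)
      then have "inv\<^bsub>?G\<^esub> h = pres_class S R [(x, False)]"
        using presented_group_inv[of "[(x, True)]" S R] assms by auto
      then show ?case using x by (intro image_eqI[of _ _ "[(x, False)]"]) auto
    next
      case (eng g h)
      then obtain u v where uv: "u \<in> signed_words X" "g = pres_class S R u" "v \<in> signed_words X" "h = pres_class S R v"
        by (elim imageE)
      then have "g \<otimes>\<^bsub>?G\<^esub> h = pres_class S R (u @ v)" using sub by (simp only: presented_group_mult)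
      moreover have "u @ v \<in> signed_words X" using uv by (simp only: append_in_lists_conv simp_thms)
      ultimately show ?case by (rule image_eqI)
    qed
  qed
  show "pres_class S R ` signed_words X \<subseteq> generate ?G (pres_gen S R ` X)"
  proof (rule image_subsetI)
    fix u assume "u \<in> signed_words X"
    then show "pres_class S R u \<in> generate ?G (pres_gen S R ` X)"
    proof (induction u rule: list.induct)
      case Nil
      then show ?case using generate.one[of ?G] by (simp only: presented_group_one)
    next
      case (Cons a u)
      obtain x b where a: "a = (x, b)" by force
      have x: "x \<in> X" "u \<in> signed_words X" using Cons.prems by (simp_all add: a)
      have x': "pres_class S R [(x, True)] \<in> pres_gen S R ` X" using x by (auto simp: pres_gen_def)
      have "pres_class S R [(x, b)] \<in> generate ?G (pres_gen S R ` X)"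
      proof (cases b)
        case True
        then show ?thesis using generate.incl[OF x'] by simp
      next
        case False
        have "[(x, True)] \<in> signed_words S" using x assms by auto
        then have "inv\<^bsub>?G\<^esub> (pres_class S R [(x, True)]) = pres_class S R [(x, False)]"
          using presented_group_inv[of "[(x, True)]" S R] by simp
        then show ?thesis using generate.inv[OF x', of ?G] False by simp
      qed
      then have "pres_class S R [(x, b)] \<otimes>\<^bsub>?G\<^esub> pres_class S R u \<in> generate ?G (pres_gen S R ` X)"
        using Cons.IH x by (blast intro: generate.eng)
      moreover have "[(x, b)] \<in> signed_words S" using x assms by auto
      ultimately show ?case
        using sub[OF x(2)] presented_group_mult[of "[(x, b)]" S u R] by (simp add: a)
    qed
  qed
qed

lemma foldr_presented_group:
  assumes "ks \<in> lists S"
  shows "foldr (mult (presented_group S R)) (map (pres_gen S R) ks) \<one>\<^bsub>presented_group S R\<^esub> =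
    pres_class S R (positive_word ks)"
  using assms
proof (induction ks rule: list.induct)
  case (Cons k ks)
  have "[(k, True)] \<in> signed_words S" "positive_word ks \<in> signed_words S" using Cons.prems by simp_all
  then show ?case
    using Cons presented_group_mult[of "[(k, True)]" S "positive_word ks" R] by (simp add: pres_gen_def)
qed (simp add: presented_group_one)

lemma pres_eq_context:
  assumes "pres_eq S R u v" "x \<in> signed_words S" "y \<in> signed_words S"
  shows "pres_eq S R (x @ u @ y) (x @ v @ y)"
  by (rule pres_eq.append[OF pres_eq.refl[OF assms(2)] pres_eq.append[OF assms(1) pres_eq.refl[OF assms(3)]]])

section \<open>The Coxeter group and the Artin-Tits group of a graph\<close>

text \<open>The value \<open>0\<close> encodes a missing edge, that is, no relation.\<close>

definition edge_label :: "'a labelled_graph \<Rightarrow> 'a \<Rightarrow> 'a \<Rightarrow> nat"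
  where "edge_label \<Gamma> i j = (if {i, j} \<in> edges \<Gamma> then label \<Gamma> {i, j} else 0)"

locale artin_graph =
  fixes \<Gamma> :: "'a labelled_graph"
  assumes graph: "finite_labelled_graph \<Gamma>"
begin

lemma edge_labelD:
  assumes "{i, j} \<in> edges \<Gamma>"
  shows "i \<noteq> j" "edge_label \<Gamma> i j = label \<Gamma> {i, j}" "edge_label \<Gamma> i j \<noteq> 0" "i \<in> verts \<Gamma>" "j \<in> verts \<Gamma>"
proof -
  have g: "{i, j} \<subseteq> verts \<Gamma>" "card {i, j} = 2" "2 \<le> label \<Gamma> {i, j}"
    using graph assms unfolding finite_labelled_graph_def by blast+
  then show "i \<noteq> j" by auto
  show "edge_label \<Gamma> i j = label \<Gamma> {i, j}" using assms by (simp add: edge_label_def)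
  then show "edge_label \<Gamma> i j \<noteq> 0" using g by simp
  show "i \<in> verts \<Gamma>" "j \<in> verts \<Gamma>" using g by auto
qed

sublocale coxeter_matrix "edge_label \<Gamma>"
proof
  show "edge_label \<Gamma> i j = edge_label \<Gamma> j i" for i j by (simp add: edge_label_def insert_commute)
  show "edge_label \<Gamma> i j \<noteq> 1" for i j
  proof (cases "{i, j} \<in> edges \<Gamma>")
    case True
    then have "2 \<le> label \<Gamma> {i, j}" using graph by (simp add: finite_labelled_graph_def)
    then show ?thesis using True by (simp add: edge_label_def)
  qed (simp add: edge_label_def)
qed

abbreviation V where "V \<equiv> verts \<Gamma>"

lemma braid_eq_pres_eq:
  assumes "braid_eq ks ls" "ks \<in> lists V" "braid_rels \<Gamma> \<subseteq> R"
  shows "pres_eq V R (positive_word ks) (positive_word ls)"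
  using assms(1,2)
proof induction
  case (refl ks)
  then show ?case by (simp add: pres_eq.refl)
next
  case (sym ks ls)
  then show ?case using braid_eq_set[of ks ls] by (auto simp: in_lists_conv_set intro: pres_eq.sym)
next
  case (trans ks ls us)
  then show ?case using braid_eq_set[of ks ls] by (auto simp: in_lists_conv_set intro: pres_eq.trans)
next
  case (braid i j us vs)
  have e: "{i, j} \<in> edges \<Gamma>" using braid(2) by (simp add: edge_label_def split: if_splits)
  have "(positive_word (alternating i j (label \<Gamma> {i, j})), positive_word (alternating j i (label \<Gamma> {i, j}))) \<in> R"
    using assms(3) e by (auto simp: braid_rels_def)
  moreover have "alternating i j n \<in> lists V" "alternating j i n \<in> lists V" for n
    using set_alternating[of i j n] set_alternating[of j i n] edge_labelD(4,5)[OF e]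
    by (auto simp: in_lists_conv_set)
  ultimately have "pres_eq V R (positive_word (alternating i j (label \<Gamma> {i, j})))
      (positive_word (alternating j i (label \<Gamma> {i, j})))"
    by (intro pres_eq.rel) simp_all
  moreover have "positive_word us \<in> signed_words V" "positive_word vs \<in> signed_words V"
    using braid(3) by simp_all
  ultimately show ?case unfolding edge_labelD(2)[OF e] map_append by (rule pres_eq_context)
qed

lemma pres_eq_act:
  assumes "pres_eq V R u v" "R \<subseteq> coxeter_rels \<Gamma>"
  shows "act (map fst u) = act (map fst v)"
  using assms(1)
proof induction
  case (rel u v)
  have fst_pos: "map fst (positive_word ks) = ks" for ks :: "'a list" by (simp add: o_def)
  consider (braid) i j where "{i, j} \<in> edges \<Gamma>"
      "u = positive_word (alternating i j (label \<Gamma> {i, j}))" "v = positive_word (alternating j i (label \<Gamma> {i, j}))"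
    | (square) i where "u = [(i, True), (i, True)]" "v = []"
    using rel(1) assms(2) by (auto simp: coxeter_rels_def braid_rels_def)
  then show ?case
  proof cases
    case braid
    then show ?thesis
      using braid_relation[of i j] edge_labelD[OF braid(1)] by (simp only: fst_pos) simp
  next
    case square
    then show ?thesis by simp
  qed
next
  case (append u v u' v')
  then show ?case by (simp add: act_append)
qed simp_all

lemma artin_word_eq: "ks \<in> lists V \<Longrightarrow> artin_word \<Gamma> ks = pres_class V (braid_rels \<Gamma>) (positive_word ks)"
  unfolding artin_word_def artin_group_def artin_gen_def by (rule foldr_presented_group)

lemma coxeter_word_eq: "ks \<in> lists V \<Longrightarrow> coxeter_word \<Gamma> ks = pres_class V (coxeter_rels \<Gamma>) (positive_word ks)"
  unfolding coxeter_word_def coxeter_group_def coxeter_gen_def by (rule foldr_presented_group)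

lemma coxeter_square: "x \<in> V \<Longrightarrow> pres_eq V (coxeter_rels \<Gamma>) [(x, True), (x, True)] []"
  by (rule pres_eq.rel) (auto simp: coxeter_rels_def)

lemma coxeter_pres_eq_positive:
  assumes "u \<in> signed_words V"
  shows "pres_eq V (coxeter_rels \<Gamma>) u (positive_word (map fst u))"
  using assms
proof (induction u rule: list.induct)
  case (Cons a u)
  obtain x b where a: "a = (x, b)" by force
  have x: "x \<in> V" "u \<in> signed_words V" using Cons.prems by (simp_all add: a)
  have "pres_eq V (coxeter_rels \<Gamma>) [(x, b)] [(x, True)]"
  proof (cases b)
    case True
    then show ?thesis using x by (simp add: pres_eq.refl)
  next
    case False
    have "pres_eq V (coxeter_rels \<Gamma>) ([(x, False)] @ [(x, True), (x, True)] @ []) ([(x, False)] @ [] @ [])"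
      using x coxeter_square by (intro pres_eq_context) auto
    moreover have "pres_eq V (coxeter_rels \<Gamma>) ([] @ [(x, False), (x, \<not> False)] @ [(x, True)]) ([] @ [] @ [(x, True)])"
      using x by (intro pres_eq_context pres_eq.cancel) auto
    ultimately have "pres_eq V (coxeter_rels \<Gamma>) [(x, False)] [(x, True)]"
      using pres_eq.sym pres_eq.trans by fastforce
    then show ?thesis using False by simp
  qed
  then have "pres_eq V (coxeter_rels \<Gamma>) ([(x, b)] @ u) ([(x, True)] @ positive_word (map fst u))"
    using Cons.IH x(2) by (blast intro: pres_eq.append)
  then show ?case by (simp add: a)
qed (simp add: pres_eq.refl)

text \<open>A word that is not reduced is shortened with the relations alone: by \<open>matsumoto\<close>, the reduced tail can
  be rewritten so that it starts with the letter in front of it, and the square cancels.\<close>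

lemma reduced_representative:
  assumes "ks \<in> lists V"
  shows "\<exists>ls. reduced ls \<and> ls \<in> lists V \<and> pres_eq V (coxeter_rels \<Gamma>) (positive_word ks) (positive_word ls)"
  using assms
proof (induction ks rule: list.induct)
  case Nil
  then show ?case by (intro exI[of _ "[]"]) (simp add: reduced_def pres_eq.refl)
next
  case (Cons i ks)
  then obtain r where r: "reduced r" "r \<in> lists V" "pres_eq V (coxeter_rels \<Gamma>) (positive_word ks) (positive_word r)"
    by auto
  have i: "i \<in> V" using Cons.prems by simp
  have ir: "pres_eq V (coxeter_rels \<Gamma>) (positive_word (i # ks)) (positive_word (i # r))"
    using pres_eq_context[OF r(3), of "[(i, True)]" "[]"] i by simp
  show ?case
  proof (cases "reduced (i # r)")
    case True
    then show ?thesis using r i ir by (intro exI[of _ "i # r"]) simp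
  next
    case False
    obtain r' where r': "act r' = act (i # r)" "length r' = len (i # r)" using reduced_word_exists by blast
    have a: "act (i # r') = act r" by (simp only: act_Cons r'(1)) (simp add: o_assoc)
    have "len r = Suc (length r')"
      using False r(1) r'(2) len_Cons_cases[of i r] by (auto simp: reduced_def)
    then have red: "reduced (i # r')" using len_cong[OF a] by (simp add: reduced_def)
    have b: "braid_eq r (i # r')" using matsumoto[OF r(1) red] a by simp
    then have r'V: "r' \<in> lists V" using braid_eq_set[OF b] r(2) by (auto simp: in_lists_conv_set)
    have "pres_eq V (coxeter_rels \<Gamma>) (positive_word r) (positive_word (i # r'))"
      using braid_eq_pres_eq[OF b r(2)] by (simp add: coxeter_rels_def)
    then have "pres_eq V (coxeter_rels \<Gamma>) (positive_word (i # r)) ([] @ [(i, True), (i, True)] @ positive_word r')"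
      using pres_eq_context[of V _ _ _ "[(i, True)]" "[]"] i by fastforce
    moreover have "pres_eq V (coxeter_rels \<Gamma>) ([] @ [(i, True), (i, True)] @ positive_word r') ([] @ [] @ positive_word r')"
      using coxeter_square[OF i] r'V by (intro pres_eq_context) auto
    ultimately have "pres_eq V (coxeter_rels \<Gamma>) (positive_word (i # ks)) (positive_word r')"
      using ir by (metis append_Nil pres_eq.trans)
    then show ?thesis using r'V reduced_ConsD[OF red] by blast
  qed
qed

text \<open>The geometric representation is faithful on the presented Coxeter group.\<close>

theorem coxeter_word_eq_iff:
  assumes "ks \<in> lists V" "ls \<in> lists V"
  shows "coxeter_word \<Gamma> ks = coxeter_word \<Gamma> ls \<longleftrightarrow> act ks = act ls"
proof -
  have "act ks = act ls \<longleftrightarrow> pres_eq V (coxeter_rels \<Gamma>) (positive_word ks) (positive_word ls)"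
  proof
    assume e: "act ks = act ls"
    obtain ks' where ks': "reduced ks'" "ks' \<in> lists V" "pres_eq V (coxeter_rels \<Gamma>) (positive_word ks) (positive_word ks')"
      using reduced_representative[OF assms(1)] by blast
    obtain ls' where ls': "reduced ls'" "ls' \<in> lists V" "pres_eq V (coxeter_rels \<Gamma>) (positive_word ls) (positive_word ls')"
      using reduced_representative[OF assms(2)] by blast
    have "act ks' = act ls'"
      using e pres_eq_act[OF ks'(3)] pres_eq_act[OF ls'(3)] by (simp add: o_def)
    then have "braid_eq ks' ls'" using matsumoto ks'(1) ls'(1) by blast
    then have "pres_eq V (coxeter_rels \<Gamma>) (positive_word ks') (positive_word ls')"
      using ks'(2) by (rule braid_eq_pres_eq) (simp add: coxeter_rels_def)
    then show "pres_eq V (coxeter_rels \<Gamma>) (positive_word ks) (positive_word ls)"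
      using ks'(3) ls'(3) by (blast intro: pres_eq.trans pres_eq.sym)
  next
    assume "pres_eq V (coxeter_rels \<Gamma>) (positive_word ks) (positive_word ls)"
    from pres_eq_act[OF this] show "act ks = act ls" by (simp add: o_def)
  qed
  then show ?thesis using assms by (simp only: coxeter_word_eq pres_class_eq_iff positive_word_in)
qed

lemma reduced_word_in_verts:
  assumes "ks \<in> lists V"
  obtains ls where "ls \<in> lists V" "act ls = act ks" "length ls = len ks"
proof -
  have "set ks \<subseteq> V" using assms by (simp add: lists_eq_set)
  then obtain ls where "set ls \<subseteq> V" "act ls = act ks" "length ls = len ks"
    by (rule parabolic_reduced_word)
  then show ?thesis using that[of ls] by (simp add: lists_eq_set)
qed

lemma coxeter_length_eq:
  assumes "ks \<in> lists V"
  shows "coxeter_length \<Gamma> (coxeter_word \<Gamma> ks) = len ks"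
  unfolding coxeter_length_def
proof (rule Least_equality)
  obtain ls where "ls \<in> lists V" "act ls = act ks" "length ls = len ks"
    using reduced_word_in_verts[OF assms] .
  then show "\<exists>ls\<in>lists V. coxeter_word \<Gamma> ls = coxeter_word \<Gamma> ks \<and> length ls = len ks"
    using coxeter_word_eq_iff assms by blast
next
  fix n assume "\<exists>ls\<in>lists V. coxeter_word \<Gamma> ls = coxeter_word \<Gamma> ks \<and> length ls = n"
  then show "len ks \<le> n" using coxeter_word_eq_iff[OF _ assms] len_le by blast
qed

text \<open>The section is well defined: by Matsumoto's theorem the choice of the reduced word is immaterial.\<close>

theorem kappa_eq:
  assumes "ks \<in> lists V" "reduced ks"
  shows "kappa \<Gamma> (coxeter_word \<Gamma> ks) = artin_word \<Gamma> ks"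
  unfolding kappa_def
proof (rule the_equality)
  have "reduced_word \<Gamma> (coxeter_word \<Gamma> ks) ks"
    using assms coxeter_length_eq by (simp add: reduced_word_def reduced_def)
  then show "\<exists>ls. reduced_word \<Gamma> (coxeter_word \<Gamma> ks) ls \<and> artin_word \<Gamma> ks = artin_word \<Gamma> ls" by blast
next
  fix \<omega> assume "\<exists>ls. reduced_word \<Gamma> (coxeter_word \<Gamma> ks) ls \<and> \<omega> = artin_word \<Gamma> ls"
  then obtain ls where ls: "reduced_word \<Gamma> (coxeter_word \<Gamma> ks) ls" "\<omega> = artin_word \<Gamma> ls" by blast
  then have l: "ls \<in> lists V" "act ls = act ks" "length ls = len ks"
    using coxeter_word_eq_iff coxeter_length_eq assms(1) by (auto simp: reduced_word_def)
  then have "reduced ls" using len_cong[of ls ks] by (simp add: reduced_def)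
  then have "braid_eq ls ks" using matsumoto assms(2) l(2) by blast
  then show "\<omega> = artin_word \<Gamma> ks"
    using braid_eq_pres_eq[of ls ks "braid_rels \<Gamma>"] l(1) assms(1) ls(2)
    by (simp add: artin_word_eq pres_class_eq_iff)
qed

section \<open>Parabolic subgroups as sets of words\<close>

lemma artin_parabolic_eq: "X \<subseteq> V \<Longrightarrow> artin_parabolic \<Gamma> X = pres_class V (braid_rels \<Gamma>) ` signed_words X"
  unfolding artin_parabolic_def artin_group_def artin_gen_def by (rule generate_presented_group)

lemma coxeter_class_eq:
  assumes "u \<in> signed_words V"
  shows "pres_class V (coxeter_rels \<Gamma>) u = coxeter_word \<Gamma> (map fst u)"
proof -
  have "map fst u \<in> lists V" using assms by (auto simp: in_lists_conv_set)
  then show ?thesis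
    using coxeter_pres_eq_positive[OF assms] by (simp only: coxeter_word_eq pres_class_eq_iff[OF assms])
qed

lemma coxeter_words:
  assumes "X \<subseteq> V"
  shows "pres_class V (coxeter_rels \<Gamma>) ` signed_words X = coxeter_word \<Gamma> ` lists X"
proof
  show "pres_class V (coxeter_rels \<Gamma>) ` signed_words X \<subseteq> coxeter_word \<Gamma> ` lists X"
  proof (rule image_subsetI)
    fix u assume u: "u \<in> signed_words X"
    then have "map fst u \<in> lists X" by (auto simp: in_lists_conv_set)
    then show "pres_class V (coxeter_rels \<Gamma>) u \<in> coxeter_word \<Gamma> ` lists X"
      unfolding coxeter_class_eq[OF signed_words_mono[OF assms u]] by (rule imageI)
  qed
  show "coxeter_word \<Gamma> ` lists X \<subseteq> pres_class V (coxeter_rels \<Gamma>) ` signed_words X"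
  proof (rule image_subsetI)
    fix ks assume ks: "ks \<in> lists X"
    then have "ks \<in> lists V" using assms by (auto simp: in_lists_conv_set)
    moreover have "positive_word ks \<in> signed_words X" using ks by simp
    ultimately show "coxeter_word \<Gamma> ks \<in> pres_class V (coxeter_rels \<Gamma>) ` signed_words X"
      by (simp only: coxeter_word_eq imageI)
  qed
qed

lemma coxeter_parabolic_eq:
  assumes "X \<subseteq> V"
  shows "coxeter_parabolic \<Gamma> X = coxeter_word \<Gamma> ` lists X"
  unfolding coxeter_parabolic_def coxeter_group_def coxeter_gen_def
    generate_presented_group[OF assms] coxeter_words[OF assms] ..

lemma coxeter_carrier: "carrier (coxeter_group \<Gamma>) = coxeter_word \<Gamma> ` lists V"
  unfolding coxeter_words[OF subset_refl, symmetric] coxeter_group_def presented_group_def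
  by (simp only: partial_object.simps)

lemma group_coxeter: "group (coxeter_group \<Gamma>)"
  by (simp add: coxeter_group_def group_presented_group)

lemma group_artin: "group (artin_group \<Gamma>)"
  by (simp add: artin_group_def group_presented_group)

lemma coxeter_word_append:
  assumes "ks \<in> lists V" "ls \<in> lists V"
  shows "coxeter_word \<Gamma> (ks @ ls) = coxeter_word \<Gamma> ks \<otimes>\<^bsub>coxeter_group \<Gamma>\<^esub> coxeter_word \<Gamma> ls"
  using assms presented_group_mult[of "positive_word ks" V "positive_word ls" "coxeter_rels \<Gamma>"]
  by (simp add: coxeter_word_eq coxeter_group_def)

lemma artin_word_append:
  assumes "ks \<in> lists V" "ls \<in> lists V"
  shows "artin_word \<Gamma> (ks @ ls) = artin_word \<Gamma> ks \<otimes>\<^bsub>artin_group \<Gamma>\<^esub> artin_word \<Gamma> ls"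
  using assms presented_group_mult[of "positive_word ks" V "positive_word ls" "braid_rels \<Gamma>"]
  by (simp add: artin_word_eq artin_group_def)

lemma coxeter_gen_eq: "x \<in> V \<Longrightarrow> coxeter_gen \<Gamma> x = coxeter_word \<Gamma> [x]"
  by (simp add: coxeter_word_eq coxeter_gen_def pres_gen_def)

lemma artin_word_in_parabolic:
  assumes "X \<subseteq> V" "ks \<in> lists X"
  shows "artin_word \<Gamma> ks \<in> artin_parabolic \<Gamma> X"
proof -
  have "ks \<in> lists V" using assms by (auto simp: in_lists_conv_set)
  moreover have "positive_word ks \<in> signed_words X" using assms by simp
  ultimately show ?thesis by (simp only: artin_word_eq artin_parabolic_eq[OF assms(1)] imageI)
qed

lemma subgroup_artin_parabolic:
  assumes "X \<subseteq> V"
  shows "subgroup (artin_parabolic \<Gamma> X) (artin_group \<Gamma>)"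
  unfolding artin_parabolic_def
proof (rule group.generate_is_subgroup[OF group_artin], rule image_subsetI)
  fix x assume "x \<in> X"
  then have "[(x, True)] \<in> signed_words V" using assms by auto
  then show "artin_gen \<Gamma> x \<in> carrier (artin_group \<Gamma>)"
    unfolding artin_gen_def pres_gen_def artin_group_def by (rule pres_class_in_carrier)
qed

text \<open>Minimal length in the double coset is used only through the absence of descents in \<open>X\<close> on the left and
  in \<open>Y\<close> on the right.\<close>

lemma minimal_of_double_coset_reduced:
  assumes h: "h \<in> lists V" and XY: "X \<subseteq> V" "Y \<subseteq> V"
    and dc: "double_coset_reduced \<Gamma> X Y (coxeter_word \<Gamma> h)"
  shows "left_minimal X h" "right_minimal Y h"
proof -
  have min: "len h \<le> len (a @ h @ b)" if ab: "a \<in> lists X" "b \<in> lists Y" for a b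
  proof -
    have V: "a \<in> lists V" "b \<in> lists V" using ab XY by (auto simp: in_lists_conv_set)
    have "coxeter_word \<Gamma> ((a @ h) @ b) \<in>
        (coxeter_parabolic \<Gamma> X #>\<^bsub>coxeter_group \<Gamma>\<^esub> coxeter_word \<Gamma> h) <#>\<^bsub>coxeter_group \<Gamma>\<^esub> coxeter_parabolic \<Gamma> Y"
      using ab V h coxeter_word_append[of "a @ h" b] coxeter_word_append[of a h]
      unfolding coxeter_parabolic_eq[OF XY(1)] coxeter_parabolic_eq[OF XY(2)] r_coset_def set_mult_def
      by auto
    then have "coxeter_length \<Gamma> (coxeter_word \<Gamma> h) \<le> coxeter_length \<Gamma> (coxeter_word \<Gamma> ((a @ h) @ b))"
      using dc unfolding double_coset_reduced_def by blast
    then show ?thesis using h V by (simp add: coxeter_length_eq)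
  qed
  show "left_minimal X h"
    unfolding left_minimal_def
  proof
    fix x assume "x \<in> X"
    then show "len h < len (x # h)" using min[of "[x]" "[]"] len_Cons_ne[of x h] by simp
  qed
  show "right_minimal Y h"
    unfolding right_minimal_def
  proof
    fix y assume "y \<in> Y"
    then show "len h < len (h @ [y])" using min[of "[]" "[y]"] len_snoc_cases[of h y] by auto
  qed
qed

lemma coxeter_gen_conjugate_iff:
  assumes "x \<in> V" "y \<in> V" "h \<in> lists V"
  shows "coxeter_gen \<Gamma> x = coxeter_word \<Gamma> h \<otimes>\<^bsub>coxeter_group \<Gamma>\<^esub> coxeter_gen \<Gamma> y
      \<otimes>\<^bsub>coxeter_group \<Gamma>\<^esub> inv\<^bsub>coxeter_group \<Gamma>\<^esub> (coxeter_word \<Gamma> h) \<longleftrightarrow> act (x # h) = act (h @ [y])"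
proof -
  interpret W: group "coxeter_group \<Gamma>" by (rule group_coxeter)
  have "coxeter_word \<Gamma> ks \<in> carrier (coxeter_group \<Gamma>)" if "ks \<in> lists V" for ks
    using that coxeter_carrier by blast
  then show ?thesis
    using assms coxeter_word_append[of "[x]" h] coxeter_word_append[of h "[y]"]
      coxeter_word_eq_iff[of "x # h" "h @ [y]"]
    by (simp add: coxeter_gen_eq W.eq_conjugate_iff)
qed

lemma coxeter_gen_inj:
  assumes "coxeter_gen \<Gamma> x = coxeter_gen \<Gamma> y" "x \<in> V" "y \<in> V"
  shows "x = y"
  using assms coxeter_word_eq_iff[of "[x]" "[y]"] act_snoc_inj[of "[]" x y] by (simp add: coxeter_gen_eq)

lemma conj_letters_of_conjugate_sets:
  assumes h: "h \<in> lists V" and XY: "X \<subseteq> V" "Y \<subseteq> V" and sub: "X' \<subseteq> X" "Y' \<subseteq> Y"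
    and X': "coxeter_gen \<Gamma> ` X' =
      conjugate_set (coxeter_group \<Gamma>) (coxeter_word \<Gamma> h) (coxeter_gen \<Gamma> ` Y) \<inter> coxeter_gen \<Gamma> ` X"
    and Y': "conjugate_set (coxeter_group \<Gamma>) (coxeter_word \<Gamma> h) (coxeter_gen \<Gamma> ` Y') = coxeter_gen \<Gamma> ` X'"
  shows "X' = conj_letters X Y h" "Y' = conj_letters Y X (rev h)"
proof -
  interpret W: group "coxeter_group \<Gamma>" by (rule group_coxeter)
  have conj: "coxeter_gen \<Gamma> x \<in> conjugate_set (coxeter_group \<Gamma>) (coxeter_word \<Gamma> h) (coxeter_gen \<Gamma> ` Z) \<longleftrightarrow>
      (\<exists>y\<in>Z. act (x # h) = act (h @ [y]))" if "x \<in> V" "Z \<subseteq> V" for x Z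
    unfolding W.conjugate_set_image image_image image_iff
    using coxeter_gen_conjugate_iff[OF that(1) _ h] that(2) by (intro bex_cong) auto
  have gen: "coxeter_gen \<Gamma> x \<in> coxeter_gen \<Gamma> ` Z \<longleftrightarrow> x \<in> Z" if "x \<in> V" "Z \<subseteq> V" for x Z
    using that coxeter_gen_inj by blast
  have V: "X' \<subseteq> V" "Y' \<subseteq> V" using XY sub by auto
  have 1: "x \<in> X' \<longleftrightarrow> (\<exists>y\<in>Y. act (x # h) = act (h @ [y])) \<and> x \<in> X" if "x \<in> V" for x
    using X' gen[OF that V(1)] gen[OF that XY(1)] conj[OF that XY(2)] by blast
  then show X'_eq: "X' = conj_letters X Y h" using sub XY by (auto simp: conj_letters_def)
  have 2: "x \<in> X' \<longleftrightarrow> (\<exists>y\<in>Y'. act (x # h) = act (h @ [y]))" if "x \<in> V" for x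
    using Y' gen[OF that V(1)] conj[OF that V(2)] by simp
  show "Y' = conj_letters Y X (rev h)"
    unfolding conj_letters_rev
  proof (intro equalityI subsetI)
    fix y assume y: "y \<in> Y'"
    have "coxeter_word \<Gamma> h \<otimes>\<^bsub>coxeter_group \<Gamma>\<^esub> coxeter_gen \<Gamma> y
        \<otimes>\<^bsub>coxeter_group \<Gamma>\<^esub> inv\<^bsub>coxeter_group \<Gamma>\<^esub> (coxeter_word \<Gamma> h) \<in> coxeter_gen \<Gamma> ` X'"
      unfolding Y'[symmetric] W.conjugate_set_image using y by blast
    then obtain x where x: "x \<in> X'" "coxeter_gen \<Gamma> x = coxeter_word \<Gamma> h \<otimes>\<^bsub>coxeter_group \<Gamma>\<^esub> coxeter_gen \<Gamma> y
        \<otimes>\<^bsub>coxeter_group \<Gamma>\<^esub> inv\<^bsub>coxeter_group \<Gamma>\<^esub> (coxeter_word \<Gamma> h)" by force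
    then have "act (x # h) = act (h @ [y])" using coxeter_gen_conjugate_iff h y V by blast
    then show "y \<in> {y \<in> Y. \<exists>x\<in>X. act (x # h) = act (h @ [y])}" using x y sub by blast
  next
    fix y assume "y \<in> {y \<in> Y. \<exists>x\<in>X. act (x # h) = act (h @ [y])}"
    then obtain x where x: "y \<in> Y" "x \<in> X" "act (x # h) = act (h @ [y])" by blast
    then have "x \<in> X'" using 1 XY by blast
    then obtain y' where y': "y' \<in> Y'" "act (x # h) = act (h @ [y'])" using 2 V by blast
    then have "act (h @ [y]) = act (h @ [y'])" using x by simp
    then show "y \<in> Y'" using y' act_snoc_inj by blast
  qed
qed

section \<open>Walks respect the relations of the Artin-Tits group\<close>

lemma braid_rels_subset: "braid_rels \<Gamma> \<subseteq> coxeter_rels \<Gamma>"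
  by (simp add: coxeter_rels_def)

lemma signed_output_in:
  assumes "d \<in> minimal_reps Y"
  shows "signed_output Y u d \<in> signed_words Y"
proof -
  have "set (map fst (signed_output Y u d)) \<subseteq> Y"
    unfolding map_fst_signed_output by (rule set_emitted[OF assms])
  then show ?thesis by (force simp: in_lists_conv_set)
qed

lemma signed_output_cancel:
  assumes "d \<in> minimal_reps Y" "Y \<subseteq> V"
  shows "pres_eq V R (signed_output Y [(x, b), (x, \<not> b)] d) []"
  using assms(1)
proof (cases rule: step_cases[of _ _ x])
  case free
  have "reflection x \<circ> move Y x d \<in> minimal_reps Y" using assms(1) by (simp add: free(2) o_assoc)
  then have "emit Y x (move Y x d) = []" by (simp add: emit_def)
  then show ?thesis by (simp add: free(3) pres_eq.refl)
next
  case (blocked k)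
  then have "signed_output Y [(x, b), (x, \<not> b)] d = [(k, b), (k, \<not> b)]" by simp
  then show ?thesis using pres_eq.cancel[of k V R b] blocked(1) assms(2) by auto
qed

text \<open>The output of the walk from a fixed starting point is well defined on the Artin-Tits group. Restricted to the
  start \<open>id\<close> it is a retraction of that group, as a set, onto the parabolic subgroup of \<open>Y\<close>.\<close>

theorem signed_output_pres_eq:
  assumes "pres_eq V (braid_rels \<Gamma>) u v" "d \<in> minimal_reps Y" "Y \<subseteq> V"
  shows "pres_eq V (braid_rels \<Gamma>) (signed_output Y u d) (signed_output Y v d)"
  using assms(1,2)
proof (induction arbitrary: d)
  case (rel u v)
  then obtain i j where e: "{i, j} \<in> edges \<Gamma>"
      "u = positive_word (alternating i j (label \<Gamma> {i, j}))" "v = positive_word (alternating j i (label \<Gamma> {i, j}))"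
    by (auto simp: braid_rels_def)
  let ?M = "label \<Gamma> {i, j}"
  have "braid_eq (emitted Y (alternating i j ?M) d) (emitted Y (alternating j i ?M) d)"
    using emitted_braid[OF rel.prems, of i j] edge_labelD[OF e(1)] by simp
  moreover have "emitted Y (alternating i j ?M) d \<in> lists V"
    using set_emitted[OF rel.prems, of "alternating i j ?M"] assms(3) by (auto simp: in_lists_conv_set)
  ultimately show ?case unfolding e signed_output_positive by (rule braid_eq_pres_eq) simp
next
  case (cancel x b)
  then show ?case using signed_output_cancel[OF _ assms(3)] by simp
next
  case (refl u)
  have "signed_output Y u d \<in> signed_words V"
    using signed_words_mono[OF assms(3) signed_output_in[OF refl.prems]] .
  then show ?case by (rule pres_eq.refl)
next
  case (sym u v)
  then show ?case using pres_eq.sym by blast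
next
  case (trans u v w)
  then show ?case using pres_eq.trans by blast
next
  case (append u v u' v')
  have "walk Y (map fst u') d = walk Y (map fst v') d"
    using walk_cong[OF append.prems] pres_eq_act[OF append.hyps(2) braid_rels_subset] by blast
  moreover have "walk Y (map fst u') d \<in> minimal_reps Y" using walk_in_minimal_reps append.prems by blast
  ultimately show ?case
    using append.IH(1)[of "walk Y (map fst u') d"] append.IH(2)[OF append.prems]
    unfolding signed_output_append by (metis pres_eq.append)
qed

section \<open>Intersections with conjugates by minimal double coset representatives\<close>

text \<open>Both sides are walked from \<open>id\<close>. On the right, \<open>\<beta>\<close> is put out unchanged and then the letters of \<open>h\<close>
  lead to \<open>h\<close> without output. On the left, the walk first goes to \<open>h\<close>, and from there
  the letters of \<open>X\<close> can only put out letters that \<open>h\<close> conjugates into \<open>X\<close>.\<close>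

lemma conjugated_word_reduces:
  assumes h: "h \<in> lists V" "reduced h" "left_minimal X h" "right_minimal Y h"
    and XY: "X \<subseteq> V" "Y \<subseteq> V" and \<alpha>: "\<alpha> \<in> signed_words X" and \<beta>: "\<beta> \<in> signed_words Y"
    and eq: "pres_eq V (braid_rels \<Gamma>) (\<alpha> @ positive_word h) (positive_word h @ \<beta>)"
  shows "\<exists>\<beta>'\<in>signed_words (conj_letters Y X (rev h)). pres_eq V (braid_rels \<Gamma>) \<beta>' \<beta>"
proof
  have fst_pos: "map fst (positive_word h) = h" by (simp add: o_def)
  have hwalk: "walk Y h id = act h" "signed_output Y (positive_word h) id = []"
    using walk_minimal_word[OF h(2,4)] by (simp_all only: signed_output_positive list.map)
  let ?\<beta> = "signed_output Y \<alpha> (act h)"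
  have "signed_output Y (\<alpha> @ positive_word h) id = ?\<beta>"
    by (simp only: signed_output_append fst_pos hwalk append_Nil2)
  moreover have "signed_output Y (positive_word h @ \<beta>) id = \<beta>"
    using signed_output_parabolic[OF \<beta>] by (simp only: signed_output_append hwalk append_Nil)
  ultimately show "pres_eq V (braid_rels \<Gamma>) ?\<beta> \<beta>"
    using signed_output_pres_eq[OF eq id_in_minimal_reps XY(2)] by simp
  have dh: "act h \<in> minimal_reps Y" using h(4) act_in_minimal_reps by blast
  have \<alpha>X: "set (map fst \<alpha>) \<subseteq> X" using \<alpha> by (auto simp: in_lists_conv_set)
  have "set (emitted Y (map fst \<alpha>) (act h)) \<subseteq> conj_letters Y X (rev h)"
  proof
    fix k assume "k \<in> set (emitted Y (map fst \<alpha>) (act h))"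
    then have "k \<in> Y \<and> (\<exists>b\<in>X. act (b # h) = act (h @ [k]))"
      using emitted_letters[OF h(3,4) dh, of "[]" "map fst \<alpha>" k] \<alpha>X by simp
    then show "k \<in> conj_letters Y X (rev h)" unfolding conj_letters_rev by simp
  qed
  then have "set (map fst ?\<beta>) \<subseteq> conj_letters Y X (rev h)" by (simp only: map_fst_signed_output)
  then show "?\<beta> \<in> signed_words (conj_letters Y X (rev h))" by (force simp: in_lists_conv_set)
qed

text \<open>For a positive letter, both sides come from reduced words of the same element of the Coxeter group.
  The case of an inverse letter follows by cancellation on both sides.\<close>

lemma conjugated_letter:
  assumes h: "h \<in> lists V" "reduced h" "right_minimal Y h"
    and xy: "x \<in> V" "y \<in> Y" "Y \<subseteq> V" and eq: "act (x # h) = act (h @ [y])"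
  shows "pres_eq V (braid_rels \<Gamma>) ([(x, b)] @ positive_word h) (positive_word h @ [(y, b)])"
proof -
  let ?R = "braid_rels \<Gamma>" and ?h = "positive_word h"
  have y: "y \<in> V" using xy by blast
  have "len (h @ [y]) = Suc (len h)"
    using h(3) xy(2) len_snoc_cases[of h y] by (auto simp: right_minimal_def)
  then have "reduced (x # h)" "reduced (h @ [y])" using h(2) len_cong[OF eq] by (simp_all add: reduced_def)
  then have "braid_eq (x # h) (h @ [y])" using matsumoto eq by blast
  then have pos: "pres_eq V ?R ([(x, True)] @ ?h) (?h @ [(y, True)])"
    using braid_eq_pres_eq[of "x # h" "h @ [y]" ?R] h(1) xy(1) by simp
  have w: "?h \<in> signed_words V" "[(x, c)] \<in> signed_words V" "[(y, c)] \<in> signed_words V" for c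
    using h(1) xy(1) y by simp_all
  show ?thesis
  proof (cases b)
    case True
    then show ?thesis using pos by simp
  next
    case False
    have "pres_eq V ?R ([(x, False)] @ ([(x, True)] @ ?h) @ [(y, False)]) ([(x, False)] @ (?h @ [(y, True)]) @ [(y, False)])"
      by (rule pres_eq_context[OF pos w(2,3)])
    moreover have "pres_eq V ?R ([] @ [(x, False), (x, \<not> False)] @ ?h @ [(y, False)]) ([] @ [] @ ?h @ [(y, False)])"
      using w pres_eq.cancel[OF xy(1), of ?R False] by (intro pres_eq_context) auto
    moreover have "pres_eq V ?R (([(x, False)] @ ?h) @ [(y, True), (y, \<not> True)] @ []) (([(x, False)] @ ?h) @ [] @ [])"
      using w pres_eq.cancel[OF y, of ?R True] by (intro pres_eq_context) auto
    ultimately have "pres_eq V ?R ([(x, False)] @ ?h) (?h @ [(y, False)])"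
      by (simp del: in_lists_conv_set) (meson pres_eq.sym pres_eq.trans)
    then show ?thesis using False by simp
  qed
qed

lemma conjugated_words:
  assumes h: "h \<in> lists V" "reduced h" "right_minimal Y h" and XY: "X \<subseteq> V" "Y \<subseteq> V"
  shows "\<alpha> \<in> signed_words (conj_letters X Y h) \<Longrightarrow>
      \<exists>\<beta>\<in>signed_words (conj_letters Y X (rev h)). pres_eq V (braid_rels \<Gamma>) (\<alpha> @ positive_word h) (positive_word h @ \<beta>)"
    and "\<beta> \<in> signed_words (conj_letters Y X (rev h)) \<Longrightarrow>
      \<exists>\<alpha>\<in>signed_words (conj_letters X Y h). pres_eq V (braid_rels \<Gamma>) (\<alpha> @ positive_word h) (positive_word h @ \<beta>)"
proof -
  let ?R = "braid_rels \<Gamma>" and ?h = "positive_word h"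
  have hV: "?h \<in> signed_words V" using h(1) by simp
  have step: "pres_eq V ?R (((x, b) # \<alpha>) @ ?h) (?h @ ((y, b) # \<beta>))"
    if a: "pres_eq V ?R (\<alpha> @ ?h) (?h @ \<beta>)" and xy: "x \<in> X" "y \<in> Y" "act (x # h) = act (h @ [y])" for x y b \<alpha> \<beta>
  proof -
    have xy': "x \<in> V" "y \<in> V" using XY xy by auto
    have "?h @ \<beta> \<in> signed_words V" using pres_eq_words[OF a] by simp
    then have \<beta>: "\<beta> \<in> signed_words V" by (simp only: append_in_lists_conv)
    have "pres_eq V ?R ([(x, b)] @ (\<alpha> @ ?h)) ([(x, b)] @ (?h @ \<beta>))"
      using xy' by (intro pres_eq.append[OF pres_eq.refl a]) simp
    moreover have "pres_eq V ?R (([(x, b)] @ ?h) @ \<beta>) ((?h @ [(y, b)]) @ \<beta>)"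
      using conjugated_letter[OF h xy'(1) xy(2) XY(2) xy(3)] by (rule pres_eq.append[OF _ pres_eq.refl[OF \<beta>]])
    ultimately show ?thesis using pres_eq.trans by fastforce
  qed
  have conj: "conj_letters X Y h = {x \<in> X. \<exists>y\<in>Y. act (x # h) = act (h @ [y])}" by (simp add: conj_letters_def)
  show "\<exists>\<beta>\<in>signed_words (conj_letters Y X (rev h)). pres_eq V ?R (\<alpha> @ ?h) (?h @ \<beta>)"
    if "\<alpha> \<in> signed_words (conj_letters X Y h)" for \<alpha>
    using that
  proof (induction \<alpha> rule: list.induct)
    case Nil
    have "pres_eq V ?R ([] @ ?h) (?h @ [])" using pres_eq.refl[OF hV] by simp
    then show ?case by (rule bexI) simp
  next
    case (Cons a \<alpha>)
    obtain x b where a: "a = (x, b)" by force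
    obtain \<beta> where \<beta>: "\<beta> \<in> signed_words (conj_letters Y X (rev h))" "pres_eq V ?R (\<alpha> @ ?h) (?h @ \<beta>)"
      using Cons by auto
    obtain y where y: "x \<in> X" "y \<in> Y" "act (x # h) = act (h @ [y])" using Cons.prems by (auto simp: a conj)
    then have "y \<in> conj_letters Y X (rev h)" by (auto simp: conj_letters_rev)
    then have "(y, b) # \<beta> \<in> signed_words (conj_letters Y X (rev h))" using \<beta>(1) by simp
    then show ?case using step[OF \<beta>(2) y, of b] unfolding a by (rule rev_bexI)
  qed
  show "\<exists>\<alpha>\<in>signed_words (conj_letters X Y h). pres_eq V ?R (\<alpha> @ ?h) (?h @ \<beta>)"
    if "\<beta> \<in> signed_words (conj_letters Y X (rev h))" for \<beta>
    using that
  proof (induction \<beta> rule: list.induct)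
    case Nil
    have "pres_eq V ?R ([] @ ?h) (?h @ [])" using pres_eq.refl[OF hV] by simp
    then show ?case by (rule bexI) simp
  next
    case (Cons a \<beta>)
    obtain y b where a: "a = (y, b)" by force
    obtain \<alpha> where \<alpha>: "\<alpha> \<in> signed_words (conj_letters X Y h)" "pres_eq V ?R (\<alpha> @ ?h) (?h @ \<beta>)"
      using Cons by auto
    obtain x where y: "x \<in> X" "y \<in> Y" "act (x # h) = act (h @ [y])"
      using Cons.prems by (auto simp: a conj_letters_rev)
    then have "x \<in> conj_letters X Y h" by (auto simp: conj)
    then have "(x, b) # \<alpha> \<in> signed_words (conj_letters X Y h)" using \<alpha>(1) by simp
    then show ?case using step[OF \<alpha>(2) y, of b] unfolding a by (rule rev_bexI)
  qed
qed

theorem parabolic_Int_minimal_conjugate: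
  assumes h: "h \<in> lists V" "reduced h" "left_minimal X h" "right_minimal Y h" and XY: "X \<subseteq> V" "Y \<subseteq> V"
  shows "conjugate_set (artin_group \<Gamma>) (artin_word \<Gamma> h) (artin_parabolic \<Gamma> Y) \<inter> artin_parabolic \<Gamma> X =
      artin_parabolic \<Gamma> (conj_letters X Y h)" (is ?left)
    and "conjugate_set (artin_group \<Gamma>) (inv\<^bsub>artin_group \<Gamma>\<^esub> (artin_word \<Gamma> h)) (artin_parabolic \<Gamma> X) \<inter> artin_parabolic \<Gamma> Y =
      artin_parabolic \<Gamma> (conj_letters Y X (rev h))" (is ?right)
proof -
  interpret A: group "artin_group \<Gamma>" by (rule group_artin)
  let ?R = "braid_rels \<Gamma>" and ?G = "artin_group \<Gamma>" and ?k = "artin_word \<Gamma> h" and ?h = "positive_word h"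
  let ?X = "conj_letters X Y h" and ?Y = "conj_letters Y X (rev h)"
  let ?c = "pres_class V ?R"
  have sub: "?X \<subseteq> X" "?Y \<subseteq> Y" by (auto simp: conj_letters_def)
  have subV: "?X \<subseteq> V" "?Y \<subseteq> V" using sub XY by blast+
  have hV: "?h \<in> signed_words V" using h(1) by simp
  have k: "?k = ?c ?h" using h(1) by (rule artin_word_eq)
  have kc: "?k \<in> carrier ?G" unfolding k artin_group_def using hV by (rule pres_class_in_carrier)
  have par: "artin_parabolic \<Gamma> Z = ?c ` signed_words Z" if "Z \<subseteq> V" for Z
    using artin_parabolic_eq[OF that] .
  have parc: "artin_parabolic \<Gamma> Z \<subseteq> carrier ?G" if "Z \<subseteq> V" for Z
    using subgroup.subset[OF subgroup_artin_parabolic[OF that]] .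
  have words: "?c \<alpha> \<otimes>\<^bsub>?G\<^esub> ?k = ?k \<otimes>\<^bsub>?G\<^esub> ?c \<beta> \<longleftrightarrow> pres_eq V ?R (\<alpha> @ ?h) (?h @ \<beta>)"
    if "\<alpha> \<in> signed_words V" "\<beta> \<in> signed_words V" for \<alpha> \<beta>
    using that hV unfolding k artin_group_def
    by (simp only: presented_group_mult pres_class_eq_iff append_in_lists_conv simp_thms)
  \<comment> \<open>Everything is expressed by the relation \<open>g k = k s\<close> between \<open>g\<close> in one parabolic
    subgroup and \<open>s\<close> in the other one.\<close>
  have up: "\<exists>s\<in>artin_parabolic \<Gamma> ?Y. g \<otimes>\<^bsub>?G\<^esub> ?k = ?k \<otimes>\<^bsub>?G\<^esub> s" if g: "g \<in> artin_parabolic \<Gamma> ?X" for g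
  proof -
    obtain \<alpha> where \<alpha>: "\<alpha> \<in> signed_words ?X" "g = ?c \<alpha>" using g unfolding par[OF subV(1)] by blast
    obtain \<beta> where \<beta>: "\<beta> \<in> signed_words ?Y" "pres_eq V ?R (\<alpha> @ ?h) (?h @ \<beta>)"
      using conjugated_words(1)[OF h(1,2,4) XY \<alpha>(1)] by blast
    have "\<alpha> \<in> signed_words V" "\<beta> \<in> signed_words V"
      using signed_words_mono[OF subV(1) \<alpha>(1)] signed_words_mono[OF subV(2) \<beta>(1)] .
    then have "g \<otimes>\<^bsub>?G\<^esub> ?k = ?k \<otimes>\<^bsub>?G\<^esub> ?c \<beta>" using words \<alpha>(2) \<beta>(2) by blast
    moreover have "?c \<beta> \<in> artin_parabolic \<Gamma> ?Y" unfolding par[OF subV(2)] using \<beta>(1) by (rule imageI)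
    ultimately show ?thesis by blast
  qed
  have down: "\<exists>g\<in>artin_parabolic \<Gamma> ?X. g \<otimes>\<^bsub>?G\<^esub> ?k = ?k \<otimes>\<^bsub>?G\<^esub> s" if s: "s \<in> artin_parabolic \<Gamma> ?Y" for s
  proof -
    obtain \<beta> where \<beta>: "\<beta> \<in> signed_words ?Y" "s = ?c \<beta>" using s unfolding par[OF subV(2)] by blast
    obtain \<alpha> where \<alpha>: "\<alpha> \<in> signed_words ?X" "pres_eq V ?R (\<alpha> @ ?h) (?h @ \<beta>)"
      using conjugated_words(2)[OF h(1,2,4) XY \<beta>(1)] by blast
    have "\<alpha> \<in> signed_words V" "\<beta> \<in> signed_words V"
      using signed_words_mono[OF subV(1) \<alpha>(1)] signed_words_mono[OF subV(2) \<beta>(1)] .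
    then have "?c \<alpha> \<otimes>\<^bsub>?G\<^esub> ?k = ?k \<otimes>\<^bsub>?G\<^esub> s" using words \<alpha>(2) \<beta>(2) by blast
    moreover have "?c \<alpha> \<in> artin_parabolic \<Gamma> ?X" unfolding par[OF subV(1)] using \<alpha>(1) by (rule imageI)
    ultimately show ?thesis by blast
  qed
  have key: "s \<in> artin_parabolic \<Gamma> ?Y"
    if gs: "g \<in> artin_parabolic \<Gamma> X" "s \<in> artin_parabolic \<Gamma> Y" "g \<otimes>\<^bsub>?G\<^esub> ?k = ?k \<otimes>\<^bsub>?G\<^esub> s" for g s
  proof -
    obtain \<alpha> where \<alpha>: "\<alpha> \<in> signed_words X" "g = ?c \<alpha>" using gs(1) unfolding par[OF XY(1)] by blast
    obtain \<beta> where \<beta>: "\<beta> \<in> signed_words Y" "s = ?c \<beta>" using gs(2) unfolding par[OF XY(2)] by blast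
    have V: "\<alpha> \<in> signed_words V" "\<beta> \<in> signed_words V"
      using signed_words_mono[OF XY(1) \<alpha>(1)] signed_words_mono[OF XY(2) \<beta>(1)] .
    then have "pres_eq V ?R (\<alpha> @ ?h) (?h @ \<beta>)" using words gs(3) \<alpha>(2) \<beta>(2) by blast
    then obtain \<beta>' where \<beta>': "\<beta>' \<in> signed_words ?Y" "pres_eq V ?R \<beta>' \<beta>"
      using conjugated_word_reduces[OF h XY \<alpha>(1) \<beta>(1)] by blast
    then have "s = ?c \<beta>'" using \<beta>(2) pres_class_eq_iff[of \<beta>' V ?R \<beta>] pres_eq_words[OF \<beta>'(2)] by simp
    then show ?thesis unfolding par[OF subV(2)] using \<beta>'(1) by blast
  qed
  have parsub: "artin_parabolic \<Gamma> ?X \<subseteq> artin_parabolic \<Gamma> X" "artin_parabolic \<Gamma> ?Y \<subseteq> artin_parabolic \<Gamma> Y"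
    unfolding par[OF subV(1)] par[OF XY(1)] par[OF subV(2)] par[OF XY(2)]
    by (rule image_mono, rule subsetI, rule signed_words_mono[OF sub(1)], assumption,
      rule image_mono, rule subsetI, rule signed_words_mono[OF sub(2)], assumption)
  have conj: "g = ?k \<otimes>\<^bsub>?G\<^esub> s \<otimes>\<^bsub>?G\<^esub> inv\<^bsub>?G\<^esub> ?k \<longleftrightarrow> g \<otimes>\<^bsub>?G\<^esub> ?k = ?k \<otimes>\<^bsub>?G\<^esub> s"
    "s = inv\<^bsub>?G\<^esub> ?k \<otimes>\<^bsub>?G\<^esub> g \<otimes>\<^bsub>?G\<^esub> inv\<^bsub>?G\<^esub> (inv\<^bsub>?G\<^esub> ?k) \<longleftrightarrow> g \<otimes>\<^bsub>?G\<^esub> ?k = ?k \<otimes>\<^bsub>?G\<^esub> s"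
    if "g \<in> artin_parabolic \<Gamma> X" "s \<in> artin_parabolic \<Gamma> Y" for g s
  proof -
    have c: "g \<in> carrier ?G" "s \<in> carrier ?G" using that parc XY by blast+
    show "g = ?k \<otimes>\<^bsub>?G\<^esub> s \<otimes>\<^bsub>?G\<^esub> inv\<^bsub>?G\<^esub> ?k \<longleftrightarrow> g \<otimes>\<^bsub>?G\<^esub> ?k = ?k \<otimes>\<^bsub>?G\<^esub> s"
      using A.eq_conjugate_iff[OF kc c] .
    show "s = inv\<^bsub>?G\<^esub> ?k \<otimes>\<^bsub>?G\<^esub> g \<otimes>\<^bsub>?G\<^esub> inv\<^bsub>?G\<^esub> (inv\<^bsub>?G\<^esub> ?k) \<longleftrightarrow> g \<otimes>\<^bsub>?G\<^esub> ?k = ?k \<otimes>\<^bsub>?G\<^esub> s"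
      using c kc A.inv_solve_left[of s ?k "g \<otimes>\<^bsub>?G\<^esub> ?k"] by (auto simp: A.m_assoc)
  qed
  show ?left
  proof (intro equalityI subsetI)
    fix g assume "g \<in> conjugate_set ?G ?k (artin_parabolic \<Gamma> Y) \<inter> artin_parabolic \<Gamma> X"
    then obtain s where s: "s \<in> artin_parabolic \<Gamma> Y" "g = ?k \<otimes>\<^bsub>?G\<^esub> s \<otimes>\<^bsub>?G\<^esub> inv\<^bsub>?G\<^esub> ?k" and g: "g \<in> artin_parabolic \<Gamma> X"
      unfolding A.conjugate_set_image by blast
    then have gs: "g \<otimes>\<^bsub>?G\<^esub> ?k = ?k \<otimes>\<^bsub>?G\<^esub> s" using conj(1)[OF g s(1)] by blast
    then obtain g' where g': "g' \<in> artin_parabolic \<Gamma> ?X" "g' \<otimes>\<^bsub>?G\<^esub> ?k = ?k \<otimes>\<^bsub>?G\<^esub> s"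
      using down[OF key[OF g s(1) gs]] by blast
    have "g \<in> carrier ?G" "g' \<in> carrier ?G" using parc[OF XY(1)] parsub(1) g g'(1) by blast+
    then have "g = g'" using gs g'(2) A.right_cancel[OF kc, of g g'] by blast
    then show "g \<in> artin_parabolic \<Gamma> ?X" using g' by simp
  next
    fix g assume g: "g \<in> artin_parabolic \<Gamma> ?X"
    then obtain s where s: "s \<in> artin_parabolic \<Gamma> ?Y" "g \<otimes>\<^bsub>?G\<^esub> ?k = ?k \<otimes>\<^bsub>?G\<^esub> s" using up by blast
    then have "g = ?k \<otimes>\<^bsub>?G\<^esub> s \<otimes>\<^bsub>?G\<^esub> inv\<^bsub>?G\<^esub> ?k" using conj(1)[of g s] g parsub by blast
    then show "g \<in> conjugate_set ?G ?k (artin_parabolic \<Gamma> Y) \<inter> artin_parabolic \<Gamma> X"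
      unfolding A.conjugate_set_image using g s parsub by blast
  qed
  show ?right
  proof (intro equalityI subsetI)
    fix s assume "s \<in> conjugate_set ?G (inv\<^bsub>?G\<^esub> ?k) (artin_parabolic \<Gamma> X) \<inter> artin_parabolic \<Gamma> Y"
    then obtain g where g: "g \<in> artin_parabolic \<Gamma> X" "s = inv\<^bsub>?G\<^esub> ?k \<otimes>\<^bsub>?G\<^esub> g \<otimes>\<^bsub>?G\<^esub> inv\<^bsub>?G\<^esub> (inv\<^bsub>?G\<^esub> ?k)"
      and s: "s \<in> artin_parabolic \<Gamma> Y"
      unfolding A.conjugate_set_image by blast
    then show "s \<in> artin_parabolic \<Gamma> ?Y" using key[OF g(1) s] conj(2)[OF g(1) s] by blast
  next
    fix s assume s: "s \<in> artin_parabolic \<Gamma> ?Y"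
    then obtain g where g: "g \<in> artin_parabolic \<Gamma> ?X" "g \<otimes>\<^bsub>?G\<^esub> ?k = ?k \<otimes>\<^bsub>?G\<^esub> s" using down by blast
    then have "s = inv\<^bsub>?G\<^esub> ?k \<otimes>\<^bsub>?G\<^esub> g \<otimes>\<^bsub>?G\<^esub> inv\<^bsub>?G\<^esub> (inv\<^bsub>?G\<^esub> ?k)" using conj(2)[of g s] s parsub by blast
    then show "s \<in> conjugate_set ?G (inv\<^bsub>?G\<^esub> ?k) (artin_parabolic \<Gamma> X) \<inter> artin_parabolic \<Gamma> Y"
      unfolding A.conjugate_set_image using g s parsub by blast
  qed
qed

theorem parabolic_Int_conjugate:
  assumes w: "w \<in> carrier (coxeter_group \<Gamma>)" and XY: "X \<subseteq> V" "Y \<subseteq> V"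
    and w_eq: "w = w1 \<otimes>\<^bsub>coxeter_group \<Gamma>\<^esub> w2 \<otimes>\<^bsub>coxeter_group \<Gamma>\<^esub> w3"
    and w1: "w1 \<in> coxeter_parabolic \<Gamma> X" and w3: "w3 \<in> coxeter_parabolic \<Gamma> Y"
    and dc: "double_coset_reduced \<Gamma> X Y w2"
    and sub: "X' \<subseteq> X" "Y' \<subseteq> Y"
    and X': "coxeter_gen \<Gamma> ` X' = conjugate_set (coxeter_group \<Gamma>) w2 (coxeter_gen \<Gamma> ` Y) \<inter> coxeter_gen \<Gamma> ` X"
    and Y': "conjugate_set (coxeter_group \<Gamma>) w2 (coxeter_gen \<Gamma> ` Y') = coxeter_gen \<Gamma> ` X'"
  shows "conjugate_set (artin_group \<Gamma>) (kappa \<Gamma> w) (artin_parabolic \<Gamma> Y) \<inter> artin_parabolic \<Gamma> X =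
      conjugate_set (artin_group \<Gamma>) (kappa \<Gamma> w1) (artin_parabolic \<Gamma> X')" (is ?left)
    and "conjugate_set (artin_group \<Gamma>) (inv\<^bsub>artin_group \<Gamma>\<^esub> (kappa \<Gamma> w)) (artin_parabolic \<Gamma> X) \<inter> artin_parabolic \<Gamma> Y =
      conjugate_set (artin_group \<Gamma>) (inv\<^bsub>artin_group \<Gamma>\<^esub> (kappa \<Gamma> w3)) (artin_parabolic \<Gamma> Y')" (is ?right)
proof -
  interpret A: group "artin_group \<Gamma>" by (rule group_artin)
  let ?G = "artin_group \<Gamma>"
  have lists_V: "ks \<in> lists V" if "set ks \<subseteq> Z" "Z \<subseteq> V" for ks Z using that by (auto simp: lists_eq_set)
  obtain a where a: "a \<in> lists X" "w1 = coxeter_word \<Gamma> a" using w1 coxeter_parabolic_eq[OF XY(1)] by blast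
  obtain b where b: "b \<in> lists Y" "w3 = coxeter_word \<Gamma> b" using w3 coxeter_parabolic_eq[OF XY(2)] by blast
  have aX: "set a \<subseteq> X" and bY: "set b \<subseteq> Y" using a(1) b(1) by (simp_all add: lists_eq_set)
  have aV: "a \<in> lists V" and bV: "b \<in> lists V" using lists_V aX bY XY by blast+
  have "w2 \<in> carrier (coxeter_group \<Gamma>)" using dc by (simp add: double_coset_reduced_def)
  then obtain h0 where h0: "h0 \<in> lists V" "w2 = coxeter_word \<Gamma> h0" using coxeter_carrier by blast
  obtain h where h: "h \<in> lists V" "act h = act h0" "length h = len h0" using reduced_word_in_verts[OF h0(1)] .
  have w2: "w2 = coxeter_word \<Gamma> h" using h0 h coxeter_word_eq_iff by blast
  have hred: "reduced h" using h(3) len_cong[OF h(2)] by (simp add: reduced_def)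
  note hmin = minimal_of_double_coset_reduced[OF h(1) XY dc[unfolded w2]]
  have letters: "X' = conj_letters X Y h" "Y' = conj_letters Y X (rev h)"
    using conj_letters_of_conjugate_sets[OF h(1) XY sub X'[unfolded w2] Y'[unfolded w2]] .
  have w: "w = coxeter_word \<Gamma> (a @ h @ b)"
    using aV bV h(1) coxeter_word_append[of a h] coxeter_word_append[of "a @ h" b] by (simp add: w_eq a b w2)
  have XV: "X' \<subseteq> V" "Y' \<subseteq> V" using sub XY by blast+
  have kappa_w: "kappa \<Gamma> w = artin_word \<Gamma> u \<otimes>\<^bsub>?G\<^esub> artin_word \<Gamma> h \<otimes>\<^bsub>?G\<^esub> artin_word \<Gamma> v"
    if "act (a @ h @ b) = act (u @ h @ v)" "reduced (u @ h @ v)" "u \<in> lists V" "v \<in> lists V" for u v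
  proof -
    have uhv: "u @ h @ v \<in> lists V" "a @ h @ b \<in> lists V" using that aV bV h(1) by simp_all
    then have "w = coxeter_word \<Gamma> (u @ h @ v)" unfolding w using coxeter_word_eq_iff that(1) by blast
    then have "kappa \<Gamma> w = artin_word \<Gamma> (u @ h @ v)" using kappa_eq[OF uhv(1) that(2)] by simp
    then show ?thesis
      using that h(1) artin_word_append[of u h] artin_word_append[of "u @ h" v] by simp
  qed
  have kappa_pair: "kappa \<Gamma> (coxeter_word \<Gamma> ks) = artin_word \<Gamma> xs \<otimes>\<^bsub>?G\<^esub> artin_word \<Gamma> ys"
    if "act ks = act (xs @ ys)" "reduced (xs @ ys)" "xs \<in> lists V" "ys \<in> lists V" "ks \<in> lists V" for ks xs ys
  proof -
    have xy: "xs @ ys \<in> lists V" using that by simp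
    then have "coxeter_word \<Gamma> ks = coxeter_word \<Gamma> (xs @ ys)" using coxeter_word_eq_iff that by blast
    then show ?thesis using kappa_eq[OF xy that(2)] artin_word_append[OF that(3,4)] by simp
  qed
  have in_par: "artin_word \<Gamma> ks \<in> artin_parabolic \<Gamma> Z" if "set ks \<subseteq> Z" "Z \<subseteq> V" for ks Z
    using artin_word_in_parabolic[OF that(2)] that(1) by (simp add: lists_eq_set)
  have in_G: "artin_word \<Gamma> ks \<in> carrier ?G" if "ks \<in> lists V" for ks
    using artin_word_in_parabolic[OF subset_refl that] subgroup.mem_carrier[OF subgroup_artin_parabolic[OF subset_refl]] by blast
  note sgX = subgroup_artin_parabolic[OF XY(1)] and sgY = subgroup_artin_parabolic[OF XY(2)]
  show ?left
  proof -
    obtain u c v where f: "set u \<subseteq> X" "set c \<subseteq> conj_letters X Y h" "set v \<subseteq> Y"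
      "act (a @ h @ b) = act (u @ h @ v)" "reduced (u @ h @ v)" "act a = act (u @ c)" "reduced (u @ c)"
      using double_coset_factorization[OF hmin hred aX bY] by blast
    have c: "set c \<subseteq> X'" using f(2) letters(1) by simp
    have V: "u \<in> lists V" "v \<in> lists V" "c \<in> lists V"
      using lists_V[OF f(1) XY(1)] lists_V[OF f(3) XY(2)] lists_V[OF c XV(1)] .
    have "conjugate_set ?G (artin_word \<Gamma> u \<otimes>\<^bsub>?G\<^esub> artin_word \<Gamma> h \<otimes>\<^bsub>?G\<^esub> artin_word \<Gamma> v) (artin_parabolic \<Gamma> Y)
        \<inter> artin_parabolic \<Gamma> X = conjugate_set ?G (artin_word \<Gamma> u \<otimes>\<^bsub>?G\<^esub> artin_word \<Gamma> c) (artin_parabolic \<Gamma> X')"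
    proof (rule A.conjugate_set_Int_subgroup[OF sgY sgX subgroup_artin_parabolic[OF XV(1)]])
      show "conjugate_set ?G (artin_word \<Gamma> h) (artin_parabolic \<Gamma> Y) \<inter> artin_parabolic \<Gamma> X = artin_parabolic \<Gamma> X'"
        unfolding letters(1) by (rule parabolic_Int_minimal_conjugate(1)[OF h(1) hred hmin XY])
    qed (use in_par[OF f(1) XY(1)] in_par[OF f(3) XY(2)] in_par[OF c XV(1)] in_G[OF h(1)] in simp_all)
    then show ?thesis
      using kappa_w[OF f(4,5) V(1,2)] kappa_pair[OF f(6,7) V(1,3) aV] a(2) by simp
  qed
  show ?right
  proof -
    obtain u c v where f: "set u \<subseteq> X" "set c \<subseteq> conj_letters Y X (rev h)" "set v \<subseteq> Y"
      "act (a @ h @ b) = act (u @ h @ v)" "reduced (u @ h @ v)" "act b = act (c @ v)" "reduced (c @ v)"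
      using double_coset_factorization_right[OF hmin hred aX bY] by blast
    have c: "set c \<subseteq> Y'" using f(2) letters(2) by simp
    have V: "u \<in> lists V" "v \<in> lists V" "c \<in> lists V"
      using lists_V[OF f(1) XY(1)] lists_V[OF f(3) XY(2)] lists_V[OF c XV(2)] .
    let ?u = "inv\<^bsub>?G\<^esub> (artin_word \<Gamma> u)" and ?h = "inv\<^bsub>?G\<^esub> (artin_word \<Gamma> h)"
      and ?v = "inv\<^bsub>?G\<^esub> (artin_word \<Gamma> v)" and ?c = "inv\<^bsub>?G\<^esub> (artin_word \<Gamma> c)"
    note sgY' = subgroup_artin_parabolic[OF XV(2)]
    have "conjugate_set ?G (?v \<otimes>\<^bsub>?G\<^esub> ?h \<otimes>\<^bsub>?G\<^esub> ?u) (artin_parabolic \<Gamma> X) \<inter> artin_parabolic \<Gamma> Y =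
        conjugate_set ?G (?v \<otimes>\<^bsub>?G\<^esub> ?c) (artin_parabolic \<Gamma> Y')"
    proof (rule A.conjugate_set_Int_subgroup[OF sgX sgY sgY'])
      show "conjugate_set ?G ?h (artin_parabolic \<Gamma> X) \<inter> artin_parabolic \<Gamma> Y = artin_parabolic \<Gamma> Y'"
        unfolding letters(2) by (rule parabolic_Int_minimal_conjugate(2)[OF h(1) hred hmin XY])
      show "?v \<in> artin_parabolic \<Gamma> Y" by (rule subgroup.m_inv_closed[OF sgY in_par[OF f(3) XY(2)]])
      show "?u \<in> artin_parabolic \<Gamma> X" by (rule subgroup.m_inv_closed[OF sgX in_par[OF f(1) XY(1)]])
      show "?c \<in> artin_parabolic \<Gamma> Y'" by (rule subgroup.m_inv_closed[OF sgY' in_par[OF c XV(2)]])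
      show "?h \<in> carrier ?G" using in_G[OF h(1)] by simp
    qed
    moreover have "inv\<^bsub>?G\<^esub> (kappa \<Gamma> w) = ?v \<otimes>\<^bsub>?G\<^esub> ?h \<otimes>\<^bsub>?G\<^esub> ?u"
      using kappa_w[OF f(4,5) V(1,2)] in_G[OF V(1)] in_G[OF V(2)] in_G[OF h(1)]
      by (simp add: A.inv_mult_group A.m_assoc)
    moreover have "inv\<^bsub>?G\<^esub> (kappa \<Gamma> w3) = ?v \<otimes>\<^bsub>?G\<^esub> ?c"
      using kappa_pair[OF f(6,7) V(3,2) bV] in_G[OF V(3)] in_G[OF V(2)] b(2)
      by (simp add: A.inv_mult_group)
    ultimately show ?thesis by simp
  qed
qed

end

theorem proposition3p3:
  fixes \<Gamma> :: "'a labelled_graph"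
    and X Y X\<^sub>1 Y\<^sub>1 :: "'a set"
    and w w\<^sub>1 w\<^sub>2 w\<^sub>2' \<omega> \<omega>\<^sub>1 \<omega>\<^sub>2' :: "'a signed_word set"
  assumes "finite_labelled_graph \<Gamma>"
    and "X \<subseteq> verts \<Gamma>" and "Y \<subseteq> verts \<Gamma>"
    and "w \<in> carrier (coxeter_group \<Gamma>)"
    and "w = w\<^sub>1 \<otimes>\<^bsub>coxeter_group \<Gamma>\<^esub> w\<^sub>2 \<otimes>\<^bsub>coxeter_group \<Gamma>\<^esub> w\<^sub>2'"
    and "w\<^sub>1 \<in> coxeter_parabolic \<Gamma> X" and "w\<^sub>2' \<in> coxeter_parabolic \<Gamma> Y"
    and "double_coset_reduced \<Gamma> X Y w\<^sub>2"
    and "\<omega> = kappa \<Gamma> w" and "\<omega>\<^sub>1 = kappa \<Gamma> w\<^sub>1" and "\<omega>\<^sub>2' = kappa \<Gamma> w\<^sub>2'"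
    and "X\<^sub>1 \<subseteq> X" and "Y\<^sub>1 \<subseteq> Y"
    and "coxeter_gen \<Gamma> ` X\<^sub>1 =
      conjugate_set (coxeter_group \<Gamma>) w\<^sub>2 (coxeter_gen \<Gamma> ` Y) \<inter> coxeter_gen \<Gamma> ` X"
    and "conjugate_set (coxeter_group \<Gamma>) w\<^sub>2 (coxeter_gen \<Gamma> ` Y\<^sub>1) = coxeter_gen \<Gamma> ` X\<^sub>1"
  shows "conjugate_set (artin_group \<Gamma>) \<omega> (artin_parabolic \<Gamma> Y) \<inter> artin_parabolic \<Gamma> X =
      conjugate_set (artin_group \<Gamma>) \<omega>\<^sub>1 (artin_parabolic \<Gamma> X\<^sub>1) \<and>
    conjugate_set (artin_group \<Gamma>) (inv\<^bsub>artin_group \<Gamma>\<^esub> \<omega>) (artin_parabolic \<Gamma> X) \<inter> artin_parabolic \<Gamma> Y =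
      conjugate_set (artin_group \<Gamma>) (inv\<^bsub>artin_group \<Gamma>\<^esub> \<omega>\<^sub>2') (artin_parabolic \<Gamma> Y\<^sub>1)"
proof -
  interpret artin_graph \<Gamma> by unfold_locales fact
  show ?thesis
    unfolding assms(9-11)
    using parabolic_Int_conjugate[OF assms(4,2,3,5,6,7,8,12,13,14,15)] by (rule conjI)
qed

end
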